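(* For all integers $k,n \geq 1$ and $\overline{\Delta} \geq 0$, every strongly $k$-connected $n$-vertex digraph $D$ with $\overline{\Delta}(D) \leq \overline{\Delta}$ contains a strongly $k$-connected spanning subgraph with at most $kn + 790k\overline{\Delta} + 790k^2$ edges.
   Context: A digraph is a pair $(V,E)$ with $V$ finite and $E \subseteq (V\times V)\setminus\{(v,v)\}$ (no loops, no parallel edges; 2-cycles allowed). $\overline{\Delta}(D)$ is the maximum over $v\in V(D)$ of the number of vertices $w\neq v$ with neither $(v,w)$ nor $(w,v)$ in $E(D)$. A digraph $D$ is strongly $k$-connected if $|V(D)|\geq k+1$ and $D-S$ is strongly connected for every $S\subseteq V(D)$ with $|S|\leq k-1$. *)

theory Defs
  imports "Graph_Theory.Digraph_Component"
begin

text \<open>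
  A digraph is a \<^typ>\<open>'a pair_pre_digraph\<close> satisfying \<^locale>\<open>pair_digraph\<close>: a finite vertex set
  together with a set of ordered pairs of distinct vertices. The notions below are stated for the
  more general \<^typ>\<open>('a, 'b) pre_digraph\<close>, on which the library defines
  \<^const>\<open>strongly_connected\<close>; pair digraphs are embedded there by \<^const>\<open>with_proj\<close>.
\<close>

definition non_neighbours :: "('a, 'b) pre_digraph \<Rightarrow> 'a \<Rightarrow> 'a set" where
  "non_neighbours D v =
     {w \<in> verts D. w \<noteq> v \<and> (v, w) \<notin> arcs_ends D \<and> (w, v) \<notin> arcs_ends D}"

text \<open>This is \<open>\<Delta>\<close>-bar. The maximum is only meaningful for finite nonempty vertex sets.\<close>

definition max_non_degree :: "('a, 'b) pre_digraph \<Rightarrow> nat" where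
  "max_non_degree D = Max ((\<lambda>v. card (non_neighbours D v)) ` verts D)"

text \<open>
  The condition \<open>card S < k\<close> is \<open>|S| \<le> k - 1\<close> without truncated subtraction. The bound on
  \<open>card (verts D)\<close> forces \<open>verts D\<close>, and hence every \<open>S\<close>, to be finite.
\<close>

definition strongly_k_connected :: "nat \<Rightarrow> ('a, 'b) pre_digraph \<Rightarrow> bool" where
  "strongly_k_connected k D \<longleftrightarrow>
     k + 1 \<le> card (verts D) \<and>
     (\<forall>S \<subseteq> verts D. card S < k \<longrightarrow> strongly_connected (D \<restriction> (verts D - S)))"

end

theory Submission
  imports Defs
begin

text \<open>
  If \<open>card V\<close> is \<open>O(k + d)\<close>, a minimal strongly \<open>k\<close>-connected subgraph, with at most \<open>4 * k * card V\<close> arcs,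
  is good enough. For larger digraphs let \<open>W\<close> be the set of the \<open>O(k + d)\<close> vertices of smallest out-degree.
  Any other vertex reaches the vertices of large out-degree in \<open>W\<close> by many paths of length at most two, so
  \<open>O(k * (k + d))\<close> arcs make a suitable \<open>k\<close>-set \<open>X\<close> robustly reachable from \<open>W\<close>. The reversed digraph
  yields \<open>W'\<close> and \<open>Y\<close> in the same way. Take a minimum union \<open>F\<close> of \<open>k\<close> disjoint paths from \<open>X\<close> to \<open>Y\<close> and
  a median order in which a vertex weighs \<open>k\<close>, or \<open>k - 1\<close> if it has an outgoing arc in \<open>F\<close>. The median
  property gives a matching of forward arcs with these capacities and small deficiency. Together with \<open>F\<close> it
  has at most \<open>k * card V\<close> arcs, and up to \<open>O(k * (k + d))\<close> further arcs it makes the in- and out-degrees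
  of all but \<open>O(k + d)\<close> vertices at least \<open>k\<close>.

  Suppose that fewer than \<open>k\<close> vertices separate \<open>T\<close> from the rest. The last vertex \<open>t\<close> of \<open>T\<close> has all its
  forward out-neighbours in the separator. So either \<open>t\<close> is one of the few exceptional vertices, or the
  forward out-neighbours of \<open>t\<close> fill the separator and, \<open>F\<close> having no chords, the path of \<open>F\<close> from \<open>t\<close> to \<open>Y\<close>
  stays in \<open>T\<close>. The exceptional vertices and those of \<open>Y\<close> are given \<open>k\<close> short paths to \<open>W\<close>, so in both
  cases \<open>T\<close> meets \<open>W\<close> and hence covers \<open>X\<close> up to the separator. Symmetrically, the rest contains a vertex of
  \<open>X\<close>, a contradiction.
\<close>

section \<open>Out-neighbourhoods and tight sets\<close>

definition out_nbhd :: "'a rel \<Rightarrow> 'a set \<Rightarrow> 'a set" where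
  "out_nbhd E T = E `` T - T"

lemma out_nbhd_iff: "y \<in> out_nbhd E T \<longleftrightarrow> y \<notin> T \<and> (\<exists>x\<in>T. (x, y) \<in> E)"
  by (auto simp: out_nbhd_def)

lemma out_nbhd_subset: "E \<subseteq> V \<times> V \<Longrightarrow> out_nbhd E T \<subseteq> V"
  by (auto simp: out_nbhd_def)

lemma out_nbhd_mono: "E \<subseteq> F \<Longrightarrow> out_nbhd E T \<subseteq> out_nbhd F T"
  by (auto simp: out_nbhd_def)

lemma finite_out_nbhd: "finite V \<Longrightarrow> E \<subseteq> V \<times> V \<Longrightarrow> finite (out_nbhd E T)"
  by (rule finite_subset[OF out_nbhd_subset])

lemma card_out_nbhd_mono:
  "finite V \<Longrightarrow> F \<subseteq> V \<times> V \<Longrightarrow> E \<subseteq> F \<Longrightarrow> card (out_nbhd E T) \<le> card (out_nbhd F T)"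
  by (rule card_mono[OF finite_out_nbhd out_nbhd_mono])

text \<open>Both sides count elements with multiplicity, namely union plus intersection. The
  uncrossing inequalities for boundaries and for arc counts below are instances.\<close>

lemma card_add_le_cross:
  assumes "finite C" "finite D" "A \<union> B \<subseteq> C \<union> D" "A \<inter> B \<subseteq> C \<inter> D"
  shows "card A + card B \<le> card C + card D"
proof -
  have f: "finite A" "finite B"
    using assms by (meson finite_Un finite_subset le_sup_iff)+
  have "card A + card B = card (A \<union> B) + card (A \<inter> B)"
    by (rule card_Un_Int[OF f])
  also have "\<dots> \<le> card (C \<union> D) + card (C \<inter> D)"
    by (intro add_mono card_mono) (use assms in auto)
  also have "\<dots> = card C + card D"
    by (rule card_Un_Int[symmetric]) (use assms in auto)
  finally show ?thesis .
qed

lemma card_out_nbhd_submodular: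
  assumes "finite V" "E \<subseteq> V \<times> V"
  shows "card (out_nbhd E (T \<inter> T')) + card (out_nbhd E (T \<union> T'))
      \<le> card (out_nbhd E T) + card (out_nbhd E T')"
  by (rule card_add_le_cross)
    (use assms in \<open>auto intro: finite_out_nbhd simp: out_nbhd_iff\<close>)

lemma card_out_nbhd_remove1:
  assumes "finite V" "E \<subseteq> V \<times> V"
  shows "card (out_nbhd E T) \<le> Suc (card (out_nbhd (E - {(u, v)}) T))"
    and "card (out_nbhd (E - {(u, v)}) T) < card (out_nbhd E T) \<Longrightarrow> u \<in> T \<and> v \<in> out_nbhd E T"
proof -
  have fin: "finite (out_nbhd (E - {(u, v)}) T)" using assms by (intro finite_out_nbhd[of V]) auto
  have "out_nbhd E T \<subseteq> insert v (out_nbhd (E - {(u, v)}) T)"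
    by (auto simp: out_nbhd_def)
  then have "card (out_nbhd E T) \<le> card (insert v (out_nbhd (E - {(u, v)}) T))"
    using fin by (intro card_mono) auto
  also have "\<dots> \<le> Suc (card (out_nbhd (E - {(u, v)}) T))"
    using fin by (simp add: card_insert_if)
  finally show "card (out_nbhd E T) \<le> Suc (card (out_nbhd (E - {(u, v)}) T))" .
  assume "card (out_nbhd (E - {(u, v)}) T) < card (out_nbhd E T)"
  then have "out_nbhd (E - {(u, v)}) T \<noteq> out_nbhd E T" by auto
  then show "u \<in> T \<and> v \<in> out_nbhd E T"
    by (auto simp: out_nbhd_def)
qed

lemma exists_minimal_subset:
  assumes "finite A" "P A"
  obtains B where "B \<subseteq> A" "P B" "\<And>C. C \<subset> B \<Longrightarrow> \<not> P C"
proof -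
  let ?B = "arg_min_on card {B. B \<subseteq> A \<and> P B}"
  have fin: "finite {B. B \<subseteq> A \<and> P B}" using assms by simp
  have ne: "{B. B \<subseteq> A \<and> P B} \<noteq> {}" using assms by auto
  have B: "?B \<subseteq> A" "P ?B" using arg_min_if_finite(1)[OF fin ne, of card] by auto
  show ?thesis
  proof (rule that[OF B])
    fix C assume C: "C \<subset> ?B"
    then have "card C < card ?B" using B assms finite_subset psubset_card_mono by metis
    then show "\<not> P C" using C B arg_min_if_finite(2)[OF fin ne, of card] by blast
  qed
qed

lemma card_le_sum_out_degrees:
  assumes "finite W" "F \<subseteq> W \<times> UNIV" "\<And>u. u \<in> W \<Longrightarrow> finite (F `` {u}) \<and> card (F `` {u}) \<le> k"
  shows "card F \<le> k * card W"
proof -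
  have "F = (SIGMA u:W. F `` {u})" using assms(2) by auto
  then have "card F = (\<Sum>u\<in>W. card (F `` {u}))"
    using card_SigmaI[OF assms(1), of "\<lambda>u. F `` {u}"] assms(3) by simp
  also have "\<dots> \<le> (\<Sum>u\<in>W. k)" using assms(3) by (intro sum_mono) auto
  finally show ?thesis by (simp add: mult.commute)
qed

text \<open>
  Uncrossing tight sets containing \<open>u\<close> gives one tight set whose out-neighbourhood contains all of \<open>N\<close>.
\<close>

lemma card_tight_heads:
  assumes fin: "finite V" and E: "E \<subseteq> V \<times> V"
    and closed: "\<And>T T'. P T \<Longrightarrow> P T' \<Longrightarrow> u \<in> T \<Longrightarrow> u \<in> T' \<Longrightarrow> P (T \<inter> T') \<and> P (T \<union> T')"
    and lower: "\<And>T. P T \<Longrightarrow> u \<in> T \<Longrightarrow> k \<le> card (out_nbhd E T)"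
    and N: "N \<subseteq> E `` {u}"
    and tight: "\<And>v. v \<in> N \<Longrightarrow> \<exists>T. P T \<and> u \<in> T \<and> v \<in> out_nbhd E T \<and> card (out_nbhd E T) = k"
  shows "card N \<le> k"
proof -
  have all: "A = {} \<or> (\<exists>T. P T \<and> u \<in> T \<and> A \<subseteq> out_nbhd E T \<and> card (out_nbhd E T) = k)"
    if "finite A" "A \<subseteq> N" for A
    using that
  proof (induction A rule: finite_induct)
    case (insert v A)
    obtain T where T: "P T" "u \<in> T" "v \<in> out_nbhd E T" "card (out_nbhd E T) = k"
      using tight[of v] insert.prems by auto
    from insert.IH insert.prems consider "A = {}" |
      T' where "P T'" "u \<in> T'" "A \<subseteq> out_nbhd E T'" "card (out_nbhd E T') = k"
      by auto
    then show ?case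
    proof cases
      case 1
      then show ?thesis using T by auto
    next
      case 2
      note cl = closed[OF T(1) 2(1) T(2) 2(2)]
      have "k \<le> card (out_nbhd E (T \<inter> T'))" by (rule lower) (use cl T 2 in auto)
      moreover have "k \<le> card (out_nbhd E (T \<union> T'))" by (rule lower) (use cl T 2 in auto)
      ultimately have "card (out_nbhd E (T \<inter> T')) = k"
        using card_out_nbhd_submodular[OF fin E, of T T'] T 2 by simp
      \<comment> \<open>All heads are out-neighbours of \<open>u\<close>, which lies in both sets,
        so passing to the intersection loses none of them.\<close>
      moreover have "insert v A \<subseteq> out_nbhd E (T \<inter> T')"
      proof
        fix w assume w: "w \<in> insert v A"
        then have "(u, w) \<in> E" using insert.prems N by auto
        moreover have "w \<notin> T \<inter> T'" using w T 2 by (auto simp: out_nbhd_def)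
        ultimately show "w \<in> out_nbhd E (T \<inter> T')" using T 2 by (auto simp: out_nbhd_iff)
      qed
      ultimately show ?thesis using T 2 cl by blast
    qed
  qed simp
  have "N \<subseteq> V" using N E by auto
  then have "finite N" using fin finite_subset by blast
  from all[OF this subset_refl] show ?thesis
  proof
    assume "\<exists>T. P T \<and> u \<in> T \<and> N \<subseteq> out_nbhd E T \<and> card (out_nbhd E T) = k"
    then obtain T where "N \<subseteq> out_nbhd E T" "card (out_nbhd E T) = k" by blast
    then show ?thesis using card_mono[OF finite_out_nbhd[OF fin E]] by metis
  qed simp
qed

text \<open>Let \<open>F\<close> be minimal. Each of its arcs is critical, so its head is an
  out-neighbour of a tight set containing its tail, and by \<open>card_tight_heads\<close> at most
  \<open>k\<close> arcs of \<open>F\<close> leave each vertex of \<open>W\<close>. The arcs of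
  \<open>C\<close> are kept throughout.\<close>

lemma rooted_sparsification:
  assumes fin: "finite V" and C: "C \<subseteq> V \<times> V" and D: "D \<subseteq> V \<times> V" "D \<subseteq> W \<times> UNIV" and W: "W \<subseteq> V"
    and conn: "\<And>T. T \<subseteq> V \<Longrightarrow> T \<inter> W \<noteq> {} \<Longrightarrow> T \<inter> R = {} \<Longrightarrow> k \<le> card (out_nbhd (C \<union> D) T)"
  shows "\<exists>F\<subseteq>D. card F \<le> k * card W \<and>
    (\<forall>T\<subseteq>V. T \<inter> W \<noteq> {} \<longrightarrow> T \<inter> R = {} \<longrightarrow> k \<le> card (out_nbhd (C \<union> F) T))"
proof -
  let ?P = "\<lambda>F. \<forall>T\<subseteq>V. T \<inter> W \<noteq> {} \<longrightarrow> T \<inter> R = {} \<longrightarrow> k \<le> card (out_nbhd (C \<union> F) T)"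
  have finD: "finite D" using D fin by (meson finite_SigmaI finite_subset)
  obtain F where F: "F \<subseteq> D" "?P F" and min: "\<And>F'. F' \<subset> F \<Longrightarrow> \<not> ?P F'"
    by (rule exists_minimal_subset[of D ?P]) (use finD conn in auto)
  let ?E = "C \<union> F"
  have E: "?E \<subseteq> V \<times> V" using C D F by auto
  have tight1: "\<exists>T\<subseteq>V. u \<in> T \<and> v \<in> out_nbhd ?E T \<and> T \<inter> R = {} \<and> card (out_nbhd ?E T) = k"
    if uv: "(u, v) \<in> F" for u v
  proof -
    have "\<not> ?P (F - {(u, v)})" by (rule min) (use uv in auto)
    then obtain T where T: "T \<subseteq> V" "T \<inter> W \<noteq> {}" "T \<inter> R = {}"
      and lt: "card (out_nbhd (C \<union> (F - {(u, v)})) T) < k" by (auto simp: not_le)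
    have ge: "k \<le> card (out_nbhd ?E T)" using F(2) T by blast
    have "card (out_nbhd (?E - {(u, v)}) T) \<le> card (out_nbhd (C \<union> (F - {(u, v)})) T)"
      by (rule card_out_nbhd_mono[OF fin]) (use E in auto)
    then have lt': "card (out_nbhd (?E - {(u, v)}) T) < k" using lt by simp
    show ?thesis
      using card_out_nbhd_remove1[OF fin E, where T=T and u=u and v=v] T lt' ge by (intro exI[of _ T]) auto
  qed
  have deg: "card (F `` {u}) \<le> k" if u: "u \<in> W" for u
  proof (rule card_tight_heads[OF fin E, where P = "\<lambda>T. T \<subseteq> V \<and> T \<inter> R = {}" and u = u])
    show "k \<le> card (out_nbhd ?E T)" if "T \<subseteq> V \<and> T \<inter> R = {}" "u \<in> T" for T
      by (rule F(2)[rule_format]) (use that u in auto)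
    show "\<exists>T. (T \<subseteq> V \<and> T \<inter> R = {}) \<and> u \<in> T \<and> v \<in> out_nbhd ?E T \<and> card (out_nbhd ?E T) = k"
      if "v \<in> F `` {u}" for v
    proof -
      have "(u, v) \<in> F" using that by simp
      from tight1[OF this] show ?thesis by (elim exE conjE) (intro exI conjI)
    qed
  qed auto
  have "card F \<le> k * card W"
  proof (rule card_le_sum_out_degrees)
    show "finite W" using W fin finite_subset by blast
    show "F \<subseteq> W \<times> UNIV" using F D by blast
    show "finite (F `` {u}) \<and> card (F `` {u}) \<le> k" if "u \<in> W" for u
      using deg[OF that] F finD by (meson finite_Image finite_subset)
  qed
  then show ?thesis using F by blast
qed

text \<open>Cut form of the fact that \<open>k\<close> paths from \<open>v\<close> to
  \<open>Z\<close>, disjoint outside \<open>v\<close>, use at most \<open>k\<close> end vertices;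
  \<open>Y\<close> plays the role of these.\<close>

lemma fan_endpoints:
  assumes fin: "finite V" and E: "E \<subseteq> V \<times> V" and Z: "finite Z"
    and conn: "\<And>T. T \<subseteq> V \<Longrightarrow> v \<in> T \<Longrightarrow> T \<inter> Z = {} \<Longrightarrow> k \<le> card (out_nbhd E T)"
  shows "\<exists>Y\<subseteq>Z. card Y \<le> k \<and> (\<forall>T\<subseteq>V. v \<in> T \<longrightarrow> T \<inter> Y = {} \<longrightarrow> k \<le> card (out_nbhd E T))"
proof -
  let ?P = "\<lambda>Y. \<forall>T\<subseteq>V. v \<in> T \<longrightarrow> T \<inter> Y = {} \<longrightarrow> k \<le> card (out_nbhd E T)"
  obtain Y where Y: "Y \<subseteq> Z" "?P Y" and min: "\<And>Y'. Y' \<subset> Y \<Longrightarrow> \<not> ?P Y'"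
    by (rule exists_minimal_subset[of Z ?P]) (use Z conn in auto)
  have tight1: "\<exists>T\<subseteq>V. v \<in> T \<and> T \<inter> Y = {z} \<and> card (out_nbhd E T) < k" if z: "z \<in> Y" for z
  proof -
    have "\<not> ?P (Y - {z})" by (rule min) (use z in auto)
    then obtain T where T: "T \<subseteq> V" "v \<in> T" "T \<inter> (Y - {z}) = {}" "card (out_nbhd E T) < k"
      by (auto simp: not_le)
    moreover have "T \<inter> Y \<noteq> {}" using T Y(2) by (metis not_le)
    ultimately show ?thesis by (intro exI[of _ T]) auto
  qed
  \<comment> \<open>The sets from \<open>tight1\<close> are united one by one. Their intersections
    avoid \<open>Y\<close> and so have at least \<open>k\<close> out-neighbours; by submodularity
    every further vertex of \<open>Y\<close> costs the union an out-neighbour.\<close>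
  have all: "A \<noteq> {} \<Longrightarrow> \<exists>T\<subseteq>V. v \<in> T \<and> T \<inter> Y = A \<and> card (out_nbhd E T) + card A \<le> k"
    if "finite A" "A \<subseteq> Y" for A
    using that
  proof (induction A rule: finite_induct)
    case (insert z A)
    obtain T where T: "T \<subseteq> V" "v \<in> T" "T \<inter> Y = {z}" "card (out_nbhd E T) < k"
      using tight1[of z] insert.prems by auto
    show ?case
    proof (cases "A = {}")
      case True
      then show ?thesis using T by (intro exI[of _ T]) auto
    next
      case False
      then obtain T' where T': "T' \<subseteq> V" "v \<in> T'" "T' \<inter> Y = A" "card (out_nbhd E T') + card A \<le> k"
        using insert by auto
      have "T \<inter> T' \<inter> Y = {}" using T T' insert.hyps by auto
      then have "k \<le> card (out_nbhd E (T \<inter> T'))"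
        using Y(2) T T' by (metis IntI inf.coboundedI1)
      then have "card (out_nbhd E (T \<union> T')) + card (insert z A) \<le> k"
        using card_out_nbhd_submodular[OF fin E, of T T'] T T' insert.hyps by simp
      then show ?thesis using T T' by (intro exI[of _ "T \<union> T'"]) auto
    qed
  qed simp
  have "finite Y" using Y Z finite_subset by blast
  then have "card Y \<le> k" using all[of Y] by (cases "Y = {}") auto
  then show ?thesis using Y by blast
qed

text \<open>Double counting of the ordered pairs in \<open>U\<close>: two elements are related one
  way, the other way or not at all, and in- and out-degrees have the same sum.\<close>

lemma card_le_of_bounded_in_degree:
  assumes fin: "finite U"
    and in_deg: "\<And>z. z \<in> U \<Longrightarrow> card {y\<in>U. y \<noteq> z \<and> P y z} \<le> a"
    and incomp: "\<And>z. z \<in> U \<Longrightarrow> card {y\<in>U. y \<noteq> z \<and> \<not> P y z \<and> \<not> P z y} \<le> b"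
  shows "card U \<le> 2 * a + b + 1"
proof (cases "U = {}")
  case False
  let ?I = "\<lambda>z. {y\<in>U. y \<noteq> z \<and> P y z}" and ?O = "\<lambda>z. {y\<in>U. y \<noteq> z \<and> P z y}"
  let ?N = "\<lambda>z. {y\<in>U. y \<noteq> z \<and> \<not> P y z \<and> \<not> P z y}"
  have "card U - 1 \<le> card (?I z) + card (?O z) + card (?N z)" if "z \<in> U" for z
  proof -
    have "card U - 1 = card (U - {z})" using that fin by simp
    also have "\<dots> \<le> card (?I z \<union> ?O z \<union> ?N z)" using fin by (intro card_mono) auto
    also have "\<dots> \<le> card (?I z) + card (?O z) + card (?N z)"
      by (meson add_le_mono1 card_Un_le order_trans)
    finally show ?thesis .
  qed
  then have "(\<Sum>z\<in>U. card U - 1) \<le> (\<Sum>z\<in>U. card (?I z) + card (?O z) + card (?N z))"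
    by (intro sum_mono) auto
  also have "\<dots> = (\<Sum>z\<in>U. card (?I z)) + (\<Sum>z\<in>U. card (?O z)) + (\<Sum>z\<in>U. card (?N z))"
    by (simp add: sum.distrib)
  also have "(\<Sum>z\<in>U. card (?O z)) = (\<Sum>z\<in>U. card (?I z))"
  proof -
    have "(\<Sum>z\<in>U. card (?O z)) = (\<Sum>z\<in>U. \<Sum>y\<in>U. if y \<noteq> z \<and> P z y then 1 else 0)"
      using fin by (simp add: sum.If_cases Int_def)
    also have "\<dots> = (\<Sum>y\<in>U. \<Sum>z\<in>U. if z \<noteq> y \<and> P z y then 1 else 0)"
      by (subst sum.swap) (auto intro!: sum.cong)
    also have "\<dots> = (\<Sum>z\<in>U. card (?I z))"
      using fin by (simp add: sum.If_cases Int_def)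
    finally show ?thesis .
  qed
  also have "(\<Sum>z\<in>U. card (?I z)) + (\<Sum>z\<in>U. card (?I z)) + (\<Sum>z\<in>U. card (?N z))
      \<le> (\<Sum>z\<in>U. a) + (\<Sum>z\<in>U. a) + (\<Sum>z\<in>U. b)"
    using in_deg incomp by (intro add_mono sum_mono) auto
  finally have "card U * (card U - 1) \<le> card U * (2 * a + b)" by (simp add: algebra_simps)
  then show ?thesis using False fin by (simp add: card_gt_0_iff)
qed simp

section \<open>Dense digraphs\<close>

text \<open>The values are integers so that negation gives the subsets with smallest values as
  well.\<close>

lemma top_subset:
  fixes f :: "'a \<Rightarrow> int"
  assumes "finite B" "m \<le> card B"
  shows "\<exists>X\<subseteq>B. card X = m \<and> (\<forall>x\<in>X. \<forall>z\<in>B - X. f z \<le> f x)"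
  using assms(2)
proof (induction m)
  case 0
  then show ?case by (intro exI[of _ "{}"]) auto
next
  case (Suc m)
  then obtain X where X: "X \<subseteq> B" "card X = m" "\<forall>x\<in>X. \<forall>z\<in>B - X. f z \<le> f x" by auto
  have finX: "finite X" using X assms(1) finite_subset by blast
  have ne: "B - X \<noteq> {}"
    using X Suc.prems finX by (metis Diff_eq_empty_iff card_mono not_less_eq_eq)
  let ?M = "Max (f ` (B - X))"
  have "?M \<in> f ` (B - X)" using ne assms(1) by (intro Max_in) auto
  then obtain x where x: "x \<in> B - X" "f x = ?M" by auto
  have "f z \<le> f x" if "z \<in> B - X" for z using that assms(1) x by simp
  then show ?case using X x finX by (intro exI[of _ "insert x X"]) auto
qed

lemma card_filter_split:
  "finite A \<Longrightarrow> card A = card {x\<in>A. P x} + card {x\<in>A. \<not> P x}"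
  by (subst card_Un_disjoint[symmetric]) (auto intro!: arg_cong[where f = card])

text \<open>Elements join \<open>O1\<close> one at a time. While fewer than \<open>k\<close> of the
  \<open>q\<close> are served, more than \<open>3 * k\<close> are not, and each of these still
  offers a quarter of \<open>B\<close>, so some element serves at least \<open>3 * k / 4\<close> of
  them.\<close>

lemma greedy_selection:
  fixes G :: "'b \<Rightarrow> 'a set"
  assumes finB: "finite B" and finQ: "finite Q" "card Q = 4 * k" and k: "1 \<le> k"
    and G: "\<And>q. q \<in> Q \<Longrightarrow> G q \<subseteq> B \<and> card B + 4 * k \<le> 4 * card (G q)"
  shows "\<exists>O1\<subseteq>B. card O1 \<le> 6 * k \<and> k \<le> card {q\<in>Q. k \<le> card (G q \<inter> O1)}"
proof (rule ccontr)
  assume none: "\<not> ?thesis"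
  define \<Phi> where "\<Phi> O1 = (\<Sum>q\<in>Q. min k (card (G q \<inter> O1)))" for O1
  have "\<exists>O1\<subseteq>B. card O1 \<le> j \<and> 3 * k * j \<le> 4 * \<Phi> O1" if "j \<le> 6 * k" for j
    using that
  proof (induction j)
    case 0
    then show ?case by (intro exI[of _ "{}"]) auto
  next
    case (Suc j)
    then obtain O1 where O1: "O1 \<subseteq> B" "card O1 \<le> j" "3 * k * j \<le> 4 * \<Phi> O1" by auto
    have finO: "finite O1" using O1 finB finite_subset by blast
    let ?U = "{q\<in>Q. card (G q \<inter> O1) < k}"
    have "card {q\<in>Q. k \<le> card (G q \<inter> O1)} < k"
      using none O1 Suc.prems by (meson Suc_leD le_trans not_le)
    moreover have "card Q = card ?U + card {q\<in>Q. k \<le> card (G q \<inter> O1)}"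
      using card_filter_split[OF finQ(1), of "\<lambda>q. card (G q \<inter> O1) < k"] by (simp add: not_less)
    ultimately have U: "3 * k + 1 \<le> card ?U" using finQ by simp
    have out: "card B \<le> 4 * card (G q - O1)" if "q \<in> ?U" for q
    proof -
      have finG: "finite (G q)" using G that finB finite_subset by blast
      have "card (G q) = card (G q \<inter> O1) + card (G q - O1)"
        using finG by (metis card_Diff_subset_Int card_mono diff_add_inverse finite_Int inf_le1 le_add_diff_inverse)
      moreover have "card B + 4 * k \<le> 4 * card (G q)" using G that by auto
      ultimately show ?thesis using that by simp
    qed
    have finU: "finite ?U" using finQ by simp
    have "\<exists>z\<in>B. 3 * k \<le> 4 * card {q\<in>?U. z \<in> G q - O1}"
    proof (rule ccontr)
      assume "\<not> ?thesis"
      then have less: "4 * card {q\<in>?U. z \<in> G q - O1} \<le> 3 * k" if "z \<in> B" for z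
        using that by (meson less_imp_le not_le)
      have "(\<Sum>q\<in>?U. card (G q - O1)) = (\<Sum>q\<in>?U. \<Sum>z\<in>B. if z \<in> G q - O1 then 1 else 0)"
      proof (rule sum.cong)
        fix q assume "q \<in> ?U"
        then have "B \<inter> {z. z \<in> G q - O1} = G q - O1" using G by auto
        then show "card (G q - O1) = (\<Sum>z\<in>B. if z \<in> G q - O1 then 1 else 0)"
          using finB by (simp add: sum.If_cases)
      qed simp
      also have "\<dots> = (\<Sum>z\<in>B. card {q\<in>?U. z \<in> G q - O1})"
        using finU by (subst sum.swap) (simp add: sum.If_cases Int_def del: Diff_iff)
      finally have eq: "(\<Sum>q\<in>?U. card (G q - O1)) = (\<Sum>z\<in>B. card {q\<in>?U. z \<in> G q - O1})" .
      have "(3 * k + 1) * card B \<le> card ?U * card B" using U by (rule mult_le_mono1)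
      also have "\<dots> = (\<Sum>q\<in>?U. card B)" by simp
      also have "\<dots> \<le> (\<Sum>q\<in>?U. 4 * card (G q - O1))" using out by (intro sum_mono) auto
      also have "\<dots> = 4 * (\<Sum>q\<in>?U. card (G q - O1))" by (simp add: sum_distrib_left)
      also have "\<dots> = (\<Sum>z\<in>B. 4 * card {q\<in>?U. z \<in> G q - O1})" unfolding eq by (simp add: sum_distrib_left)
      also have "\<dots> \<le> (\<Sum>z\<in>B. 3 * k)" using less by (intro sum_mono) auto
      finally have "card B = 0" by (simp add: algebra_simps)
      moreover obtain q where "q \<in> Q" using finQ k by (metis card.empty ex_in_conv mult_is_0 not_one_le_zero zero_neq_numeral)
      ultimately show False using G[of q] k finB card_mono[OF finB, of "G q"] by auto
    qed
    then obtain z where z: "z \<in> B" "3 * k \<le> 4 * card {q\<in>?U. z \<in> G q - O1}" by blast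
    let ?H = "{q\<in>?U. z \<in> G q - O1}"
    have "\<Phi> O1 + card ?H = (\<Sum>q\<in>Q. min k (card (G q \<inter> O1)) + (if q \<in> ?H then 1 else 0))"
      using finQ by (simp add: \<Phi>_def sum.distrib sum.If_cases Int_def conj_ac)
    also have "\<dots> \<le> \<Phi> (insert z O1)"
      unfolding \<Phi>_def
    proof (rule sum_mono)
      fix q assume "q \<in> Q"
      show "min k (card (G q \<inter> O1)) + (if q \<in> ?H then 1 else 0) \<le> min k (card (G q \<inter> insert z O1))"
        using finO by (cases "z \<in> G q"; cases "z \<in> O1") (auto simp: Int_insert_right insert_absorb)
    qed
    finally have "3 * k * Suc j \<le> 4 * \<Phi> (insert z O1)" using O1(3) z(2) by simp
    moreover have "card (insert z O1) \<le> Suc j" using O1 finO by (simp add: card_insert_if)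
    ultimately show ?case using z O1 by (intro exI[of _ "insert z O1"]) auto
  qed
  \<comment> \<open>After \<open>6 * k\<close> rounds \<open>4 * \<Phi>\<close> is at least
    \<open>18 * k * k\<close>, while the cap \<open>k\<close> on each of the \<open>4 * k\<close>
    terms keeps it at most \<open>16 * k * k\<close>.\<close>
  from this[of "6 * k"] obtain O1 where "3 * k * (6 * k) \<le> 4 * \<Phi> O1" by auto
  moreover have "\<Phi> O1 \<le> (\<Sum>q\<in>Q. k)" unfolding \<Phi>_def by (intro sum_mono) simp
  then have "4 * \<Phi> O1 \<le> 16 * (k * k)" using finQ by simp
  moreover have "3 * k * (6 * k) = 18 * (k * k)" by simp
  moreover have "0 < k * k" using k by simp
  ultimately show False by linarith
qed

section \<open>Dense digraphs in cut form, and weak in-degrees\<close>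

locale dense_digraph =
  fixes V :: "'a set" and E :: "'a rel" and k d :: nat
  assumes fin: "finite V" and arcs: "E \<subseteq> V \<times> V" and loopfree: "(v, v) \<notin> E" and k_pos: "1 \<le> k"
    and non_adj: "v \<in> V \<Longrightarrow> card {w\<in>V. w \<noteq> v \<and> (v, w) \<notin> E \<and> (w, v) \<notin> E} \<le> d"
    and conn: "T \<subseteq> V \<Longrightarrow> T \<noteq> {} \<Longrightarrow> V - T - out_nbhd E T \<noteq> {} \<Longrightarrow> k \<le> card (out_nbhd E T)"
begin

lemma finite_sub: "B \<subseteq> V \<Longrightarrow> finite B"
  using fin finite_subset by blast

lemma finite_out: "F \<subseteq> E \<Longrightarrow> finite (out_nbhd F T)"
  by (rule finite_out_nbhd[OF fin]) (use arcs in auto)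

text \<open>
  The relation counted by \<open>weak_in\<close> is total, so non-adjacent pairs matter only when two counts are compared.
\<close>

definition weak_in :: "'a set \<Rightarrow> 'a \<Rightarrow> 'a set" where
  "weak_in B z = {y\<in>B. y \<noteq> z \<and> ((y, z) \<in> E \<or> (z, y) \<notin> E)}"

text \<open>All of \<open>B - T - S\<close> counts for \<open>z\<close>, and so do at least
  \<open>d + k\<close> further vertices of \<open>weak_in \<Gamma> z\<close>. For \<open>x\<close>
  only the rest of \<open>B - T - S\<close>, fewer than \<open>k\<close> vertices of
  \<open>S\<close> and at most \<open>d\<close> non-neighbours in \<open>T\<close> can
  count.\<close>

lemma weak_in_less:
  assumes B: "B \<subseteq> V" and x: "x \<in> B" "x \<notin> T" "x \<notin> S" and z: "z \<in> B" "z \<in> T"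
    and S: "finite S" "card S < k"
    and no_out: "\<And>r. r \<in> B - T - S \<Longrightarrow> (z, r) \<notin> E" and no_in: "\<And>y. y \<in> B \<inter> T \<Longrightarrow> (y, x) \<notin> E"
    and \<Gamma>: "\<Gamma> \<subseteq> B" "\<Gamma> \<subseteq> T \<union> S" "d + k \<le> card (weak_in \<Gamma> z)"
  shows "card (weak_in B x) < card (weak_in B z)"
proof -
  let ?R = "B - T - S"
  have finB: "finite B" using B finite_sub by blast
  have xV: "x \<in> V" using x B by auto
  have fN: "finite {w\<in>V. w \<noteq> x \<and> (x, w) \<notin> E \<and> (w, x) \<notin> E}" using fin by simp
  have "weak_in B x \<subseteq> (?R - {x}) \<union> S \<union> {w\<in>V. w \<noteq> x \<and> (x, w) \<notin> E \<and> (w, x) \<notin> E}"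
    using no_in B by (auto simp: weak_in_def)
  then have "card (weak_in B x) \<le> card ((?R - {x}) \<union> S \<union> {w\<in>V. w \<noteq> x \<and> (x, w) \<notin> E \<and> (w, x) \<notin> E})"
    using finB S fN by (intro card_mono) auto
  also have "\<dots> \<le> card (?R - {x}) + card S + card {w\<in>V. w \<noteq> x \<and> (x, w) \<notin> E \<and> (w, x) \<notin> E}"
    by (meson add_le_mono1 card_Un_le order_trans)
  also have "\<dots> < card ?R + d + k"
  proof -
    have "card (?R - {x}) < card ?R" using x finB by (intro psubset_card_mono) auto
    then show ?thesis using non_adj[OF xV] S by simp
  qed
  also have "\<dots> \<le> card ?R + card (weak_in \<Gamma> z)" using \<Gamma> by simp
  also have "\<dots> = card (?R \<union> weak_in \<Gamma> z)"
    using finB \<Gamma> finite_subset[OF \<Gamma>(1) finB] by (intro card_Un_disjoint[symmetric]) (auto simp: weak_in_def)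
  also have "\<dots> \<le> card (weak_in B z)"
    using finB \<Gamma> no_out z by (intro card_mono) (auto simp: weak_in_def)
  finally show ?thesis .
qed

text \<open>The weak relation is total, so no incomparable pairs enter the count; \<open>d\<close>
  occurs only through the threshold.\<close>

lemma card_small_weak_in:
  assumes "\<Gamma> \<subseteq> V"
  shows "card {z\<in>\<Gamma>. card (weak_in \<Gamma> z) < d + k} \<le> 2 * d + 2 * k"
proof -
  let ?U = "{z\<in>\<Gamma>. card (weak_in \<Gamma> z) < d + k}"
  have f: "finite \<Gamma>" using assms finite_sub by blast
  have "card ?U \<le> 2 * (d + k - 1) + 0 + 1"
  proof (rule card_le_of_bounded_in_degree[where P = "\<lambda>y z. (y, z) \<in> E \<or> (z, y) \<notin> E"])
    show "finite ?U" using f by simp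
    fix z assume z: "z \<in> ?U"
    have "card {y \<in> ?U. y \<noteq> z \<and> ((y, z) \<in> E \<or> (z, y) \<notin> E)} \<le> card (weak_in \<Gamma> z)"
      using f by (intro card_mono) (auto simp: weak_in_def)
    also have "\<dots> \<le> d + k - 1" using z by auto
    finally show "card {y \<in> ?U. y \<noteq> z \<and> ((y, z) \<in> E \<or> (z, y) \<notin> E)} \<le> d + k - 1" .
    have "{y \<in> ?U. y \<noteq> z \<and> \<not> ((y, z) \<in> E \<or> (z, y) \<notin> E) \<and> \<not> ((z, y) \<in> E \<or> (y, z) \<notin> E)} = {}" by auto
    then show "card {y \<in> ?U. y \<noteq> z \<and> \<not> ((y, z) \<in> E \<or> (z, y) \<notin> E) \<and> \<not> ((z, y) \<in> E \<or> (y, z) \<notin> E)} \<le> 0"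
      by (metis card.empty order_refl)
  qed
  then show ?thesis using k_pos by simp
qed

lemma card_large_weak_in:
  assumes "\<Gamma> \<subseteq> V"
  shows "card \<Gamma> \<le> card {z\<in>\<Gamma>. d + k \<le> card (weak_in \<Gamma> z)} + 2 * d + 2 * k"
proof -
  have "finite \<Gamma>" using assms finite_sub by blast
  then have "card \<Gamma> = card {z\<in>\<Gamma>. d + k \<le> card (weak_in \<Gamma> z)} + card {z\<in>\<Gamma>. card (weak_in \<Gamma> z) < d + k}"
    using card_filter_split[of \<Gamma> "\<lambda>z. d + k \<le> card (weak_in \<Gamma> z)"] by (simp add: not_le)
  then show ?thesis using card_small_weak_in[OF assms] by simp
qed

lemma card_small_out_degree:
  assumes "B \<subseteq> V"
  shows "card {w\<in>B. card {y\<in>B. (w, y) \<in> E} < t} \<le> 2 * t + d"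
proof (cases "t = 0")
  case False
  let ?U = "{w\<in>B. card {y\<in>B. (w, y) \<in> E} < t}"
  have f: "finite B" using assms finite_sub by blast
  have "card ?U \<le> 2 * (t - 1) + d + 1"
  proof (rule card_le_of_bounded_in_degree[where P = "\<lambda>y z. (z, y) \<in> E"])
    show "finite ?U" using f by simp
    fix z assume z: "z \<in> ?U"
    have "card {y \<in> ?U. y \<noteq> z \<and> (z, y) \<in> E} \<le> card {y\<in>B. (z, y) \<in> E}"
      using f by (intro card_mono) auto
    also have "\<dots> \<le> t - 1" using z by auto
    finally show "card {y \<in> ?U. y \<noteq> z \<and> (z, y) \<in> E} \<le> t - 1" .
    have "card {y \<in> ?U. y \<noteq> z \<and> (z, y) \<notin> E \<and> (y, z) \<notin> E} \<le> card {w\<in>V. w \<noteq> z \<and> (z, w) \<notin> E \<and> (w, z) \<notin> E}"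
      using fin assms by (intro card_mono) auto
    then show "card {y \<in> ?U. y \<noteq> z \<and> (z, y) \<notin> E \<and> (y, z) \<notin> E} \<le> d"
      using non_adj[of z] z assms by auto
  qed
  then show ?thesis using False by simp
qed simp

lemma card_large_out_degree:
  assumes "B \<subseteq> V"
  shows "card B \<le> card {w\<in>B. t \<le> card {y\<in>B. (w, y) \<in> E}} + 2 * t + d"
proof -
  have "finite B" using assms finite_sub by blast
  then have "card B = card {w\<in>B. t \<le> card {y\<in>B. (w, y) \<in> E}} + card {w\<in>B. card {y\<in>B. (w, y) \<in> E} < t}"
    using card_filter_split[of B "\<lambda>w. t \<le> card {y\<in>B. (w, y) \<in> E}"] by (simp add: not_le)
  then show ?thesis using card_small_out_degree[OF assms, of t] by simp
qed

text \<open>\<open>X\<close> consists of vertices of largest weak in-degree in \<open>B\<close>. A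
  hub in \<open>T\<close> has at least \<open>k\<close> good out-neighbours in \<open>O1\<close>, so
  one of them, \<open>z\<close>, lies in \<open>T\<close>. If \<open>T\<close> missed some
  \<open>x\<close> of \<open>X\<close>, then by \<open>weak_in_less\<close> the weak in-degree of
  \<open>z\<close> would exceed that of \<open>x\<close>. \<open>K\<close> has just the arcs that
  this comparison uses.\<close>

lemma hub_structure:
  assumes B: "B \<subseteq> V" "card B = 24 * k + 12 * d"
  shows "\<exists>H X K. H \<subseteq> B \<and> card H = k \<and> X \<subseteq> B \<and> card X = k \<and> K \<subseteq> E \<and> card K \<le> 8 * k * card B \<and>
    (\<forall>T\<subseteq>V. T \<inter> H \<noteq> {} \<longrightarrow> card (out_nbhd K T) < k \<longrightarrow> X \<subseteq> T \<union> out_nbhd K T)"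
proof -
  have finB: "finite B" using B finite_sub by blast
  obtain X where X: "X \<subseteq> B" "card X = k"
    and top: "\<And>x z. x \<in> X \<Longrightarrow> z \<in> B - X \<Longrightarrow> card (weak_in B z) \<le> card (weak_in B x)"
    using top_subset[OF finB, of k "\<lambda>z. int (card (weak_in B z))"] B by auto
  define \<Gamma> where "\<Gamma> h = {y\<in>B. (h, y) \<in> E}" for h
  define G where "G h = {z\<in>\<Gamma> h. d + k \<le> card (weak_in (\<Gamma> h) z)} - X" for h
  have "4 * k \<le> card {h\<in>B. 10 * k + 5 * d \<le> card (\<Gamma> h)}"
    using card_large_out_degree[OF B(1), of "10 * k + 5 * d"] B(2) by (simp add: \<Gamma>_def)
  then obtain Q where Q: "Q \<subseteq> {h\<in>B. 10 * k + 5 * d \<le> card (\<Gamma> h)}" "card Q = 4 * k"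
    by (meson obtain_subset_with_card_n)
  have finQ: "finite Q" using Q finB finite_subset by fastforce
  have G: "G h \<subseteq> B \<and> card B + 4 * k \<le> 4 * card (G h)" if "h \<in> Q" for h
  proof -
    define L where "L = {z\<in>\<Gamma> h. d + k \<le> card (weak_in (\<Gamma> h) z)}"
    have "\<Gamma> h \<subseteq> V" using B by (auto simp: \<Gamma>_def)
    then have "card (\<Gamma> h) \<le> card L + 2 * d + 2 * k"
      using card_large_weak_in[of "\<Gamma> h"] unfolding L_def by simp
    moreover have "10 * k + 5 * d \<le> card (\<Gamma> h)" using Q that by auto
    moreover have "card L - card X \<le> card (G h)"
      unfolding G_def L_def[symmetric] by (rule diff_card_le_card_Diff) (use X finB finite_subset in blast)
    then have "card L \<le> card (G h) + k"
      using X(2) by simp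
    \<comment> \<open>This is exactly a quarter of \<open>card B + 4 * k\<close>, as
      \<open>greedy_selection\<close> requires.\<close>
    ultimately have "7 * k + 3 * d \<le> card (G h)" by linarith
    then show ?thesis using B by (auto simp: G_def \<Gamma>_def)
  qed
  obtain O1 where O1: "O1 \<subseteq> B" "card O1 \<le> 6 * k" "k \<le> card {q\<in>Q. k \<le> card (G q \<inter> O1)}"
    using greedy_selection[OF finB finQ Q(2) k_pos, of G] G by meson
  then obtain H where H: "H \<subseteq> {q\<in>Q. k \<le> card (G q \<inter> O1)}" "card H = k"
    by (meson obtain_subset_with_card_n)
  define K where "K = E \<inter> ((H \<union> O1) \<times> B \<union> B \<times> X)"
  have HB: "H \<subseteq> B" using H Q by auto
  have "card K \<le> card ((H \<union> O1) \<times> B \<union> B \<times> X)"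
    unfolding K_def using finB HB O1 X by (intro card_mono) (auto intro: finite_subset)
  also have "\<dots> \<le> card ((H \<union> O1) \<times> B) + card (B \<times> X)" by (rule card_Un_le)
  also have "\<dots> \<le> (7 * k) * card B + card B * k"
    using card_Un_le[of H O1] H O1 X by (auto simp: card_cartesian_product intro!: add_mono)
  finally have cardK: "card K \<le> 8 * k * card B" by (simp add: algebra_simps)
  have "X \<subseteq> T \<union> out_nbhd K T" if T: "T \<subseteq> V" "T \<inter> H \<noteq> {}" "card (out_nbhd K T) < k" for T
  proof (rule ccontr)
    let ?S = "out_nbhd K T"
    assume "\<not> ?thesis"
    then obtain x where x: "x \<in> X" "x \<notin> T" "x \<notin> ?S" by auto
    obtain h where h: "h \<in> T" "h \<in> H" using T by auto
    have \<Gamma>TS: "\<Gamma> h \<subseteq> T \<union> ?S" using h by (auto simp: \<Gamma>_def K_def out_nbhd_def)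
    have finS: "finite ?S" by (rule finite_out) (auto simp: K_def)
    have "\<not> G h \<inter> O1 \<subseteq> ?S"
      using T(3) h H finS by (metis (mono_tags, lifting) card_mono linorder_not_less mem_Collect_eq order_trans subsetD)
    then obtain z where z: "z \<in> G h" "z \<in> O1" "z \<notin> ?S" by auto
    then have zT: "z \<in> T" using \<Gamma>TS by (auto simp: G_def)
    have "card (weak_in B x) < card (weak_in B z)"
    proof (rule weak_in_less[where T = T and S = ?S and \<Gamma> = "\<Gamma> h"])
      show "(z, r) \<notin> E" if "r \<in> B - T - ?S" for r
        using that z zT by (auto simp: K_def out_nbhd_def)
      show "(y, x) \<notin> E" if "y \<in> B \<inter> T" for y
        using that x by (auto simp: K_def out_nbhd_def)
    qed (use B x X z zT finS T \<Gamma>TS in \<open>auto simp: G_def \<Gamma>_def\<close>)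
    moreover have "card (weak_in B z) \<le> card (weak_in B x)"
      using top[OF x(1), of z] z by (auto simp: G_def \<Gamma>_def)
    ultimately show False by simp
  qed
  then show ?thesis using HB H(2) X cardK
    by (intro exI[of _ H] exI[of _ X] exI[of _ K]) (auto simp: K_def)
qed

end

section \<open>Vertices of small out-degree\<close>

lemma card_UN_le_mult:
  assumes "finite I" "\<And>i. i \<in> I \<Longrightarrow> card (A i) \<le> m"
  shows "card (\<Union>i\<in>I. A i) \<le> m * card I"
proof -
  have "card (\<Union>i\<in>I. A i) \<le> (\<Sum>i\<in>I. card (A i))" by (rule card_UN_le[OF assms(1)])
  also have "\<dots> \<le> (\<Sum>i\<in>I. m)" using assms(2) by (rule sum_mono)
  finally show ?thesis by (simp add: mult.commute)
qed

lemma inj_on_of_disjoint: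
  assumes "\<And>i. i \<in> I \<Longrightarrow> e i \<in> A i" "\<And>i j. i \<in> I \<Longrightarrow> j \<in> I \<Longrightarrow> i \<noteq> j \<Longrightarrow> A i \<inter> A j = {}"
  shows "inj_on e I"
  using assms unfolding inj_on_def by (metis IntI empty_iff)

text \<open>
  For each \<open>i\<close> a path from \<open>s i\<close> via \<open>y i\<close> to \<open>w i\<close>, where \<open>y i = w i\<close> encodes a single arc.
\<close>

definition exit_arcs :: "'i set \<Rightarrow> ('i \<Rightarrow> 'a) \<Rightarrow> ('i \<Rightarrow> 'a) \<Rightarrow> ('i \<Rightarrow> 'a) \<Rightarrow> 'a rel" where
  "exit_arcs I s y w = (\<Union>i\<in>I. if y i = w i then {(s i, w i)} else {(s i, y i), (y i, w i)})"

lemma card_exit_arcs: "finite I \<Longrightarrow> card (exit_arcs I s y w) \<le> 2 * card I"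
  unfolding exit_arcs_def by (rule card_UN_le_mult) auto

lemma exit_arcs_hit:
  assumes "i \<in> I" "s i \<in> T" "w i \<notin> T"
  shows "\<exists>e\<in>{y i, w i}. e \<in> out_nbhd (exit_arcs I s y w) T"
proof (cases "y i \<in> T")
  case True
  then have "y i \<noteq> w i" using assms by auto
  then have "(y i, w i) \<in> exit_arcs I s y w" using assms(1) by (auto simp: exit_arcs_def)
  then show ?thesis using True assms(3) by (auto simp: out_nbhd_iff)
next
  case False
  have "(s i, y i) \<in> exit_arcs I s y w" using assms(1) by (auto simp: exit_arcs_def)
  then show ?thesis using False assms(2) by (auto simp: out_nbhd_iff)
qed

context dense_digraph
begin

text \<open>\<open>N\<close> is chosen for \<open>card_high\<close> and \<open>\<theta>\<close> for
  \<open>high_closure\<close>. Vertices of \<open>B0\<close> have enough out-neighbours inside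
  \<open>W\<close> to force a target set of \<open>m\<close> vertices; those of \<open>Low\<close>
  first need extra arcs leading to \<open>B0\<close>.\<close>

context
  fixes m N \<theta> :: nat and W Low B0 :: "'a set"
  defines "\<theta> \<equiv> m + 3 * k + 2 * d" and "N \<equiv> 4 * m + 24 * k + 13 * d"
  assumes W: "W \<subseteq> V" "card W = N"
    and W_min: "\<And>w v. w \<in> W \<Longrightarrow> v \<in> V - W \<Longrightarrow> card (E `` {w}) \<le> card (E `` {v})"
  defines "Low \<equiv> {w\<in>W. card {y\<in>W. (w, y) \<in> E} < \<theta>}" and "B0 \<equiv> W - Low"
begin

lemma card_Low: "card Low \<le> 2 * m + 6 * k + 5 * d"
  using card_small_out_degree[OF W(1), of \<theta>] unfolding Low_def \<theta>_def by simp

lemma finite_nbrs: "finite (E `` {v})"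
  using arcs fin by (meson finite_Image finite_SigmaI finite_subset)

text \<open>The threshold is one more than the losses in \<open>short_exit\<close>: the bound on
  \<open>card Low\<close>, \<open>3 * k\<close> forbidden vertices and \<open>d\<close>
  non-neighbours.\<close>

lemma card_high: "3 * k < card {w\<in>W. 2 * m + 9 * k + 6 * d + 1 \<le> card {y\<in>W. (w, y) \<in> E}}"
  using card_large_out_degree[OF W(1), of "2 * m + 9 * k + 6 * d + 1"] W(2) k_pos by (simp add: N_def)

lemma card_B0: "3 * k < card B0"
proof -
  have "{w\<in>W. 2 * m + 9 * k + 6 * d + 1 \<le> card {y\<in>W. (w, y) \<in> E}} \<subseteq> B0"
    by (auto simp: B0_def Low_def \<theta>_def)
  moreover have "finite B0" using W(1) finite_sub by (auto simp: B0_def)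
  ultimately show ?thesis by (intro less_le_trans[OF card_high card_mono])
qed

text \<open>
  A vertex outside \<open>W\<close> that dominates no vertex of \<open>B0 - F\<close> spends at most \<open>card (Low \<union> F)\<close> of its
  arcs on \<open>W\<close>. As its out-degree is not smaller than that of a vertex \<open>w\<close> with large out-degree in
  \<open>W\<close>, it has an out-neighbour outside \<open>W\<close> that is not dominated by \<open>w\<close>.
\<close>

lemma short_exit:
  assumes v: "v \<in> V - W" and F: "finite F" "card F \<le> 3 * k"
  shows "\<exists>y w. w \<in> B0 - F \<and> (v, y) \<in> E \<and> y \<notin> Low \<union> F \<and> (y = w \<or> (y, w) \<in> E)"
proof (rule ccontr)
  assume none: "\<not> ?thesis"
  let ?H = "{w\<in>W. 2 * m + 9 * k + 6 * d + 1 \<le> card {y\<in>W. (w, y) \<in> E}}"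
  have "\<not> ?H \<subseteq> F" using card_high F(2) card_mono[OF F(1), of ?H] by linarith
  then obtain w where w: "w \<in> W" "2 * m + 9 * k + 6 * d + 1 \<le> card {y\<in>W. (w, y) \<in> E}" "w \<notin> F" by auto
  then have wB: "w \<in> B0 - F" by (auto simp: B0_def Low_def \<theta>_def)
  let ?N = "{u\<in>V. u \<noteq> w \<and> (w, u) \<notin> E \<and> (u, w) \<notin> E}"
  have finW: "finite W" using W finite_sub by blast
  have finL: "finite Low" unfolding Low_def using finW by simp
  have "E `` {v} \<subseteq> (Low \<union> F) \<union> (E `` {w} - W) \<union> ?N"
  proof
    fix y assume y: "y \<in> E `` {v}"
    show "y \<in> (Low \<union> F) \<union> (E `` {w} - W) \<union> ?N"
    proof (cases "y \<in> Low \<union> F")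
      case False
      then have "y \<notin> W" using none y by (auto simp: B0_def)
      moreover have "(y, w) \<notin> E" using none y False wB by blast
      ultimately show ?thesis using y w arcs by auto
    qed auto
  qed
  then have "card (E `` {v}) \<le> card ((Low \<union> F) \<union> (E `` {w} - W) \<union> ?N)"
    using finL F finite_nbrs fin by (intro card_mono) auto
  also have "\<dots> \<le> card Low + card F + card (E `` {w} - W) + card ?N"
    by (meson add_le_mono1 card_Un_le order_trans)
  also have "\<dots> \<le> (2 * m + 6 * k + 5 * d) + 3 * k + card (E `` {w} - W) + d"
    using card_Low F non_adj[of w] w W by (intro add_mono) auto
  also have "\<dots> < card {y\<in>W. (w, y) \<in> E} + card (E `` {w} - W)" using w by simp
  also have "\<dots> = card ({y\<in>W. (w, y) \<in> E} \<union> (E `` {w} - W))"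
    using finW finite_nbrs by (intro card_Un_disjoint[symmetric]) auto
  also have "{y\<in>W. (w, y) \<in> E} \<union> (E `` {w} - W) = E `` {w}" by auto
  also have "card (E `` {w}) \<le> card (E `` {v})" using W_min w v by blast
  finally show False by simp
qed

text \<open>Exits are chosen one at a time, the vertices already used being forbidden; each index
  uses at most two. The sources may coincide, as in \<open>exit_fan\<close>.\<close>

lemma disjoint_exits:
  fixes s :: "'i \<Rightarrow> 'a"
  assumes I: "finite I" "\<And>i. i \<in> I \<Longrightarrow> s i \<in> V - W" and F: "finite F" "card F + 2 * card I \<le> 3 * k"
  shows "\<exists>y w. (\<forall>i\<in>I. w i \<in> B0 - F \<and> (s i, y i) \<in> E \<and> y i \<notin> Low \<union> F \<and> (y i = w i \<or> (y i, w i) \<in> E)) \<and>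
    (\<forall>i\<in>I. \<forall>j\<in>I. i \<noteq> j \<longrightarrow> {y i, w i} \<inter> {y j, w j} = {})"
  using I F(2)
proof (induction I rule: finite_induct)
  case (insert i I)
  have "\<exists>y w. (\<forall>i\<in>I. w i \<in> B0 - F \<and> (s i, y i) \<in> E \<and> y i \<notin> Low \<union> F \<and> (y i = w i \<or> (y i, w i) \<in> E)) \<and>
    (\<forall>i\<in>I. \<forall>j\<in>I. i \<noteq> j \<longrightarrow> {y i, w i} \<inter> {y j, w j} = {})"
    by (rule insert.IH) (use insert in auto)
  then obtain y w where yw:
    "\<forall>j\<in>I. w j \<in> B0 - F \<and> (s j, y j) \<in> E \<and> y j \<notin> Low \<union> F \<and> (y j = w j \<or> (y j, w j) \<in> E)"
    "\<forall>j\<in>I. \<forall>l\<in>I. j \<noteq> l \<longrightarrow> {y j, w j} \<inter> {y l, w l} = {}"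
    by blast
  let ?F = "F \<union> y ` I \<union> w ` I"
  have "card ?F \<le> card F + card I + card I"
    by (intro order_trans[OF card_Un_le] add_mono card_image_le insert.hyps order_refl)
  then have "card ?F \<le> 3 * k" using insert by simp
  moreover have "finite ?F" using F insert by simp
  ultimately obtain y' w' where new: "w' \<in> B0 - ?F" "(s i, y') \<in> E" "y' \<notin> Low \<union> ?F" "y' = w' \<or> (y', w') \<in> E"
    using short_exit[of "s i" ?F] insert.prems by auto
  let ?y = "y(i := y')" and ?w = "w(i := w')"
  have "\<forall>j\<in>insert i I. ?w j \<in> B0 - F \<and> (s j, ?y j) \<in> E \<and> ?y j \<notin> Low \<union> F \<and> (?y j = ?w j \<or> (?y j, ?w j) \<in> E)"
    using yw(1) new by auto
  moreover have "\<forall>j\<in>insert i I. \<forall>l\<in>insert i I. j \<noteq> l \<longrightarrow> {?y j, ?w j} \<inter> {?y l, ?w l} = {}"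
  proof (intro ballI impI)
    have *: "{y', w'} \<inter> {y j, w j} = {}" if "j \<in> I" for j using new that by auto
    fix j l assume "j \<in> insert i I" "l \<in> insert i I" "j \<noteq> l"
    then show "{?y j, ?w j} \<inter> {?y l, ?w l} = {}"
      using *[of j] *[of l] yw(2)[rule_format, of j l] insert.hyps by (cases "j = i"; cases "l = i") auto
  qed
  ultimately show ?case by blast
qed simp

lemma exit_arcs_subset:
  assumes "\<forall>i\<in>I. w i \<in> B0 - F \<and> (s i, y i) \<in> E \<and> y i \<notin> Low \<union> F \<and> (y i = w i \<or> (y i, w i) \<in> E)"
  shows "exit_arcs I s y w \<subseteq> E"
  using assms by (auto simp: exit_arcs_def)

text \<open>The \<open>k\<close> exits share only \<open>v\<close>, so each leaves a set containing
  \<open>v\<close> and avoiding \<open>W\<close> in a vertex of its own.\<close>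

lemma exit_fan:
  assumes v: "v \<in> V - W"
  shows "\<exists>K\<subseteq>E. card K \<le> 2 * k \<and> (\<forall>T. v \<in> T \<longrightarrow> T \<inter> W = {} \<longrightarrow> k \<le> card (out_nbhd K T))"
proof -
  obtain y w where yw: "\<forall>i\<in>{..<k}. w i \<in> B0 - {} \<and> (v, y i) \<in> E \<and> y i \<notin> Low \<union> {} \<and> (y i = w i \<or> (y i, w i) \<in> E)"
    and dj: "\<forall>i\<in>{..<k}. \<forall>j\<in>{..<k}. i \<noteq> j \<longrightarrow> {y i, w i} \<inter> {y j, w j} = {}"
    using disjoint_exits[of "{..<k}" "\<lambda>_. v" "{}", OF finite_lessThan v finite.emptyI] by force
  let ?K = "exit_arcs {..<k} (\<lambda>_. v) y w"
  have K: "?K \<subseteq> E" using exit_arcs_subset[OF yw] .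
  have "k \<le> card (out_nbhd ?K T)" if T: "v \<in> T" "T \<inter> W = {}" for T
  proof -
    have "\<forall>i\<in>{..<k}. \<exists>e\<in>{y i, w i}. e \<in> out_nbhd ?K T"
    proof
      fix i assume i: "i \<in> {..<k}"
      have "w i \<notin> T" using yw i T by (auto simp: B0_def)
      then show "\<exists>e\<in>{y i, w i}. e \<in> out_nbhd ?K T" using exit_arcs_hit[OF i, of "\<lambda>_. v" T w y] T by simp
    qed
    then obtain e where e: "\<forall>i\<in>{..<k}. e i \<in> {y i, w i} \<and> e i \<in> out_nbhd ?K T" by metis
    have "inj_on e {..<k}"
      by (rule inj_on_of_disjoint[where A = "\<lambda>i. {y i, w i}"], use e in blast, use dj in blast)
    then have "k = card (e ` {..<k})" by (simp add: card_image)
    also have "\<dots> \<le> card (out_nbhd ?K T)" using e by (intro card_mono finite_out K) auto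
    finally show ?thesis .
  qed
  then show ?thesis using K card_exit_arcs[of "{..<k}" "\<lambda>_. v" y w] by (intro exI[of _ ?K]) auto
qed

text \<open>A fan inside \<open>Low\<close> leads from \<open>v\<close> to at most \<open>k\<close>
  end vertices \<open>Y\<close> outside \<open>Low\<close>. Those in \<open>W\<close> are already in
  \<open>B0\<close>; the others are continued to \<open>B0\<close> by disjoint exits avoiding
  \<open>Low\<close> and \<open>Y\<close>. Only the exits are charged to \<open>C\<close>.\<close>

lemma low_fan:
  assumes v: "v \<in> Low"
  shows "\<exists>C\<subseteq>E. card C \<le> 2 * k \<and>
    (\<forall>T\<subseteq>V. v \<in> T \<longrightarrow> T \<inter> B0 = {} \<longrightarrow> k \<le> card (out_nbhd (C \<union> E \<inter> W \<times> UNIV) T))"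
proof -
  let ?G = "E \<inter> Low \<times> UNIV" and ?Z = "V - Low"
  have GV: "?G \<subseteq> V \<times> V" using arcs by auto
  have LowW: "Low \<subseteq> W" by (auto simp: Low_def)
  have "k \<le> card (out_nbhd ?G T)" if T: "T \<subseteq> V" "v \<in> T" "T \<inter> ?Z = {}" for T
  proof -
    have TL: "T \<subseteq> Low" using T by auto
    then have eq: "out_nbhd ?G T = out_nbhd E T" by (auto simp: out_nbhd_def)
    show ?thesis
    proof (cases "V - T - out_nbhd E T = {}")
      case True
      then have "B0 \<subseteq> out_nbhd E T" using TL W by (auto simp: B0_def)
      then have "card B0 \<le> card (out_nbhd E T)" by (intro card_mono finite_out) auto
      then show ?thesis using card_B0 eq by simp
    next
      case False
      then show ?thesis using conn[of T] T eq by auto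
    qed
  qed
  then obtain Y where Y: "Y \<subseteq> ?Z" "card Y \<le> k"
    and cut: "\<And>T. T \<subseteq> V \<Longrightarrow> v \<in> T \<Longrightarrow> T \<inter> Y = {} \<Longrightarrow> k \<le> card (out_nbhd ?G T)"
    using fan_endpoints[OF fin GV, of ?Z v k] fin by auto
  have finY: "finite Y" using Y fin finite_subset by blast
  let ?I = "Y - W"
  have I: "card ?I \<le> k" using Y card_mono[OF finY, of ?I] by auto
  obtain y w where yw: "\<forall>i\<in>?I. w i \<in> B0 - Y \<and> (i, y i) \<in> E \<and> y i \<notin> Low \<union> Y \<and> (y i = w i \<or> (y i, w i) \<in> E)"
    and dj: "\<forall>i\<in>?I. \<forall>j\<in>?I. i \<noteq> j \<longrightarrow> {y i, w i} \<inter> {y j, w j} = {}"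
  proof -
    have "\<exists>y w. (\<forall>i\<in>?I. w i \<in> B0 - Y \<and> (i, y i) \<in> E \<and> y i \<notin> Low \<union> Y \<and> (y i = w i \<or> (y i, w i) \<in> E)) \<and>
      (\<forall>i\<in>?I. \<forall>j\<in>?I. i \<noteq> j \<longrightarrow> {y i, w i} \<inter> {y j, w j} = {})"
      by (rule disjoint_exits) (use finY Y I in auto)
    then show thesis using that by blast
  qed
  let ?C = "exit_arcs ?I (\<lambda>i. i) y w"
  have CE: "?C \<subseteq> E" using exit_arcs_subset[OF yw] .
  let ?K = "?C \<union> E \<inter> W \<times> UNIV"
  have "k \<le> card (out_nbhd ?K T)" if T: "T \<subseteq> V" "v \<in> T" "T \<inter> B0 = {}" for T
  proof -
    \<comment> \<open>Outside \<open>Low\<close> all but the end vertices are added, so that the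
      boundary lies in \<open>Low \<union> Y\<close>.\<close>
    let ?T = "(T \<inter> Low) \<union> (V - Low - Y)"
    have k1: "k \<le> card (out_nbhd ?G ?T)" by (rule cut) (use T Y v in auto)
    have "\<forall>i\<in>?I \<inter> T. \<exists>e\<in>{y i, w i}. e \<in> out_nbhd ?C T"
    proof
      fix i assume i: "i \<in> ?I \<inter> T"
      have "w i \<notin> T" using yw i T by auto
      then show "\<exists>e\<in>{y i, w i}. e \<in> out_nbhd ?C T" using exit_arcs_hit[of i ?I "\<lambda>i. i" T w y] i by auto
    qed
    then obtain e where e: "\<And>i. i \<in> ?I \<inter> T \<Longrightarrow> e i \<in> {y i, w i} \<and> e i \<in> out_nbhd ?C T" by metis
    have e_out: "e i \<notin> Low \<union> Y" if "i \<in> ?I \<inter> T" for i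
      using e[OF that] yw that by (auto simp: B0_def)
    have inj_e: "inj_on e (?I \<inter> T)"
      by (rule inj_on_of_disjoint[where A = "\<lambda>i. {y i, w i}"], use e in blast, use dj in blast)
    \<comment> \<open>A boundary vertex in \<open>T\<close> is an end vertex and is replaced by the
      vertex where its exit leaves \<open>T\<close>. Replacements avoid \<open>Low\<close> and
      \<open>Y\<close>, so they differ from the boundary vertices that are kept.\<close>
    let ?g = "\<lambda>x. if x \<in> T then e x else x"
    have P: "x \<in> Low \<union> Y" "x \<in> T \<Longrightarrow> x \<in> ?I \<inter> T" "x \<notin> T \<Longrightarrow> x \<in> out_nbhd ?K T"
      if x: "x \<in> out_nbhd ?G ?T" for x
    proof -
      obtain u where u: "u \<in> ?T" "(u, x) \<in> E" "u \<in> Low" "x \<notin> ?T" using x by (auto simp: out_nbhd_def)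
      show "x \<in> Low \<union> Y" using u arcs by auto
      show "x \<in> ?I \<inter> T" if "x \<in> T" using u that T Y arcs by (auto simp: B0_def)
      show "x \<in> out_nbhd ?K T" if "x \<notin> T" using u that LowW by (auto simp: out_nbhd_def)
    qed
    have "inj_on ?g (out_nbhd ?G ?T)"
    proof (rule inj_onI)
      fix a b assume ab: "a \<in> out_nbhd ?G ?T" "b \<in> out_nbhd ?G ?T" "?g a = ?g b"
      show "a = b"
      proof (cases "a \<in> T"; cases "b \<in> T")
        assume "a \<in> T" "b \<in> T"
        then have "a \<in> ?I \<inter> T" "b \<in> ?I \<inter> T" "e a = e b" using P(2) ab by auto
        then show "a = b" using inj_onD[OF inj_e] by blast
      next
        assume t: "a \<in> T" "b \<notin> T"
        then have "e a \<in> Low \<union> Y" using P(1)[OF ab(2)] ab(3) by auto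
        then show "a = b" using e_out P(2) ab t by blast
      next
        assume t: "a \<notin> T" "b \<in> T"
        then have "e b \<in> Low \<union> Y" using P(1)[OF ab(1)] ab(3) by auto
        then show "a = b" using e_out P(2) ab t by blast
      qed (use ab in auto)
    qed
    moreover have "?g ` out_nbhd ?G ?T \<subseteq> out_nbhd ?K T"
    proof clarify
      fix x assume x: "x \<in> out_nbhd ?G ?T"
      show "?g x \<in> out_nbhd ?K T"
        using e[of x] P(2,3)[OF x] out_nbhd_mono[of ?C ?K T] by auto
    qed
    moreover have "finite (out_nbhd ?K T)" using CE by (intro finite_out) auto
    ultimately have "card (out_nbhd ?G ?T) \<le> card (out_nbhd ?K T)" by (rule card_inj_on_le)
    then show ?thesis using k1 by simp
  qed
  moreover have "card ?C \<le> 2 * k" using card_exit_arcs[of ?I "\<lambda>i. i" y w] finY I by simp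
  ultimately show ?thesis using CE by blast
qed

text \<open>A vertex of \<open>B0\<close> has at least \<open>\<theta>\<close> out-neighbours in
  \<open>W\<close>. Discarding at most \<open>2 * d + 2 * k\<close> of small weak in-degree and
  fewer than \<open>k\<close> in the separator leaves more than \<open>m\<close>, hence some
  \<open>z\<close> in \<open>T - B\<close>, which \<open>weak_in_less\<close> compares with a missed
  vertex of \<open>B\<close>.\<close>

lemma high_closure:
  assumes B: "B \<subseteq> W" "card B = m" and top: "\<And>x z. x \<in> B \<Longrightarrow> z \<in> W - B \<Longrightarrow> card (weak_in W z) \<le> card (weak_in W x)"
    and T: "T \<inter> B0 \<noteq> {}" "card (out_nbhd (E \<inter> W \<times> UNIV) T) < k"
  shows "B \<subseteq> T \<union> out_nbhd (E \<inter> W \<times> UNIV) T"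
proof (rule ccontr)
  let ?K = "E \<inter> W \<times> UNIV"
  let ?S = "out_nbhd ?K T"
  assume "\<not> ?thesis"
  then obtain x where x: "x \<in> B" "x \<notin> T" "x \<notin> ?S" by auto
  obtain b where b: "b \<in> T" "b \<in> B0" using T by auto
  have bW: "b \<in> W" using b by (auto simp: B0_def)
  have finS: "finite ?S" by (rule finite_out) auto
  let ?\<Gamma> = "{y\<in>W. (b, y) \<in> E}"
  let ?G = "{z\<in>?\<Gamma>. d + k \<le> card (weak_in ?\<Gamma> z)}"
  have \<Gamma>TS: "?\<Gamma> \<subseteq> T \<union> ?S" using b bW by (auto simp: out_nbhd_def)
  have "card ?\<Gamma> \<le> card ?G + 2 * d + 2 * k" using card_large_weak_in[of ?\<Gamma>] W by auto
  moreover have "m + 3 * k + 2 * d \<le> card ?\<Gamma>" using b by (auto simp: B0_def Low_def \<theta>_def)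
  moreover have "card ?G - card ?S \<le> card (?G - ?S)" by (rule diff_card_le_card_Diff[OF finS])
  ultimately have large: "m < card (?G - ?S)" using T(2) by linarith
  have finB: "finite B" using B W finite_sub by (meson subset_trans)
  have "\<not> ?G - ?S \<subseteq> B" using card_mono[OF finB, of "?G - ?S"] large B by linarith
  then obtain z where z: "z \<in> ?G" "z \<notin> ?S" "z \<notin> B" by auto
  then have zT: "z \<in> T" using \<Gamma>TS by auto
  have "card (weak_in W x) < card (weak_in W z)"
  proof (rule weak_in_less[where T = T and S = ?S and \<Gamma> = ?\<Gamma>])
    show "(z, r) \<notin> E" if "r \<in> W - T - ?S" for r
      using that z zT by (auto simp: out_nbhd_def)
    show "(y, x) \<notin> E" if "y \<in> W \<inter> T" for y
      using that x by (auto simp: out_nbhd_def)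
  qed (use B W x z zT finS T \<Gamma>TS in auto)
  moreover have "card (weak_in W z) \<le> card (weak_in W x)" using top[OF x(1), of z] z by auto
  ultimately show False by simp
qed

end

text \<open>A set meeting \<open>W\<close> contains a vertex of \<open>B0\<close>, where
  \<open>high_closure\<close> applies, or only vertices of \<open>Low\<close> from \<open>W\<close>,
  whose fans give \<open>k\<close> out-neighbours. The arcs leaving \<open>W\<close> are not bounded
  in number here; \<open>rooted_sparsification\<close> thins them out later.\<close>

lemma core_structure:
  assumes N: "4 * m + 24 * k + 13 * d \<le> card V"
  shows "\<exists>W B C. W \<subseteq> V \<and> card W = 4 * m + 24 * k + 13 * d \<and> B \<subseteq> W \<and> card B = m \<and>
    C \<subseteq> E \<and> card C \<le> 2 * k * (2 * m + 6 * k + 5 * d) \<and>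
    (\<forall>T\<subseteq>V. T \<inter> W \<noteq> {} \<longrightarrow> card (out_nbhd (C \<union> E \<inter> W \<times> UNIV) T) < k \<longrightarrow>
       B \<subseteq> T \<union> out_nbhd (C \<union> E \<inter> W \<times> UNIV) T) \<and>
    (\<forall>v\<in>V - W. \<exists>K\<subseteq>E. card K \<le> 2 * k \<and> (\<forall>T. v \<in> T \<longrightarrow> T \<inter> W = {} \<longrightarrow> k \<le> card (out_nbhd K T)))"
proof -
  obtain W where W: "W \<subseteq> V" "card W = 4 * m + 24 * k + 13 * d"
    and W_min: "\<And>w v. w \<in> W \<Longrightarrow> v \<in> V - W \<Longrightarrow> card (E `` {w}) \<le> card (E `` {v})"
    using top_subset[OF fin N, of "\<lambda>v. - int (card (E `` {v}))"] by auto
  have finW: "finite W" using W finite_sub by blast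
  obtain B where B: "B \<subseteq> W" "card B = m"
    and top: "\<And>x z. x \<in> B \<Longrightarrow> z \<in> W - B \<Longrightarrow> card (weak_in W z) \<le> card (weak_in W x)"
    using top_subset[OF finW, of m "\<lambda>z. int (card (weak_in W z))"] W by auto
  define Low where "Low = {w\<in>W. card {y\<in>W. (w, y) \<in> E} < m + 3 * k + 2 * d}"
  have finL: "finite Low" using finW by (simp add: Low_def)
  have "\<forall>v\<in>Low. \<exists>C. C \<subseteq> E \<and> card C \<le> 2 * k \<and>
      (\<forall>T\<subseteq>V. v \<in> T \<longrightarrow> T \<inter> (W - Low) = {} \<longrightarrow> k \<le> card (out_nbhd (C \<union> E \<inter> W \<times> UNIV) T))"
    using low_fan[OF W W_min] unfolding Low_def by simp
  from bchoice[OF this] obtain c where c: "\<forall>v\<in>Low. c v \<subseteq> E \<and> card (c v) \<le> 2 * k \<and>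
      (\<forall>T\<subseteq>V. v \<in> T \<longrightarrow> T \<inter> (W - Low) = {} \<longrightarrow> k \<le> card (out_nbhd (c v \<union> E \<inter> W \<times> UNIV) T))"
    by blast
  let ?C = "\<Union>v\<in>Low. c v"
  have CE: "?C \<subseteq> E" using c by auto
  have "card ?C \<le> 2 * k * card Low" using c finL by (intro card_UN_le_mult) auto
  also have "\<dots> \<le> 2 * k * (2 * m + 6 * k + 5 * d)"
    using card_Low[OF W W_min] unfolding Low_def by (intro mult_le_mono2)
  finally have cardC: "card ?C \<le> 2 * k * (2 * m + 6 * k + 5 * d)" .
  let ?K = "?C \<union> E \<inter> W \<times> UNIV"
  have KV: "?K \<subseteq> V \<times> V" using CE arcs by blast
  have closure: "B \<subseteq> T \<union> out_nbhd ?K T" if T: "T \<subseteq> V" "T \<inter> W \<noteq> {}" "card (out_nbhd ?K T) < k" for T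
  proof -
    have "T \<inter> (W - Low) \<noteq> {}"
    proof
      assume e: "T \<inter> (W - Low) = {}"
      then obtain v where v: "v \<in> Low" "v \<in> T" using T by auto
      then have "k \<le> card (out_nbhd (c v \<union> E \<inter> W \<times> UNIV) T)" using c T e by blast
      also have "\<dots> \<le> card (out_nbhd ?K T)"
        by (rule card_out_nbhd_mono[OF fin KV]) (use v in auto)
      finally show False using T by simp
    qed
    moreover have "card (out_nbhd (E \<inter> W \<times> UNIV) T) < k"
      using card_out_nbhd_mono[OF fin KV, of "E \<inter> W \<times> UNIV" T] T by auto
    ultimately have "B \<subseteq> T \<union> out_nbhd (E \<inter> W \<times> UNIV) T"
      using high_closure[OF W W_min B top] unfolding Low_def by blast
    then show ?thesis using out_nbhd_mono[of "E \<inter> W \<times> UNIV" ?K T] by blast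
  qed
  show ?thesis
  proof (intro exI conjI)
    show "\<forall>T\<subseteq>V. T \<inter> W \<noteq> {} \<longrightarrow> card (out_nbhd ?K T) < k \<longrightarrow> B \<subseteq> T \<union> out_nbhd ?K T"
      using closure by simp
    show "\<forall>v\<in>V - W. \<exists>K\<subseteq>E. card K \<le> 2 * k \<and> (\<forall>T. v \<in> T \<longrightarrow> T \<inter> W = {} \<longrightarrow> k \<le> card (out_nbhd K T))"
      using exit_fan[OF W W_min] by simp
  qed (fact W B CE cardC)+
qed

end

section \<open>Minimum linkages\<close>

text \<open>
  By Menger's theorem \<open>linked V X Y k F\<close> says that \<open>F\<close> contains \<open>k\<close> disjoint paths from \<open>X\<close> to \<open>Y\<close>. Instead
  of extracting these paths, everything needed is derived from the minimality of \<open>F\<close>.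
\<close>

definition sep_set :: "'a set \<Rightarrow> 'a rel \<Rightarrow> 'a set \<Rightarrow> 'a set" where
  "sep_set X F T = out_nbhd F T \<union> (X - T)"

definition linked :: "'a set \<Rightarrow> 'a set \<Rightarrow> 'a set \<Rightarrow> nat \<Rightarrow> 'a rel \<Rightarrow> bool" where
  "linked V X Y k F \<longleftrightarrow> (\<forall>T\<subseteq>V. T \<inter> Y = {} \<longrightarrow> k \<le> card (sep_set X F T))"

text \<open>\<open>sep_set X F T\<close> is the out-neighbourhood of \<open>T\<close> after adding
  to \<open>T\<close> a source joined to all of \<open>X\<close>. Minimality is among all linked
  subsets of \<open>E\<close>, since \<open>chordless\<close> exchanges an arc of \<open>F\<close>
  for one outside.\<close>

locale minimal_linkage =
  fixes V :: "'a set" and E :: "'a rel" and X Y :: "'a set" and k :: nat and F :: "'a rel"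
  assumes fin: "finite V" and arcs: "E \<subseteq> V \<times> V" and X: "X \<subseteq> V"
    and F: "F \<subseteq> E" "linked V X Y k F"
    and min_card: "F' \<subseteq> E \<Longrightarrow> linked V X Y k F' \<Longrightarrow> card F \<le> card F'"
begin

lemma finite_F: "finite F"
  using F arcs fin by (meson finite_SigmaI finite_subset)

lemma finite_sep: "F' \<subseteq> E \<Longrightarrow> finite (sep_set X F' T)"
  unfolding sep_set_def using finite_out_nbhd[OF fin, of F' T] arcs X fin finite_subset[of X V] by auto

lemma linkedD: "T \<subseteq> V \<Longrightarrow> T \<inter> Y = {} \<Longrightarrow> k \<le> card (sep_set X F T)"
  using F unfolding linked_def by blast

text \<open>Deleting the arc violates the condition for some \<open>T\<close>, and only
  \<open>v\<close> can drop out of its separating set. So \<open>T\<close> was tight, and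
  \<open>v\<close> was there only on account of \<open>u\<close>.\<close>

lemma critical:
  assumes uv: "(u, v) \<in> F"
  obtains T where "T \<subseteq> V" "T \<inter> Y = {}" "u \<in> T" "v \<notin> T" "v \<notin> X" "card (sep_set X F T) = k"
    "\<And>x. (x, v) \<in> F \<Longrightarrow> x \<noteq> u \<Longrightarrow> x \<notin> T"
proof -
  let ?F = "F - {(u, v)}"
  have "card ?F < card F" by (rule card_Diff1_less[OF finite_F uv])
  then have "\<not> linked V X Y k ?F" using min_card[of ?F] F by auto
  then obtain T where T: "T \<subseteq> V" "T \<inter> Y = {}" "card (sep_set X ?F T) < k"
    unfolding linked_def by (meson not_le)
  have ge: "k \<le> card (sep_set X F T)" using T linkedD by blast
  have fin1: "finite (sep_set X ?F T)" by (rule finite_sep) (use F in auto)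
  have sub: "sep_set X F T \<subseteq> insert v (sep_set X ?F T)" by (auto simp: sep_set_def out_nbhd_iff)
  have v: "v \<in> sep_set X F T" "v \<notin> sep_set X ?F T"
  proof -
    show "v \<in> sep_set X F T"
    proof (rule ccontr)
      assume "v \<notin> sep_set X F T"
      then have "sep_set X F T \<subseteq> sep_set X ?F T" using sub by auto
      then show False using card_mono[OF fin1] T(3) ge by (meson le_trans not_le)
    qed
    show "v \<notin> sep_set X ?F T"
    proof
      assume "v \<in> sep_set X ?F T"
      then have "sep_set X F T \<subseteq> sep_set X ?F T" using sub by auto
      then show False using card_mono[OF fin1] T(3) ge by (meson le_trans not_le)
    qed
  qed
  have "card (sep_set X F T) \<le> card (insert v (sep_set X ?F T))" using sub fin1 by (intro card_mono) auto
  also have "\<dots> \<le> k" using T(3) v(2) fin1 by simp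
  finally have k: "card (sep_set X F T) = k" using ge by simp
  have "v \<notin> T" "v \<notin> X" using v by (auto simp: sep_set_def out_nbhd_iff)
  moreover have "u \<in> T" using v by (auto simp: sep_set_def out_nbhd_iff)
  moreover have "x \<notin> T" if "(x, v) \<in> F" "x \<noteq> u" for x
    using that v(2) \<open>v \<notin> T\<close> by (auto simp: sep_set_def out_nbhd_iff)
  ultimately show thesis using that[of T] T k by blast
qed

text \<open>With \<open>D = {}\<close> this is plain submodularity. Vertices common to both
  separating sets may be counted in addition, as \<open>in_unique\<close> needs.\<close>

lemma sep_submodular:
  assumes "A \<subseteq> sep_set X F (T \<inter> T') \<union> D" "D \<subseteq> sep_set X F T \<inter> sep_set X F T'"
  shows "card A + card (sep_set X F (T \<union> T')) \<le> card (sep_set X F T) + card (sep_set X F T')"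
proof (rule card_add_le_cross)
  have 1: "sep_set X F (T \<inter> T') \<subseteq> sep_set X F T \<union> sep_set X F T'"
    "sep_set X F (T \<union> T') \<subseteq> sep_set X F T \<union> sep_set X F T'"
    by (auto simp: sep_set_def out_nbhd_iff)
  have 2: "sep_set X F (T \<inter> T') \<inter> sep_set X F (T \<union> T') \<subseteq> sep_set X F T \<inter> sep_set X F T'"
    by (auto simp: sep_set_def out_nbhd_iff)
  show "A \<union> sep_set X F (T \<union> T') \<subseteq> sep_set X F T \<union> sep_set X F T'"
    using 1 assms by blast
  show "A \<inter> sep_set X F (T \<union> T') \<subseteq> sep_set X F T \<inter> sep_set X F T'"
    using 2 assms by blast
qed (use F finite_sep in auto)

lemma tight_Int:
  assumes T: "T \<subseteq> V" "T \<inter> Y = {}" "card (sep_set X F T) = k"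
    and T': "T' \<subseteq> V" "T' \<inter> Y = {}" "card (sep_set X F T') = k"
  shows "card (sep_set X F (T \<inter> T')) = k"
proof -
  have "k \<le> card (sep_set X F (T \<inter> T'))" by (rule linkedD) (use T T' in auto)
  moreover have "k \<le> card (sep_set X F (T \<union> T'))" by (rule linkedD) (use T T' in auto)
  ultimately show ?thesis
    using sep_submodular[of "sep_set X F (T \<inter> T')" T T' "{}"] T(3) T'(3) by simp
qed

text \<open>The intersection of critical sets for the two arcs is tight, and \<open>v\<close> and
  \<open>v'\<close> are in its separating set only through \<open>u\<close>. Removing
  \<open>u\<close> loses both and gains at most \<open>u\<close>.\<close>

lemma out_unique:
  assumes "(u, v) \<in> F" "(u, v') \<in> F"
  shows "v = v'"
proof (rule ccontr)
  assume ne: "v \<noteq> v'"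
  obtain T where T: "T \<subseteq> V" "T \<inter> Y = {}" "u \<in> T" "v \<notin> T" "v \<notin> X" "card (sep_set X F T) = k"
    "\<And>x. (x, v) \<in> F \<Longrightarrow> x \<noteq> u \<Longrightarrow> x \<notin> T" using critical[OF assms(1)] by blast
  obtain T' where T': "T' \<subseteq> V" "T' \<inter> Y = {}" "u \<in> T'" "v' \<notin> T'" "v' \<notin> X" "card (sep_set X F T') = k"
    "\<And>x. (x, v') \<in> F \<Longrightarrow> x \<noteq> u \<Longrightarrow> x \<notin> T'" using critical[OF assms(2)] by blast
  let ?T = "T \<inter> T'"
  have k: "card (sep_set X F ?T) = k" using tight_Int T T' by blast
  have vv: "v \<in> sep_set X F ?T" "v' \<in> sep_set X F ?T"
    using T(3,4) T'(3,4) assms by (auto simp: sep_set_def out_nbhd_iff)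
  have fs: "finite (sep_set X F ?T)" using F finite_sep by blast
  have "k \<le> card (sep_set X F (?T - {u}))" by (rule linkedD) (use T T' in auto)
  also have "\<dots> \<le> card (insert u (sep_set X F ?T - {v, v'}))"
  proof (rule card_mono)
    show "sep_set X F (?T - {u}) \<subseteq> insert u (sep_set X F ?T - {v, v'})"
      using T(5) T'(5) by (auto simp: sep_set_def out_nbhd_iff dest: T(7) T'(7))
  qed (use fs in auto)
  also have "\<dots> \<le> Suc (card (sep_set X F ?T - {v, v'}))" using fs by (simp add: card_insert_if)
  also have "card (sep_set X F ?T - {v, v'}) = k - 2"
    using vv ne k fs by (simp add: card_Diff_subset)
  finally have "k \<le> Suc (k - 2)" .
  moreover have "2 \<le> k" using card_mono[OF fs, of "{v, v'}"] vv ne k by simp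
  ultimately show False by simp
qed

text \<open>For critical sets of the two arcs, \<open>v\<close> belongs to both separating sets but
  not to that of the intersection, which contains no in-neighbour of \<open>v\<close>. This slack
  contradicts submodularity.\<close>

lemma in_unique:
  assumes "(u, v) \<in> F" "(u', v) \<in> F"
  shows "u = u'"
proof (rule ccontr)
  assume ne: "u \<noteq> u'"
  obtain T where T: "T \<subseteq> V" "T \<inter> Y = {}" "u \<in> T" "v \<notin> T" "v \<notin> X" "card (sep_set X F T) = k"
    "\<And>x. (x, v) \<in> F \<Longrightarrow> x \<noteq> u \<Longrightarrow> x \<notin> T" using critical[OF assms(1)] by blast
  obtain T' where T': "T' \<subseteq> V" "T' \<inter> Y = {}" "u' \<in> T'" "v \<notin> T'" "v \<notin> X" "card (sep_set X F T') = k"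
    "\<And>x. (x, v) \<in> F \<Longrightarrow> x \<noteq> u' \<Longrightarrow> x \<notin> T'" using critical[OF assms(2)] by blast
  let ?A = "sep_set X F (T \<inter> T')"
  have v: "v \<notin> ?A" using T(5) ne by (auto simp: sep_set_def out_nbhd_iff dest: T(7) T'(7))
  have "card (insert v ?A) + card (sep_set X F (T \<union> T')) \<le> card (sep_set X F T) + card (sep_set X F T')"
    by (rule sep_submodular[where D = "{v}"])
      (use T(3,4) T'(3,4) assms in \<open>auto simp: sep_set_def out_nbhd_iff\<close>)
  moreover have "card (insert v ?A) = Suc (card ?A)" using v finite_sep[OF F(1)] by simp
  moreover have "k \<le> card ?A" by (rule linkedD) (use T T' in auto)
  moreover have "k \<le> card (sep_set X F (T \<union> T'))" by (rule linkedD) (use T T' in auto)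
  ultimately show False using T(6) T'(6) by simp
qed

lemma tail_notin_Y: "(u, v) \<in> F \<Longrightarrow> u \<notin> Y"
  using critical by (metis disjoint_iff)

text \<open>Enlarging a critical set of the arc by a closed \<open>R\<close> that avoids
  \<open>Y\<close> adds nothing to the separating set and absorbs \<open>v\<close>, which would
  leave fewer than \<open>k\<close> vertices.\<close>

lemma forward_closed_meets_Y:
  assumes uv: "(u, v) \<in> F" and R: "R \<subseteq> V" "v \<in> R" "F `` R \<subseteq> R"
  shows "R \<inter> Y \<noteq> {}"
proof
  assume RY: "R \<inter> Y = {}"
  obtain T where T: "T \<subseteq> V" "T \<inter> Y = {}" "u \<in> T" "v \<notin> T" "v \<notin> X" "card (sep_set X F T) = k"
    using critical[OF uv] by blast
  have fs: "finite (sep_set X F T)" using F finite_sep by blast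
  have "k \<le> card (sep_set X F (T \<union> R))" by (rule linkedD) (use T R RY in auto)
  also have "\<dots> \<le> card (sep_set X F T - {v})"
  proof (rule card_mono)
    have "\<And>x y. x \<in> R \<Longrightarrow> (x, y) \<in> F \<Longrightarrow> y \<in> R" using R by auto
    then show "sep_set X F (T \<union> R) \<subseteq> sep_set X F T - {v}"
      using R(2) by (auto simp: sep_set_def out_nbhd_iff)
  qed (use fs in auto)
  also have "\<dots> < card (sep_set X F T)"
    using T(3,4) uv by (intro card_Diff1_less[OF fs]) (auto simp: sep_set_def out_nbhd_iff)
  finally show False using T(6) by simp
qed

text \<open>Removing \<open>R\<close> from a critical set of the arc loses \<open>v\<close>, whose
  only in-neighbour there is \<open>u\<close>. Nothing is gained if \<open>R\<close> avoids
  \<open>X\<close>, since no arc enters \<open>R\<close> from outside.\<close>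

lemma backward_closed_meets_X:
  assumes uv: "(u, v) \<in> F" and R: "u \<in> R" "F\<inverse> `` R \<subseteq> R"
  shows "R \<inter> X \<noteq> {}"
proof
  assume RX: "R \<inter> X = {}"
  obtain T where T: "T \<subseteq> V" "T \<inter> Y = {}" "u \<in> T" "v \<notin> T" "v \<notin> X" "card (sep_set X F T) = k"
    "\<And>x. (x, v) \<in> F \<Longrightarrow> x \<noteq> u \<Longrightarrow> x \<notin> T" using critical[OF uv] by blast
  have fs: "finite (sep_set X F T)" using F finite_sep by blast
  have "k \<le> card (sep_set X F (T - R))" by (rule linkedD) (use T in auto)
  also have "\<dots> \<le> card (sep_set X F T - {v})"
  proof (rule card_mono)
    show "sep_set X F (T - R) \<subseteq> sep_set X F T - {v}"
    proof
      fix y assume y: "y \<in> sep_set X F (T - R)"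
      show "y \<in> sep_set X F T - {v}"
      proof (cases "y \<in> X - (T - R)")
        case True
        then show ?thesis using RX T(5) by (auto simp: sep_set_def)
      next
        case False
        then obtain x where x: "x \<in> T" "x \<notin> R" "(x, y) \<in> F" "y \<notin> T - R"
          using y by (auto simp: sep_set_def out_nbhd_iff)
        then have "y \<notin> R" using R(2) by auto
        then show ?thesis using x R(1) by (auto simp: sep_set_def out_nbhd_iff dest: T(7))
      qed
    qed
  qed (use fs in auto)
  also have "\<dots> < card (sep_set X F T)"
    using T(3,4) uv by (intro card_Diff1_less[OF fs]) (auto simp: sep_set_def out_nbhd_iff)
  finally show False using T(6) by simp
qed

end

text \<open>
  Replacing the first arc of the segment of \<open>F\<close> from \<open>t\<close> to \<open>q\<close> by a chord would give a minimum
  linkage in which \<open>q\<close> has two in-neighbours.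
\<close>

lemma (in minimal_linkage) chordless:
  assumes tt': "(t, t') \<in> F" and path: "(t', q) \<in> F\<^sup>+" and q: "q \<noteq> t'"
  shows "(t, q) \<notin> E"
proof
  assume tq: "(t, q) \<in> E"
  let ?F = "insert (t, q) (F - {(t, t')})"
  have FE: "?F \<subseteq> E" using F tq by auto
  have "card ?F \<le> Suc (card (F - {(t, t')}))" using finite_F by (simp add: card_insert_if)
  also have "\<dots> = card F" by (rule card_Suc_Diff1[OF finite_F tt'])
  finally have card: "card ?F \<le> card F" .
  have "linked V X Y k ?F"
    unfolding linked_def
  proof (intro allI impI)
    fix T assume T: "T \<subseteq> V" "T \<inter> Y = {}"
    have fs: "finite (sep_set X ?F T)" using FE finite_sep by blast
    show "k \<le> card (sep_set X ?F T)"
    proof (cases "t \<in> T")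
      case False
      have "k \<le> card (sep_set X F T)" by (rule linkedD[OF T])
      also have "\<dots> \<le> card (sep_set X ?F T)"
        using False by (intro card_mono[OF fs]) (auto simp: sep_set_def out_nbhd_iff)
      finally show ?thesis .
    next
      case True
      \<comment> \<open>The segment of \<open>F\<close> from \<open>t'\<close> to the vertex before
        \<open>q\<close>. Absorbing it removes \<open>t'\<close> from the separating set and can
        only add \<open>q\<close>, the head of the chord.\<close>
      let ?R = "{r. (t', r) \<in> F\<^sup>* \<and> (r, q) \<in> F\<^sup>+}"
      have RF: "\<exists>s. (r, s) \<in> F" if "r \<in> ?R" for r using that by (auto dest: tranclD)
      have "?R \<subseteq> V" using RF F(1) arcs by blast
      moreover have "?R \<inter> Y = {}" using RF tail_notin_Y by blast
      ultimately have "k \<le> card (sep_set X F (T \<union> ?R))" using T by (intro linkedD) auto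
      also have "\<dots> \<le> card (sep_set X ?F T)"
      proof (rule card_mono[OF fs], rule subsetI)
        fix y assume y: "y \<in> sep_set X F (T \<union> ?R)"
        show "y \<in> sep_set X ?F T"
        proof (cases "y \<in> X - (T \<union> ?R)")
          case True
          then show ?thesis by (auto simp: sep_set_def)
        next
          case False
          then obtain x where x: "x \<in> T \<union> ?R" "(x, y) \<in> F" and y': "y \<notin> T" "y \<notin> ?R"
            using y by (auto simp: sep_set_def out_nbhd_iff)
          show ?thesis
          proof (cases "x \<in> T")
            case True
            have "t' \<in> ?R" using path by auto
            then have "y \<noteq> t'" using y' by blast
            then show ?thesis using True x y' by (auto simp: sep_set_def out_nbhd_iff)
          next
            case xT: False
            then have xR: "(t', x) \<in> F\<^sup>*" "(x, q) \<in> F\<^sup>+" using x by auto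
            obtain s where "(x, s) \<in> F" "(s, q) \<in> F\<^sup>*" using tranclD[OF xR(2)] by auto
            then have "(y, q) \<in> F\<^sup>*" using out_unique x(2) by blast
            moreover have "(t', y) \<in> F\<^sup>*" using xR x by auto
            ultimately have "y = q" using y'(2) by (auto simp: rtrancl_eq_or_trancl)
            then show ?thesis using True y' by (auto simp: sep_set_def out_nbhd_iff)
          qed
        qed
      qed
      finally show ?thesis .
    qed
  qed
  then interpret F': minimal_linkage V E X Y k ?F
    using FE card min_card fin arcs X by unfold_locales (auto intro: le_trans)
  obtain p where p: "(p, q) \<in> F" using path by (auto dest: tranclD2)
  have "p \<noteq> t" using p tt' out_unique q by blast
  moreover have "p = t" by (rule F'.in_unique[of p q t]) (use p \<open>p \<noteq> t\<close> in auto)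
  ultimately show False by simp
qed

text \<open>The linkage is applied to the vertices beyond \<open>T\<close> and its out-neighbours.
  An arc of \<open>F\<close> leaving them cannot end in \<open>T\<close>, since its reverse in
  \<open>G\<close> would make the tail an out-neighbour of \<open>T\<close>. So their separating set
  lies in \<open>out_nbhd G T\<close>.\<close>

lemma linked_reverse:
  assumes fin: "finite V" and V: "G \<subseteq> V \<times> V" "X \<subseteq> V"
    and F: "linked V X Y k F" "F\<inverse> \<subseteq> G"
    and T: "T \<subseteq> V" "T \<inter> X = {}" "Y \<subseteq> T \<union> out_nbhd G T"
  shows "k \<le> card (out_nbhd G T)"
proof -
  let ?T = "V - T - out_nbhd G T"
  have "?T \<subseteq> V" "?T \<inter> Y = {}" using T(3) by auto
  then have "k \<le> card (sep_set X F ?T)" using F(1) unfolding linked_def by simp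
  moreover have "sep_set X F ?T \<subseteq> out_nbhd G T"
  proof
    fix y assume y: "y \<in> sep_set X F ?T"
    show "y \<in> out_nbhd G T"
    proof (cases "y \<in> X")
      case True
      then show ?thesis using y T V by (auto simp: sep_set_def out_nbhd_iff)
    next
      case False
      then have "y \<in> out_nbhd F ?T" using y by (auto simp: sep_set_def)
      then obtain x where x: "x \<in> ?T" "(x, y) \<in> F" "y \<notin> ?T" unfolding out_nbhd_iff[of y F] by blast
      have G: "(y, x) \<in> G" using x F by auto
      then have "y \<notin> T" using x by (auto simp: out_nbhd_iff)
      then show ?thesis using x G V by auto
    qed
  qed
  then have "card (sep_set X F ?T) \<le> card (out_nbhd G T)"
    by (rule card_mono[OF finite_out_nbhd[OF fin V(1)]])
  ultimately show ?thesis by simp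
qed

section \<open>Existence of linkages, and the sink side\<close>

context dense_digraph
begin

lemma exists_linkage:
  assumes X: "X \<subseteq> V" "card X = k" and Y: "Y \<subseteq> V" "card Y = k"
  shows "\<exists>F. minimal_linkage V E X Y k F"
proof -
  have finE: "finite E" using arcs fin by (meson finite_SigmaI finite_subset)
  have "linked V X Y k E"
    unfolding linked_def
  proof (intro allI impI)
    fix T assume T: "T \<subseteq> V" "T \<inter> Y = {}"
    have fs: "finite (sep_set X E T)" using finite_out X finite_sub by (auto simp: sep_set_def)
    have sub: "out_nbhd E T \<subseteq> sep_set X E T" by (auto simp: sep_set_def)
    show "k \<le> card (sep_set X E T)"
    proof (cases "X \<inter> T = {} \<or> Y \<subseteq> out_nbhd E T")
      case True
      then have "X \<subseteq> sep_set X E T \<or> Y \<subseteq> sep_set X E T" by (auto simp: sep_set_def)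
      then show ?thesis using card_mono[OF fs, of X] card_mono[OF fs, of Y] X Y by auto
    next
      case False
      then have "k \<le> card (out_nbhd E T)" using T Y by (intro conn) auto
      also have "\<dots> \<le> card (sep_set X E T)" by (rule card_mono[OF fs sub])
      finally show ?thesis .
    qed
  qed
  then have ne: "{F. F \<subseteq> E \<and> linked V X Y k F} \<noteq> {}" by auto
  have f: "finite {F. F \<subseteq> E \<and> linked V X Y k F}" using finE by simp
  let ?F = "arg_min_on card {F. F \<subseteq> E \<and> linked V X Y k F}"
  have "?F \<in> {F. F \<subseteq> E \<and> linked V X Y k F}" by (rule arg_min_if_finite(1)[OF f ne])
  moreover have "card ?F \<le> card F'" if "F' \<subseteq> E" "linked V X Y k F'" for F'
    using arg_min_if_finite(2)[OF f ne, of card] that by (auto simp: not_less)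
  ultimately have "minimal_linkage V E X Y k ?F"
    using fin arcs X by unfold_locales auto
  then show ?thesis by blast
qed

text \<open>The core parameter \<open>?m\<close> is the size that \<open>hub_structure\<close>
  needs; sets meeting \<open>W\<close> are led to the hubs in \<open>B\<close>, and these determine
  \<open>X\<close>.\<close>

lemma sink_side:
  assumes n: "120 * k + 61 * d \<le> card V"
  shows "\<exists>W X K. W \<subseteq> V \<and> X \<subseteq> V \<and> card X = k \<and> K \<subseteq> E \<and> card K \<le> 420 * k * k + 215 * k * d \<and>
    (\<forall>T\<subseteq>V. T \<inter> W \<noteq> {} \<longrightarrow> card (out_nbhd K T) < k \<longrightarrow> X \<subseteq> T \<union> out_nbhd K T) \<and>
    (\<forall>v\<in>V - W. \<exists>L\<subseteq>E. card L \<le> 2 * k \<and> (\<forall>T. v \<in> T \<longrightarrow> T \<inter> W = {} \<longrightarrow> k \<le> card (out_nbhd L T)))"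
proof -
  let ?m = "24 * k + 12 * d"
  have "4 * ?m + 24 * k + 13 * d \<le> card V" using n by simp
  from core_structure[OF this] obtain W B C where
    W: "W \<subseteq> V" "card W = 4 * ?m + 24 * k + 13 * d" and B: "B \<subseteq> W" "card B = ?m"
    and C: "C \<subseteq> E" "card C \<le> 2 * k * (2 * ?m + 6 * k + 5 * d)"
    and core: "\<forall>T\<subseteq>V. T \<inter> W \<noteq> {} \<longrightarrow> card (out_nbhd (C \<union> E \<inter> W \<times> UNIV) T) < k \<longrightarrow>
       B \<subseteq> T \<union> out_nbhd (C \<union> E \<inter> W \<times> UNIV) T"
    and exits: "\<forall>v\<in>V - W. \<exists>K\<subseteq>E. card K \<le> 2 * k \<and> (\<forall>T. v \<in> T \<longrightarrow> T \<inter> W = {} \<longrightarrow> k \<le> card (out_nbhd K T))"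
    by (elim exE conjE)
  have BV: "B \<subseteq> V" using B W by blast
  from hub_structure[OF BV B(2)] obtain H X K where
    H: "H \<subseteq> B" "card H = k" and X: "X \<subseteq> B" "card X = k" and K: "K \<subseteq> E" "card K \<le> 8 * k * card B"
    and hub: "\<forall>T\<subseteq>V. T \<inter> H \<noteq> {} \<longrightarrow> card (out_nbhd K T) < k \<longrightarrow> X \<subseteq> T \<union> out_nbhd K T"
    by (elim exE conjE)
  \<comment> \<open>A set that meets \<open>W\<close>, misses \<open>H\<close> and has fewer than
    \<open>k\<close> out-neighbours would cover \<open>B\<close>, so all \<open>k\<close> hubs would
    be out-neighbours.\<close>
  have "\<exists>F\<subseteq>E \<inter> W \<times> UNIV. card F \<le> k * card W \<and>
    (\<forall>T\<subseteq>V. T \<inter> W \<noteq> {} \<longrightarrow> T \<inter> H = {} \<longrightarrow> k \<le> card (out_nbhd (C \<union> F) T))"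
  proof (rule rooted_sparsification[OF fin])
    fix T assume T: "T \<subseteq> V" "T \<inter> W \<noteq> {}" "T \<inter> H = {}"
    show "k \<le> card (out_nbhd (C \<union> E \<inter> W \<times> UNIV) T)"
    proof (rule ccontr)
      assume less: "\<not> ?thesis"
      then have "B \<subseteq> T \<union> out_nbhd (C \<union> E \<inter> W \<times> UNIV) T" using core T by simp
      then have "H \<subseteq> out_nbhd (C \<union> E \<inter> W \<times> UNIV) T" using H T by auto
      moreover have "finite (out_nbhd (C \<union> E \<inter> W \<times> UNIV) T)" using C by (intro finite_out) auto
      ultimately have "card H \<le> card (out_nbhd (C \<union> E \<inter> W \<times> UNIV) T)" by (intro card_mono)
      then show False using H(2) less by simp
    qed
  qed (use C arcs W in auto)
  then obtain F where F: "F \<subseteq> E \<inter> W \<times> UNIV" "card F \<le> k * card W"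
    and root: "\<forall>T\<subseteq>V. T \<inter> W \<noteq> {} \<longrightarrow> T \<inter> H = {} \<longrightarrow> k \<le> card (out_nbhd (C \<union> F) T)"
    by (elim exE conjE)
  let ?K = "C \<union> F \<union> K"
  have KE: "?K \<subseteq> E" using C F K by auto
  have KV: "?K \<subseteq> V \<times> V" using KE arcs by blast
  have "card ?K \<le> card C + card F + card K"
    by (meson add_le_mono1 card_Un_le order_trans)
  also have "\<dots> \<le> 2 * k * (2 * ?m + 6 * k + 5 * d) + k * (4 * ?m + 24 * k + 13 * d) + 8 * k * ?m"
    using C F K W B by (intro add_mono) auto
  also have "\<dots> = 420 * k * k + 215 * k * d" by (simp add: algebra_simps)
  finally have cardK: "card ?K \<le> 420 * k * k + 215 * k * d" .
  have "X \<subseteq> T \<union> out_nbhd ?K T" if T: "T \<subseteq> V" "T \<inter> W \<noteq> {}" "card (out_nbhd ?K T) < k" for T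
  proof -
    have "card (out_nbhd (C \<union> F) T) < k"
      using card_out_nbhd_mono[OF fin KV, of "C \<union> F" T] T by simp
    then have "T \<inter> H \<noteq> {}" using root T by (meson not_le)
    moreover have "card (out_nbhd K T) < k"
      using card_out_nbhd_mono[OF fin KV, of K T] T by simp
    ultimately have "X \<subseteq> T \<union> out_nbhd K T" using hub T by simp
    then show ?thesis using out_nbhd_mono[of K ?K T] by blast
  qed
  then have closure: "\<forall>T\<subseteq>V. T \<inter> W \<noteq> {} \<longrightarrow> card (out_nbhd ?K T) < k \<longrightarrow> X \<subseteq> T \<union> out_nbhd ?K T" by simp
  have XV: "X \<subseteq> V" using X BV by blast
  show ?thesis
    by (intro exI conjI) (fact W XV X KE cardK closure exits)+
qed

end

section \<open>Capacitated matchings and median orders\<close>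

text \<open>
  The cut condition for a subset of \<open>G\<close> with in- and out-degrees bounded by \<open>b\<close> and at least
  \<open>sum b V - \<delta>\<close> arcs.
\<close>

definition matching_cond :: "'a set \<Rightarrow> ('a \<Rightarrow> nat) \<Rightarrow> nat \<Rightarrow> 'a rel \<Rightarrow> bool" where
  "matching_cond V b \<delta> G \<longleftrightarrow>
     (\<forall>P\<subseteq>V. \<forall>Q\<subseteq>V. sum b P + sum b Q \<le> sum b V + card (G \<inter> P \<times> Q) + \<delta>)"

lemma matching_condD:
  "matching_cond V b \<delta> G \<Longrightarrow> P \<subseteq> V \<Longrightarrow> Q \<subseteq> V \<Longrightarrow> sum b P + sum b Q \<le> sum b V + card (G \<inter> P \<times> Q) + \<delta>"
  by (simp add: matching_cond_def)

lemma card_converse_Int: "card (G\<inverse> \<inter> P \<times> Q) = card (G \<inter> Q \<times> P)"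
proof -
  have "G\<inverse> \<inter> P \<times> Q = (G \<inter> Q \<times> P)\<inverse>" by auto
  then show ?thesis by (simp add: card_inverse)
qed

lemma matching_cond_converse: "matching_cond V b \<delta> (G\<inverse>) \<longleftrightarrow> matching_cond V b \<delta> G"
  unfolding matching_cond_def card_converse_Int by (metis add.commute)

text \<open>Tight pairs uncross to \<open>P \<inter> P'\<close> and \<open>Q \<union> Q'\<close>, so
  one tight pair has \<open>u\<close> in \<open>P\<close> and all heads in \<open>Q\<close>.
  Removing \<open>u\<close> from \<open>P\<close> lowers the left side by \<open>b u\<close> and the
  right side by the out-degree of \<open>u\<close>.\<close>

lemma minimal_matching_out_degree:
  assumes fin: "finite V" "finite G"
    and G: "matching_cond V b \<delta> G" and min: "\<And>G'. G' \<subset> G \<Longrightarrow> \<not> matching_cond V b \<delta> G'"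
  shows "card (G `` {u}) \<le> b u"
proof -
  let ?tight = "\<lambda>P Q. P \<subseteq> V \<and> Q \<subseteq> V \<and> sum b P + sum b Q = sum b V + card (G \<inter> P \<times> Q) + \<delta>"
  have tight1: "\<exists>P Q. ?tight P Q \<and> u \<in> P \<and> v \<in> Q" if uv: "(u, v) \<in> G" for v
  proof -
    have "\<not> matching_cond V b \<delta> (G - {(u, v)})" by (rule min) (use uv in auto)
    then obtain P Q where PQ: "P \<subseteq> V" "Q \<subseteq> V"
      and less: "sum b V + card ((G - {(u, v)}) \<inter> P \<times> Q) + \<delta> < sum b P + sum b Q"
      by (auto simp: matching_cond_def not_le)
    have le: "sum b P + sum b Q \<le> sum b V + card (G \<inter> P \<times> Q) + \<delta>" by (rule matching_condD[OF G PQ])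
    have in_PQ: "(u, v) \<in> P \<times> Q"
    proof (rule ccontr)
      assume "(u, v) \<notin> P \<times> Q"
      then have "(G - {(u, v)}) \<inter> P \<times> Q = G \<inter> P \<times> Q" by auto
      then show False using le less by simp
    qed
    have "(G - {(u, v)}) \<inter> P \<times> Q = G \<inter> P \<times> Q - {(u, v)}" by auto
    then have "Suc (card ((G - {(u, v)}) \<inter> P \<times> Q)) = card (G \<inter> P \<times> Q)"
      using card_Suc_Diff1[of "G \<inter> P \<times> Q" "(u, v)"] fin uv in_PQ by auto
    then have "?tight P Q" using PQ le less by auto
    then show ?thesis using in_PQ by blast
  qed
  have all: "A \<noteq> {} \<Longrightarrow> \<exists>P Q. ?tight P Q \<and> u \<in> P \<and> A \<subseteq> Q" if "finite A" "A \<subseteq> G `` {u}" for A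
    using that
  proof (induction A rule: finite_induct)
    case (insert v A)
    obtain P Q where PQ: "?tight P Q" "u \<in> P" "v \<in> Q" using tight1[of v] insert.prems by auto
    show ?case
    proof (cases "A = {}")
      case True
      then show ?thesis using PQ by blast
    next
      case False
      then obtain P' Q' where PQ': "?tight P' Q'" "u \<in> P'" "A \<subseteq> Q'" using insert by auto
      have f: "finite P" "finite P'" "finite Q" "finite Q'"
        using PQ(1) PQ'(1) fin(1) finite_subset by blast+
      have s: "sum b (P \<inter> P') + sum b (P \<union> P') = sum b P + sum b P'"
        "sum b (Q \<union> Q') + sum b (Q \<inter> Q') = sum b Q + sum b Q'"
        using sum.union_inter[OF f(1,2), of b] sum.union_inter[OF f(3,4), of b] by simp_all
      have c: "card (G \<inter> (P \<inter> P') \<times> (Q \<union> Q')) + card (G \<inter> (P \<union> P') \<times> (Q \<inter> Q'))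
          \<le> card (G \<inter> P \<times> Q) + card (G \<inter> P' \<times> Q')"
        by (rule card_add_le_cross) (use fin in auto)
      have "sum b (P \<inter> P') + sum b (Q \<union> Q') \<le> sum b V + card (G \<inter> (P \<inter> P') \<times> (Q \<union> Q')) + \<delta>"
        by (rule matching_condD[OF G]) (use PQ PQ' in auto)
      moreover have "sum b (P \<union> P') + sum b (Q \<inter> Q') \<le> sum b V + card (G \<inter> (P \<union> P') \<times> (Q \<inter> Q')) + \<delta>"
        by (rule matching_condD[OF G]) (use PQ PQ' in auto)
      ultimately have "?tight (P \<inter> P') (Q \<union> Q')"
        using s c PQ(1) PQ'(1) by auto
      then show ?thesis using PQ PQ' by blast
    qed
  qed simp
  show ?thesis
  proof (cases "G `` {u} = {}")
    case False
    have finN: "finite (G `` {u})" using fin by simp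
    obtain P Q where PQ: "?tight P Q" "u \<in> P" "G `` {u} \<subseteq> Q" using all[OF finN] False by auto
    have finP: "finite P" using PQ(1) fin(1) finite_subset by blast
    have "G \<inter> P \<times> Q = (G \<inter> (P - {u}) \<times> Q) \<union> {u} \<times> G `` {u}" using PQ by auto
    then have "card (G \<inter> P \<times> Q) = card (G \<inter> (P - {u}) \<times> Q) + card ({u} \<times> G `` {u})"
      using fin finN by (simp add: card_Un_disjoint disjoint_iff)
    then have c: "card (G \<inter> P \<times> Q) = card (G \<inter> (P - {u}) \<times> Q) + card (G `` {u})"
      by (simp add: card_cartesian_product)
    have "sum b (P - {u}) + sum b Q \<le> sum b V + card (G \<inter> (P - {u}) \<times> Q) + \<delta>"
      by (rule matching_condD[OF G]) (use PQ in auto)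
    moreover have "sum b P = b u + sum b (P - {u})" by (rule sum.remove[OF finP PQ(2)])
    ultimately show ?thesis using PQ(1) c by simp
  qed simp
qed

text \<open>A minimal \<open>G\<close> satisfying the condition works: in-degrees follow by passing
  to the converse, and the size from \<open>P = Q = V\<close>.\<close>

lemma capacitated_matching:
  assumes fin: "finite V" and A: "A \<subseteq> V \<times> V" and cond: "matching_cond V b \<delta> A"
  shows "\<exists>G\<subseteq>A. (\<forall>u. card (G `` {u}) \<le> b u) \<and> (\<forall>v. card (G\<inverse> `` {v}) \<le> b v) \<and> sum b V \<le> card G + \<delta>"
proof -
  have finA: "finite A" using A fin by (meson finite_SigmaI finite_subset)
  obtain G where G: "G \<subseteq> A" "matching_cond V b \<delta> G" and min: "\<And>G'. G' \<subset> G \<Longrightarrow> \<not> matching_cond V b \<delta> G'"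
    by (rule exists_minimal_subset[of A "matching_cond V b \<delta>"]) (use finA cond in auto)
  have finG: "finite G" using G finA finite_subset by blast
  have "card (G `` {u}) \<le> b u" for u by (rule minimal_matching_out_degree[OF fin finG G(2) min])
  moreover have "card (G\<inverse> `` {v}) \<le> b v" for v
  proof (rule minimal_matching_out_degree[OF fin])
    show "matching_cond V b \<delta> (G\<inverse>)" using G by (simp add: matching_cond_converse)
    show "\<not> matching_cond V b \<delta> G'" if "G' \<subset> G\<inverse>" for G'
    proof -
      have "G'\<inverse> \<subset> G" using that by auto
      then show ?thesis using min matching_cond_converse by metis
    qed
  qed (use finG in auto)
  moreover have "sum b V \<le> card G + \<delta>"
  proof -
    have "G \<inter> V \<times> V = G" using G A by auto
    then show ?thesis using matching_condD[OF G(2), of V V] by simp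
  qed
  ultimately show ?thesis using G by blast
qed

section \<open>Median orders\<close>

fun order_score :: "('a \<Rightarrow> 'a \<Rightarrow> nat) \<Rightarrow> 'a list \<Rightarrow> nat" where
  "order_score w [] = 0"
| "order_score w (x # xs) = (\<Sum>y\<leftarrow>xs. w x y) + order_score w xs"

lemma order_score_append:
  "order_score w (xs @ ys) = order_score w xs + order_score w ys + (\<Sum>x\<leftarrow>xs. \<Sum>y\<leftarrow>ys. w x y)"
  by (induction xs) simp_all

lemma order_score_move:
  "order_score w (xs @ z # ys @ zs) + (\<Sum>y\<leftarrow>ys. w y z) = order_score w (xs @ ys @ z # zs) + (\<Sum>y\<leftarrow>ys. w z y)"
  by (simp add: order_score_append sum_list_addf)

text \<open>In a list of maximal score, moving \<open>z\<close> to the end of an interval right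
  after it, or to the start of one right before it, cannot raise the score. \<open>p\<close> gives
  the positions in such a list.\<close>

lemma median_order:
  fixes w :: "'a \<Rightarrow> 'a \<Rightarrow> nat"
  assumes fin: "finite V"
  shows "\<exists>p :: 'a \<Rightarrow> nat. inj_on p V \<and>
    (\<forall>z\<in>V. \<forall>m. (\<Sum>y\<in>{y\<in>V. p z < p y \<and> p y \<le> m}. w y z) \<le> (\<Sum>y\<in>{y\<in>V. p z < p y \<and> p y \<le> m}. w z y)) \<and>
    (\<forall>z\<in>V. \<forall>m. (\<Sum>y\<in>{y\<in>V. m \<le> p y \<and> p y < p z}. w z y) \<le> (\<Sum>y\<in>{y\<in>V. m \<le> p y \<and> p y < p z}. w y z))"
proof -
  let ?L = "{xs. set xs = V \<and> distinct xs}"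
  have "?L \<subseteq> {xs. set xs \<subseteq> V \<and> length xs \<le> card V}" by (auto simp: distinct_card)
  then have finL: "finite ?L" using finite_lists_length_le[OF fin] finite_subset by blast
  have "?L \<noteq> {}" using finite_distinct_list[OF fin] by auto
  then have "Max (order_score w ` ?L) \<in> order_score w ` ?L" using finL by (intro Max_in) auto
  then obtain xs where xs: "set xs = V" "distinct xs" "order_score w xs = Max (order_score w ` ?L)" by auto
  have max: "order_score w ys \<le> order_score w xs" if "set ys = V" "distinct ys" for ys
    using that finL xs(3) by simp
  define p where "p = the_inv_into {..<length xs} ((!) xs)"
  have bij: "bij_betw ((!) xs) {..<length xs} V" using xs by (intro bij_betw_nth) auto
  have p_nth: "p (xs ! i) = i" if "i < length xs" for i
    unfolding p_def using that bij by (intro the_inv_into_f_f) (auto simp: bij_betw_def)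
  have nth_p: "p y < length xs \<and> xs ! p y = y" if "y \<in> V" for y
    using that xs p_nth by (metis in_set_conv_nth)
  have inj: "inj_on p V" using nth_p by (metis inj_onI)
  have "(\<Sum>y\<in>{y\<in>V. p z < p y \<and> p y \<le> m}. w y z) \<le> (\<Sum>y\<in>{y\<in>V. p z < p y \<and> p y \<le> m}. w z y)"
    if z: "z \<in> V" for z m
  proof -
    let ?A = "take (p z) xs" and ?B = "take (m - p z) (drop (Suc (p z)) xs)"
      and ?C = "drop (m - p z) (drop (Suc (p z)) xs)"
    have split: "xs = ?A @ z # ?B @ ?C"
      using nth_p[OF z] id_take_nth_drop[of "p z" xs] append_take_drop_id[of "m - p z" "drop (Suc (p z)) xs"] by simp
    have "set ?B = {y\<in>V. p z < p y \<and> p y \<le> m}"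
    proof (intro set_eqI iffI)
      fix y assume "y \<in> set ?B"
      then obtain i where "i < m - p z" "i < length xs - Suc (p z)" "y = xs ! (Suc (p z) + i)"
        by (auto simp: in_set_conv_nth)
      then show "y \<in> {y\<in>V. p z < p y \<and> p y \<le> m}" using p_nth[of "Suc (p z) + i"] xs(1) by auto
    next
      fix y assume y: "y \<in> {y\<in>V. p z < p y \<and> p y \<le> m}"
      then have "p y < length xs" "xs ! p y = y" using nth_p by auto
      then show "y \<in> set ?B" using y
        by (auto simp: in_set_conv_nth intro!: exI[of _ "p y - Suc (p z)"])
    qed
    moreover have "distinct ?B" using xs by simp
    ultimately have sums: "(\<Sum>y\<in>{y\<in>V. p z < p y \<and> p y \<le> m}. f y) = (\<Sum>y\<leftarrow>?B. f y)" for f :: "'a \<Rightarrow> nat"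
      using sum_list_distinct_conv_sum_set[of ?B f] by simp
    have mv: "set (?A @ ?B @ z # ?C) = set (?A @ z # ?B @ ?C)" "distinct (?A @ ?B @ z # ?C) = distinct (?A @ z # ?B @ ?C)"
      by auto
    have "order_score w (?A @ ?B @ z # ?C) \<le> order_score w (?A @ z # ?B @ ?C)"
      using max[of "?A @ ?B @ z # ?C"] mv unfolding split[symmetric] xs(1) using xs(2) by simp
    then show ?thesis unfolding sums using order_score_move[of w ?A z ?B ?C] by simp
  qed
  moreover have "(\<Sum>y\<in>{y\<in>V. m \<le> p y \<and> p y < p z}. w z y) \<le> (\<Sum>y\<in>{y\<in>V. m \<le> p y \<and> p y < p z}. w y z)"
    if z: "z \<in> V" for z m
  proof -
    let ?A = "take m (take (p z) xs)" and ?B = "drop m (take (p z) xs)" and ?C = "drop (Suc (p z)) xs"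
    have split: "xs = ?A @ ?B @ z # ?C"
      using nth_p[OF z] id_take_nth_drop[of "p z" xs]
      by (metis append.assoc append_take_drop_id)
    have "set ?B = {y\<in>V. m \<le> p y \<and> p y < p z}"
    proof (intro set_eqI iffI)
      fix y assume "y \<in> set ?B"
      then have "\<exists>i. i + m < p z \<and> i + m < length xs \<and> y = xs ! (i + m)"
        by (auto simp: in_set_conv_nth less_diff_conv add.commute)
      then show "y \<in> {y\<in>V. m \<le> p y \<and> p y < p z}" using p_nth xs(1) by auto
    next
      fix y assume y: "y \<in> {y\<in>V. m \<le> p y \<and> p y < p z}"
      then have "p y < length xs" "xs ! p y = y" using nth_p by auto
      then show "y \<in> set ?B" using y
        by (auto simp: in_set_conv_nth intro!: exI[of _ "p y - m"])
    qed
    moreover have "distinct ?B" using xs by simp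
    ultimately have sums: "(\<Sum>y\<in>{y\<in>V. m \<le> p y \<and> p y < p z}. f y) = (\<Sum>y\<leftarrow>?B. f y)" for f :: "'a \<Rightarrow> nat"
      using sum_list_distinct_conv_sum_set[of ?B f] by simp
    have mv: "set (?A @ z # ?B @ ?C) = set (?A @ ?B @ z # ?C)" "distinct (?A @ z # ?B @ ?C) = distinct (?A @ ?B @ z # ?C)"
      by auto
    have "order_score w (?A @ z # ?B @ ?C) \<le> order_score w (?A @ ?B @ z # ?C)"
      using max[of "?A @ z # ?B @ ?C"] mv unfolding split[symmetric] xs(1) using xs(2) by simp
    then show ?thesis unfolding sums using order_score_move[of w ?A z ?B ?C] by simp
  qed
  ultimately show ?thesis using inj by blast
qed

text \<open>In-neighbours of \<open>z\<close> in \<open>J\<close> weigh no more than out-neighbours,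
  which lie in \<open>J - Q\<close> or among the at most \<open>k\<close> in \<open>Q\<close>. The
  latter count twice, once more as members of \<open>Q\<close>; non-neighbours contribute
  \<open>k * d\<close>. \<open>R\<close> is \<open>E\<close> or its converse.\<close>

lemma interval_bound:
  fixes b :: "'a \<Rightarrow> nat"
  assumes fin: "finite J" and b: "\<And>y. b y \<le> k"
    and non_adj: "card {y\<in>J. (z, y) \<notin> R \<and> (y, z) \<notin> R} \<le> d"
    and le: "sum b {y\<in>J. (y, z) \<in> R} \<le> sum b {y\<in>J. (z, y) \<in> R}"
    and out: "card {y\<in>Q \<inter> J. (z, y) \<in> R} \<le> k"
  shows "sum b (Q \<inter> J) \<le> sum b (J - Q) + 2 * k * k + k * d"
proof -
  have sum_le: "sum b M \<le> k * card M" for M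
    using sum_bounded_above[of M b k] b by (simp add: mult.commute)
  let ?In = "{y\<in>J. (y, z) \<in> R}" and ?Out = "{y\<in>J. (z, y) \<in> R}"
    and ?QO = "{y\<in>Q \<inter> J. (z, y) \<in> R}" and ?N = "{y\<in>J. (z, y) \<notin> R \<and> (y, z) \<notin> R}"
  have sub: "sum b A \<le> sum b B + sum b C" if "A \<subseteq> B \<union> C" "finite B" "finite C" for A B C
  proof -
    have "sum b A \<le> sum b (B \<union> C)" using that by (intro sum_mono2) auto
    also have "\<dots> \<le> sum b B + sum b C" using that by (simp add: sum_Un_nat)
    finally show ?thesis .
  qed
  have "sum b (Q \<inter> J) \<le> sum b ?In + sum b (?QO \<union> ?N)" using fin by (intro sub) auto
  also have "sum b (?QO \<union> ?N) \<le> sum b ?QO + sum b ?N" using fin by (intro sub) auto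
  also have "sum b ?In \<le> sum b ?Out" by (rule le)
  also have "sum b ?Out \<le> sum b (J - Q) + sum b ?QO" using fin by (intro sub) auto
  finally have "sum b (Q \<inter> J) \<le> sum b (J - Q) + sum b ?QO + (sum b ?QO + sum b ?N)" by simp
  moreover have "sum b ?QO \<le> k * k" using sum_le[of ?QO] out mult_le_mono2[OF out, of k] by linarith
  moreover have "sum b ?N \<le> k * d" using sum_le[of ?N] mult_le_mono2[OF non_adj, of k] by linarith
  ultimately show ?thesis by simp
qed

section \<open>Forward arcs\<close>

text \<open>All vertices of \<open>U\<close> but the first come after it, so \<open>sum b U\<close>
  is at most \<open>k + c\<close>, while each weighs at least \<open>k / 2\<close>. With integer
  values a sign reverses the order.\<close>

lemma card_window:
  fixes f :: "'a \<Rightarrow> int" and b :: "'a \<Rightarrow> nat"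
  assumes fin: "finite V" and U: "U \<subseteq> V" and inj: "inj_on f V"
    and c: "\<And>v. v \<in> U \<Longrightarrow> sum b {y\<in>V. f v < f y} \<le> c"
    and b: "\<And>v. b v \<le> k" "\<And>v. v \<in> U \<Longrightarrow> k \<le> 2 * b v"
  shows "k * card U \<le> 2 * k + 2 * c"
proof (cases "U = {}")
  case False
  have finU: "finite U" using U fin finite_subset by blast
  let ?v = "arg_min_on f U"
  have v: "?v \<in> U" "\<And>x. x \<in> U \<Longrightarrow> f ?v \<le> f x"
    using arg_min_if_finite[OF finU False, of f] by (auto simp: not_less)
  have "U \<subseteq> insert ?v {y\<in>V. f ?v < f y}"
  proof
    fix x assume x: "x \<in> U"
    show "x \<in> insert ?v {y\<in>V. f ?v < f y}"
      using v(2)[OF x] inj_onD[OF inj, of ?v x] U v(1) x by (cases "f ?v = f x") auto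
  qed
  then have "sum b U \<le> sum b (insert ?v {y\<in>V. f ?v < f y})" using fin by (intro sum_mono2) auto
  also have "\<dots> = b ?v + sum b {y\<in>V. f ?v < f y}" using fin by (subst sum.insert) auto
  also have "\<dots> \<le> k + c" using b(1) c[OF v(1)] by (rule add_mono)
  finally have "sum b U \<le> k + c" .
  moreover have "k * card U = (\<Sum>v\<in>U. k)" by simp
  moreover have "(\<Sum>v\<in>U. k) \<le> (\<Sum>v\<in>U. 2 * b v)" using b(2) by (rule sum_mono)
  moreover have "(\<Sum>v\<in>U. 2 * b v) = 2 * sum b U" by (simp add: sum_distrib_left)
  ultimately show ?thesis by linarith
qed simp

lemma fill_out_degrees:
  fixes c :: "'a \<Rightarrow> nat"
  assumes fin: "finite V" and A: "A \<subseteq> V \<times> V" and G: "G \<subseteq> A" "\<And>u. u \<in> V \<Longrightarrow> card (G `` {u}) \<le> c u"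
  shows "\<exists>H. G \<subseteq> H \<and> H \<subseteq> A \<and> (\<forall>u\<in>V. min (c u) (card (A `` {u})) \<le> card (H `` {u})) \<and> card H \<le> sum c V"
proof -
  have finA: "finite (A `` {u})" for u using A fin by (meson finite_Image finite_SigmaI finite_subset)
  have "\<forall>u\<in>V. \<exists>N. G `` {u} \<subseteq> N \<and> N \<subseteq> A `` {u} \<and> card N \<le> c u \<and> min (c u) (card (A `` {u})) \<le> card N"
  proof
    fix u assume u: "u \<in> V"
    show "\<exists>N. G `` {u} \<subseteq> N \<and> N \<subseteq> A `` {u} \<and> card N \<le> c u \<and> min (c u) (card (A `` {u})) \<le> card N"
    proof (cases "c u \<le> card (A `` {u})")
      case True
      have sub: "G `` {u} \<subseteq> A `` {u}" using G by auto
      have finG: "finite (G `` {u})" using sub finA finite_subset by blast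
      have "c u - card (G `` {u}) \<le> card (A `` {u} - G `` {u})"
        using True card_Diff_subset[OF finG sub] by simp
      then obtain M where M: "M \<subseteq> A `` {u} - G `` {u}" "card M = c u - card (G `` {u})"
        by (meson obtain_subset_with_card_n)
      have "finite M" using M finA finite_subset by blast
      moreover have "G `` {u} \<inter> M = {}" using M by blast
      ultimately have "card (G `` {u} \<union> M) = c u" using M(2) G(2)[OF u] finG by (simp add: card_Un_disjoint)
      moreover have "G `` {u} \<union> M \<subseteq> A `` {u}" using M(1) sub by blast
      ultimately show ?thesis by (intro exI[of _ "G `` {u} \<union> M"]) simp
    next
      case False
      then show ?thesis using G(1) by (intro exI[of _ "A `` {u}"]) auto
    qed
  qed
  from bchoice[OF this] obtain N where N: "\<And>u. u \<in> V \<Longrightarrow> G `` {u} \<subseteq> N u"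
    "\<And>u. u \<in> V \<Longrightarrow> N u \<subseteq> A `` {u}" "\<And>u. u \<in> V \<Longrightarrow> card (N u) \<le> c u"
    "\<And>u. u \<in> V \<Longrightarrow> min (c u) (card (A `` {u})) \<le> card (N u)" by auto
  let ?H = "SIGMA u:V. N u"
  have "?H `` {u} = N u" if "u \<in> V" for u using that by auto
  then have "\<forall>u\<in>V. min (c u) (card (A `` {u})) \<le> card (?H `` {u})" using N(4) by simp
  moreover have "G \<subseteq> ?H" using G A N(1) by fastforce
  moreover have "?H \<subseteq> A" using N(2) by auto
  moreover have "card ?H \<le> sum c V"
  proof -
    have "card ?H = (\<Sum>u\<in>V. card (N u))" using fin N(2) finA by (intro card_SigmaI) (auto intro: finite_subset)
    also have "\<dots> \<le> sum c V" using N(3) by (rule sum_mono)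
    finally show ?thesis .
  qed
  ultimately show ?thesis by blast
qed

context dense_digraph
begin

text \<open>The median inequalities are stated for \<open>0 < b z\<close> because they result from
  weights \<open>b u * b v\<close> by cancelling \<open>b z\<close>.\<close>

context
  fixes X Y :: "'a set" and F :: "'a rel" and b :: "'a \<Rightarrow> nat" and p :: "'a \<Rightarrow> nat" and A :: "'a rel"
  assumes F: "minimal_linkage V E X Y k F"
  defines "b \<equiv> (\<lambda>v. if v \<in> Domain F then k - 1 else k)"
  assumes inj: "inj_on p V"
    and median_out: "\<And>z m. z \<in> V \<Longrightarrow> 0 < b z \<Longrightarrow>
      sum b {y\<in>{y\<in>V. p z < p y \<and> p y \<le> m}. (y, z) \<in> E} \<le> sum b {y\<in>{y\<in>V. p z < p y \<and> p y \<le> m}. (z, y) \<in> E}"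
    and median_in: "\<And>z m. z \<in> V \<Longrightarrow> 0 < b z \<Longrightarrow>
      sum b {y\<in>{y\<in>V. m \<le> p y \<and> p y < p z}. (z, y) \<in> E} \<le> sum b {y\<in>{y\<in>V. m \<le> p y \<and> p y < p z}. (y, z) \<in> E}"
  defines "A \<equiv> {(u, v) \<in> E. p u < p v} - F"
begin

interpretation F: minimal_linkage V E X Y k F by (rule F)

lemma b_le: "b v \<le> k"
  by (simp add: b_def)

lemma A_arcs: "A \<subseteq> E" "A \<subseteq> V \<times> V"
  using arcs by (auto simp: A_def)

lemma finite_A: "finite A"
  using A_arcs fin by (meson finite_SigmaI finite_subset)

lemma F_out: "card (F `` {z}) \<le> 1"
proof (cases "F `` {z} = {}")
  case False
  then obtain y where "F `` {z} = {y}" using F.out_unique by blast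
  then show ?thesis by simp
qed simp

lemma F_in: "card (F\<inverse> `` {z}) \<le> 1"
proof (cases "F\<inverse> `` {z} = {}")
  case False
  then obtain y where "F\<inverse> `` {z} = {y}" using F.in_unique by blast
  then show ?thesis by simp
qed simp

lemma non_adj_sub:
  assumes "z \<in> V" "J \<subseteq> V" "z \<notin> J"
  shows "card {y\<in>J. (z, y) \<notin> E \<and> (y, z) \<notin> E} \<le> d"
proof -
  have "card {y\<in>J. (z, y) \<notin> E \<and> (y, z) \<notin> E} \<le> card {w\<in>V. w \<noteq> z \<and> (z, w) \<notin> E \<and> (w, z) \<notin> E}"
    using assms fin by (intro card_mono) auto
  then show ?thesis using non_adj[OF assms(1)] by simp
qed

lemma out_interval_bound:
  assumes z: "z \<in> V" "0 < b z" and out: "card (A `` {z} \<inter> Q) + card (F `` {z}) \<le> k"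
  shows "sum b (Q \<inter> {y\<in>V. p z < p y \<and> p y \<le> m}) \<le> sum b ({y\<in>V. p z < p y \<and> p y \<le> m} - Q) + 2 * k * k + k * d"
proof (rule interval_bound[where R = E and z = z])
  let ?J = "{y\<in>V. p z < p y \<and> p y \<le> m}"
  have "card {y\<in>Q \<inter> ?J. (z, y) \<in> E} \<le> card (A `` {z} \<inter> Q \<union> F `` {z})"
    using finite_A F.finite_F by (intro card_mono) (auto simp: A_def)
  also have "\<dots> \<le> card (A `` {z} \<inter> Q) + card (F `` {z})" by (rule card_Un_le)
  finally show "card {y\<in>Q \<inter> ?J. (z, y) \<in> E} \<le> k" using out by simp
  show "card {y\<in>?J. (z, y) \<notin> E \<and> (y, z) \<notin> E} \<le> d" by (rule non_adj_sub) (use z in auto)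
qed (use fin b_le median_out z in auto)

lemma in_interval_bound:
  assumes z: "z \<in> V" "0 < b z" and out: "card (A\<inverse> `` {z} \<inter> Q) + card (F\<inverse> `` {z}) \<le> k"
  shows "sum b (Q \<inter> {y\<in>V. m \<le> p y \<and> p y < p z}) \<le> sum b ({y\<in>V. m \<le> p y \<and> p y < p z} - Q) + 2 * k * k + k * d"
proof (rule interval_bound[where R = "E\<inverse>" and z = z])
  let ?J = "{y\<in>V. m \<le> p y \<and> p y < p z}"
  have "card {y\<in>Q \<inter> ?J. (z, y) \<in> E\<inverse>} \<le> card (A\<inverse> `` {z} \<inter> Q \<union> F\<inverse> `` {z})"
    using finite_A F.finite_F by (intro card_mono) (auto simp: A_def)
  also have "\<dots> \<le> card (A\<inverse> `` {z} \<inter> Q) + card (F\<inverse> `` {z})" by (rule card_Un_le)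
  finally show "card {y\<in>Q \<inter> ?J. (z, y) \<in> E\<inverse>} \<le> k" using out by simp
  have "card {y\<in>?J. (z, y) \<notin> E \<and> (y, z) \<notin> E} \<le> d" by (rule non_adj_sub) (use z in auto)
  then show "card {y\<in>?J. (z, y) \<notin> E\<inverse> \<and> (y, z) \<notin> E\<inverse>} \<le> d" by (simp add: conj_commute)
qed (use fin b_le median_in z in auto)

text \<open>
  If the first vertex of \<open>P \<inter> Q\<close> has many arcs into \<open>Q\<close>, or the last one many arcs from \<open>P\<close>, it can be
  removed; otherwise the median property applied to the interval between them bounds \<open>P \<inter> Q\<close>.
\<close>

lemma forward_matching_cond: "matching_cond V b (2 * k * k + k * d + k) A"
proof -
  let ?c = "2 * k * k + k * d + k"
  have "sum b P + sum b Q \<le> sum b V + card (A \<inter> P \<times> Q) + ?c" if "P \<subseteq> V" "Q \<subseteq> V" for P Q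
    using that
  proof (induction "card P + card Q" arbitrary: P Q rule: less_induct)
    case less
    have f: "finite P" "finite Q" using less.prems fin finite_subset by blast+
    let ?Z = "{z\<in>P \<inter> Q. 0 < b z}"
    have finZ: "finite ?Z" using f by simp
    show ?case
    proof (cases "?Z = {}")
      case True
      have "sum b P + sum b Q = sum b (P \<union> Q) + sum b (P \<inter> Q)" using sum.union_inter[OF f] by metis
      also have "sum b (P \<inter> Q) = 0" using True by (intro sum.neutral) auto
      also have "sum b (P \<union> Q) \<le> sum b V" using less.prems fin by (intro sum_mono2) auto
      finally show ?thesis by simp
    next
      case False
      have "Min (p ` ?Z) \<in> p ` ?Z" using finZ False by (intro Min_in) auto
      then obtain z where z1: "z \<in> ?Z" "p z = Min (p ` ?Z)" by auto
      then have z: "z \<in> ?Z" "\<And>x. x \<in> ?Z \<Longrightarrow> p z \<le> p x" using finZ by simp_all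
      have "Max (p ` ?Z) \<in> p ` ?Z" using finZ False by (intro Max_in) auto
      then obtain z' where z': "z' \<in> ?Z" "p z' = Max (p ` ?Z)" by auto
      have z'_max: "p x \<le> p z'" if "x \<in> ?Z" for x using that finZ z'(2) by simp
      consider "b z \<le> card (A `` {z} \<inter> Q)" | "b z' \<le> card (A\<inverse> `` {z'} \<inter> P)"
        | "card (A `` {z} \<inter> Q) < b z" "card (A\<inverse> `` {z'} \<inter> P) < b z'" by linarith
      then show ?thesis
      proof cases
        case 1
        have "A \<inter> P \<times> Q = (A \<inter> (P - {z}) \<times> Q) \<union> {z} \<times> (A `` {z} \<inter> Q)" using z(1) by auto
        then have "card (A \<inter> P \<times> Q) = card (A \<inter> (P - {z}) \<times> Q) + card ({z} \<times> (A `` {z} \<inter> Q))"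
          using finite_A f by (simp add: card_Un_disjoint disjoint_iff)
        then have c: "card (A \<inter> P \<times> Q) = card (A \<inter> (P - {z}) \<times> Q) + card (A `` {z} \<inter> Q)"
          by (simp add: card_cartesian_product)
        have "card (P - {z}) < card P" by (rule card_Diff1_less[OF f(1)]) (use z in auto)
        then have "sum b (P - {z}) + sum b Q \<le> sum b V + card (A \<inter> (P - {z}) \<times> Q) + ?c"
          using less.prems by (intro less.hyps) auto
        moreover have "sum b P = b z + sum b (P - {z})" by (rule sum.remove[OF f(1)]) (use z in auto)
        ultimately show ?thesis using 1 c by linarith
      next
        case 2
        have "A \<inter> P \<times> Q = (A \<inter> P \<times> (Q - {z'})) \<union> (A\<inverse> `` {z'} \<inter> P) \<times> {z'}" using z'(1) by auto
        then have "card (A \<inter> P \<times> Q) = card (A \<inter> P \<times> (Q - {z'})) + card ((A\<inverse> `` {z'} \<inter> P) \<times> {z'})"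
          using finite_A f by (simp add: card_Un_disjoint disjoint_iff)
        then have c: "card (A \<inter> P \<times> Q) = card (A \<inter> P \<times> (Q - {z'})) + card (A\<inverse> `` {z'} \<inter> P)"
          by (simp add: card_cartesian_product)
        have "card (Q - {z'}) < card Q" by (rule card_Diff1_less[OF f(2)]) (use z' in auto)
        then have "sum b P + sum b (Q - {z'}) \<le> sum b V + card (A \<inter> P \<times> (Q - {z'})) + ?c"
          using less.prems by (intro less.hyps) auto
        moreover have "sum b Q = b z' + sum b (Q - {z'})" by (rule sum.remove[OF f(2)]) (use z' in auto)
        ultimately show ?thesis using 2 c by linarith
      next
        case 3
        let ?I = "{y\<in>V. p z \<le> p y \<and> p y \<le> p z'}"
        let ?J = "{y\<in>V. p z < p y \<and> p y \<le> p z'}" and ?J' = "{y\<in>V. p z \<le> p y \<and> p y < p z'}"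
        have zV: "z \<in> V" "z \<in> P" "z \<in> Q" "0 < b z" "z' \<in> V" "z' \<in> P" "z' \<in> Q" "0 < b z'"
          using z(1) z'(1) less.prems by auto
        have zz': "p z \<le> p z'" using z'_max z(1) by blast
        have finI: "finite ?I" using fin by simp
        have ne: "p x \<noteq> p z" if "x \<in> V" "x \<noteq> z" for x using inj_onD[OF inj] that zV by blast
        have ne': "p x \<noteq> p z'" if "x \<in> V" "x \<noteq> z'" for x using inj_onD[OF inj] that zV by blast
        have IJ: "?I = insert z ?J"
        proof (intro set_eqI iffI)
          fix x assume "x \<in> ?I"
          then show "x \<in> insert z ?J" using ne[of x] by (cases "x = z") auto
        next
          fix x assume "x \<in> insert z ?J"
          then show "x \<in> ?I" using zz' zV by auto
        qed
        have IJ': "?I = insert z' ?J'"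
        proof (intro set_eqI iffI)
          fix x assume "x \<in> ?I"
          then show "x \<in> insert z' ?J'" using ne'[of x] by (cases "x = z'") auto
        next
          fix x assume "x \<in> insert z' ?J'"
          then show "x \<in> ?I" using zz' zV by auto
        qed
        \<comment> \<open>The strict inequality leaves room for the at most one arc of
          \<open>F\<close> leaving \<open>z\<close>, which \<open>A\<close> excludes.\<close>
        have "card (A `` {z} \<inter> Q) + card (F `` {z}) \<le> k" using 3(1) F_out[of z] b_le[of z] by linarith
        then have "sum b (Q \<inter> ?J) \<le> sum b (?J - Q) + 2 * k * k + k * d"
          by (rule out_interval_bound[OF zV(1,4)])
        moreover have "Q \<inter> ?I = insert z (Q \<inter> ?J)" "?I - Q = ?J - Q" using IJ zV by auto
        moreover have "sum b (insert z (Q \<inter> ?J)) = b z + sum b (Q \<inter> ?J)" using f by (subst sum.insert) auto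
        ultimately have q: "sum b (Q \<inter> ?I) \<le> sum b (?I - Q) + ?c" using b_le[of z] by simp
        have "card (A\<inverse> `` {z'} \<inter> P) + card (F\<inverse> `` {z'}) \<le> k" using 3(2) F_in[of z'] b_le[of z'] by linarith
        then have "sum b (P \<inter> ?J') \<le> sum b (?J' - P) + 2 * k * k + k * d"
          by (rule in_interval_bound[OF zV(5,8)])
        moreover have "P \<inter> ?I = insert z' (P \<inter> ?J')" "?I - P = ?J' - P" using IJ' zV by auto
        moreover have "sum b (insert z' (P \<inter> ?J')) = b z' + sum b (P \<inter> ?J')" using f by (subst sum.insert) auto
        ultimately have r: "sum b (P \<inter> ?I) \<le> sum b (?I - P) + ?c" using b_le[of z'] by simp
        have s: "sum b ?I = sum b (Q \<inter> ?I) + sum b (?I - Q)" "sum b ?I = sum b (P \<inter> ?I) + sum b (?I - P)"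
          "sum b Q = sum b (Q \<inter> ?I) + sum b (Q - ?I)" "sum b P = sum b (P \<inter> ?I) + sum b (P - ?I)"
          using sum.Int_Diff[OF finI, of b Q] sum.Int_Diff[OF finI, of b P]
            sum.Int_Diff[OF f(2), of b ?I] sum.Int_Diff[OF f(1), of b ?I] by (simp_all add: Int_commute)
        have t: "sum b V = sum b ?I + sum b (V - ?I)"
          using sum.Int_Diff[OF fin, of b ?I] by (metis (no_types, lifting) Int_absorb1 mem_Collect_eq subsetI)
        have "sum b (P - ?I) + sum b (Q - ?I) = sum b ((P - ?I) \<union> (Q - ?I)) + sum b ((P - ?I) \<inter> (Q - ?I))"
          by (rule sum.union_inter[symmetric]) (use f in auto)
        \<comment> \<open>By the choice of \<open>z\<close> and \<open>z'\<close>, all vertices of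
          positive weight in \<open>P \<inter> Q\<close> lie in \<open>?I\<close>.\<close>
        also have "sum b ((P - ?I) \<inter> (Q - ?I)) = 0"
        proof (rule sum.neutral, rule ballI)
          fix x assume x: "x \<in> (P - ?I) \<inter> (Q - ?I)"
          show "b x = 0"
          proof (rule ccontr)
            assume "b x \<noteq> 0"
            then have "x \<in> ?Z" using x by auto
            then show False using z(2) z'_max x less.prems by auto
          qed
        qed
        also have "sum b ((P - ?I) \<union> (Q - ?I)) \<le> sum b (V - ?I)"
          using fin less.prems by (intro sum_mono2) auto
        \<comment> \<open>Half the sum of \<open>q\<close> and \<open>r\<close>: inside
          \<open>?I\<close> the weights of \<open>P\<close> and \<open>Q\<close> add up to at most
          \<open>sum b ?I + ?c\<close>.\<close>
        finally show ?thesis using q r s t by linarith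
      qed
    qed
  qed
  then show ?thesis by (simp add: matching_cond_def)
qed

lemma later_bound:
  assumes z: "z \<in> V" "0 < b z" and out: "card (A `` {z}) + card (F `` {z}) \<le> k"
  shows "sum b {y\<in>V. p z < p y} \<le> 2 * k * k + k * d"
proof -
  \<comment> \<open>\<open>sum p V\<close> merely bounds all positions, so that the interval
    contains everything after \<open>z\<close>.\<close>
  have "p y \<le> sum p V" if "y \<in> V" for y using fin that by (intro member_le_sum) auto
  then have "{y\<in>V. p z < p y \<and> p y \<le> sum p V} = {y\<in>V. p z < p y}" by auto
  then show ?thesis using out_interval_bound[OF z, of UNIV "sum p V"] out by simp
qed

lemma earlier_bound:
  assumes z: "z \<in> V" "0 < b z" and out: "card (A\<inverse> `` {z}) + card (F\<inverse> `` {z}) \<le> k"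
  shows "sum b {y\<in>V. p y < p z} \<le> 2 * k * k + k * d"
  using in_interval_bound[OF z, of UNIV 0] out by simp

lemma small_window:
  assumes U: "U \<subseteq> V" and f: "inj_on f V" "\<And>v. v \<in> U \<Longrightarrow> 0 < b v"
    "\<And>v. v \<in> U \<Longrightarrow> sum b {y\<in>V. (f v :: int) < f y} \<le> 2 * k * k + k * d"
  shows "card U \<le> 6 * k + 2 * d"
proof -
  \<comment> \<open>A positive \<open>b v\<close> is \<open>k\<close>, or \<open>k - 1\<close> with
    \<open>2 \<le> k\<close>.\<close>
  have "k \<le> 2 * b v" if "v \<in> U" for v using f(2)[OF that] by (auto simp: b_def split: if_splits)
  then have "k * card U \<le> 2 * k + 2 * (2 * k * k + k * d)"
    by (intro card_window[OF fin U f(1) f(3) b_le])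
  also have "\<dots> = k * (2 + 4 * k + 2 * d)" by (simp add: algebra_simps)
  finally have "k * card U \<le> k * (2 + 4 * k + 2 * d)" .
  then have "card U \<le> 2 + 4 * k + 2 * d" by (rule mult_left_le_imp_le) (use k_pos in simp)
  then show ?thesis using k_pos by simp
qed

lemma small_out_window: "card {v\<in>V. card (A `` {v}) < b v} \<le> 6 * k + 2 * d"
proof (rule small_window[where f = "\<lambda>v. int (p v)"])
  show "inj_on (\<lambda>v. int (p v)) V" using inj by (simp add: inj_on_def)
  fix v assume "v \<in> {v\<in>V. card (A `` {v}) < b v}"
  then have v: "v \<in> V" "card (A `` {v}) < b v" by auto
  then have "card (A `` {v}) + card (F `` {v}) \<le> k" using F_out[of v] b_le[of v] by linarith
  then show "sum b {y\<in>V. int (p v) < int (p y)} \<le> 2 * k * k + k * d"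
    using later_bound[of v] v by simp
qed auto

text \<open>Otherwise \<open>{v}\<close> would be closed backwards and miss \<open>X\<close>. Hence
  outside \<open>X\<close> the wanted in-degree is at most \<open>b v\<close>.\<close>

lemma Range_of_Domain: "v \<in> Domain F \<Longrightarrow> v \<notin> X \<Longrightarrow> v \<in> Range F"
proof (rule ccontr)
  assume v: "v \<in> Domain F" "v \<notin> X" "v \<notin> Range F"
  then obtain w where "(v, w) \<in> F" by auto
  then show False using F.backward_closed_meets_X[of v w "{v}"] v by auto
qed

lemma small_in_window:
  "card {v\<in>V - X. card (A\<inverse> `` {v}) < (if v \<in> Range F then k - 1 else k)} \<le> 6 * k + 2 * d"
proof (rule small_window[where f = "\<lambda>v. - int (p v)"])
  show "inj_on (\<lambda>v. - int (p v)) V" using inj by (simp add: inj_on_def)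
  fix v assume "v \<in> {v\<in>V - X. card (A\<inverse> `` {v}) < (if v \<in> Range F then k - 1 else k)}"
  then have v: "v \<in> V" "card (A\<inverse> `` {v}) < b v"
    using Range_of_Domain[of v] by (auto simp: b_def split: if_splits)
  then have "card (A\<inverse> `` {v}) + card (F\<inverse> `` {v}) \<le> k" using F_in[of v] b_le[of v] by linarith
  then show "sum b {y\<in>V. - int (p v) < - int (p y)} \<le> 2 * k * k + k * d"
    using earlier_bound[of v] v by simp
  show "0 < b v" using v by simp
qed auto

lemma sum_b: "sum b V + card F = k * card V"
proof -
  have "inj_on fst F" using F.out_unique by (auto simp: inj_on_def)
  then have "card F = card (Domain F)" by (simp add: Domain_fst card_image)
  also have "Domain F = {v\<in>V. v \<in> Domain F}" using F.F(1) arcs by auto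
  also have "card \<dots> = (\<Sum>v\<in>V. if v \<in> Domain F then 1 else 0)" using fin by (simp add: sum.If_cases Int_def)
  finally have "sum b V + card F = (\<Sum>v\<in>V. b v + (if v \<in> Domain F then 1 else 0))"
    by (simp add: sum.distrib)
  also have "\<dots> = (\<Sum>v\<in>V. k)" using k_pos by (intro sum.cong) (auto simp: b_def)
  finally show ?thesis by simp
qed

text \<open>The matching \<open>G0\<close> is completed once towards the out-degrees and once
  towards the in-degrees. Both completions contain \<open>G0\<close> and have at most
  \<open>sum b V\<close> arcs, so their union exceeds \<open>sum b V\<close> by at most the
  deficiency.\<close>

lemma forward_arcs:
  "\<exists>G\<subseteq>A. card G + card F \<le> k * card V + (2 * k * k + k * d + k) \<and>
    (\<forall>v\<in>V. min (b v) (card (A `` {v})) \<le> card (G `` {v})) \<and>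
    (\<forall>v\<in>V. min (b v) (card (A\<inverse> `` {v})) \<le> card (G\<inverse> `` {v}))"
proof -
  obtain G0 where G0: "G0 \<subseteq> A" "\<forall>u. card (G0 `` {u}) \<le> b u" "\<forall>v. card (G0\<inverse> `` {v}) \<le> b v"
    "sum b V \<le> card G0 + (2 * k * k + k * d + k)"
    using capacitated_matching[OF fin A_arcs(2) forward_matching_cond] by auto
  obtain G1 where G1: "G0 \<subseteq> G1" "G1 \<subseteq> A" "\<forall>u\<in>V. min (b u) (card (A `` {u})) \<le> card (G1 `` {u})"
    "card G1 \<le> sum b V"
    using fill_out_degrees[OF fin A_arcs(2) G0(1), of b] G0(2) by auto
  have "A\<inverse> \<subseteq> V \<times> V" "G0\<inverse> \<subseteq> A\<inverse>" using A_arcs G0 by auto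
  then obtain G2 where G2: "G0\<inverse> \<subseteq> G2" "G2 \<subseteq> A\<inverse>" "\<forall>u\<in>V. min (b u) (card (A\<inverse> `` {u})) \<le> card (G2 `` {u})"
    "card G2 \<le> sum b V"
    using fill_out_degrees[OF fin, of "A\<inverse>" "G0\<inverse>" b] G0(3) by auto
  let ?G = "G1 \<union> G2\<inverse>"
  have GA: "?G \<subseteq> A" using G1 G2 by auto
  have f: "finite G1" "finite (G2\<inverse>)" using GA finite_A finite_subset by blast+
  have "card ?G + card (G1 \<inter> G2\<inverse>) = card G1 + card (G2\<inverse>)" by (rule card_Un_Int[OF f, symmetric])
  moreover have "card G0 \<le> card (G1 \<inter> G2\<inverse>)" using G1 G2 f by (intro card_mono) auto
  moreover have "card (G2\<inverse>) = card G2" by (rule card_inverse)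
  ultimately have "card ?G + card F \<le> k * card V + (2 * k * k + k * d + k)"
    using G0(4) G1(4) G2(4) sum_b by linarith
  moreover have "min (b v) (card (A `` {v})) \<le> card (?G `` {v})" if "v \<in> V" for v
  proof -
    have "card (G1 `` {v}) \<le> card (?G `` {v})" using f by (intro card_mono) auto
    then show ?thesis using G1(3) that by fastforce
  qed
  moreover have "min (b v) (card (A\<inverse> `` {v})) \<le> card (?G\<inverse> `` {v})" if "v \<in> V" for v
  proof -
    have "card (G2 `` {v}) \<le> card (?G\<inverse> `` {v})" using f by (intro card_mono) (auto simp: converse_Un)
    then show ?thesis using G2(3) that by fastforce
  qed
  ultimately show ?thesis using GA by blast
qed

end

lemma forward_structure:
  assumes F: "minimal_linkage V E X Y k F"
  shows "\<exists>(p :: 'a \<Rightarrow> nat) G S S'. inj_on p V \<and> G \<subseteq> {(u, v) \<in> E. p u < p v} - F \<and>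
    card G + card F \<le> k * card V + (2 * k * k + k * d + k) \<and>
    S \<subseteq> V \<and> card S \<le> 6 * k + 2 * d \<and> S' \<subseteq> V \<and> card S' \<le> 6 * k + 2 * d \<and>
    (\<forall>v\<in>V - S. (if v \<in> Domain F then k - 1 else k) \<le> card (G `` {v})) \<and>
    (\<forall>v\<in>V - X - S'. (if v \<in> Range F then k - 1 else k) \<le> card (G\<inverse> `` {v}))"
proof -
  define b where "b v = (if v \<in> Domain F then k - 1 else k)" for v
  \<comment> \<open>The product makes \<open>b z\<close> a common factor of all weights at
    \<open>z\<close>.\<close>
  define w where "w u v = (if (u, v) \<in> E then b u * b v else 0)" for u v
  obtain p :: "'a \<Rightarrow> nat" where p: "inj_on p V"
    "\<forall>z\<in>V. \<forall>m. (\<Sum>y\<in>{y\<in>V. p z < p y \<and> p y \<le> m}. w y z) \<le> (\<Sum>y\<in>{y\<in>V. p z < p y \<and> p y \<le> m}. w z y)"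
    "\<forall>z\<in>V. \<forall>m. (\<Sum>y\<in>{y\<in>V. m \<le> p y \<and> p y < p z}. w z y) \<le> (\<Sum>y\<in>{y\<in>V. m \<le> p y \<and> p y < p z}. w y z)"
    using median_order[OF fin, of w] by blast
  have w: "(\<Sum>y\<in>J. w y z) = b z * sum b {y\<in>J. (y, z) \<in> E}" "(\<Sum>y\<in>J. w z y) = b z * sum b {y\<in>J. (z, y) \<in> E}"
    if "J \<subseteq> V" for J z
  proof -
    have "finite J" using that finite_sub by blast
    then show "(\<Sum>y\<in>J. w y z) = b z * sum b {y\<in>J. (y, z) \<in> E}" "(\<Sum>y\<in>J. w z y) = b z * sum b {y\<in>J. (z, y) \<in> E}"
      by (simp_all add: w_def sum.If_cases Int_def sum_distrib_left mult.commute)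
  qed
  have m1: "sum b {y\<in>{y\<in>V. p z < p y \<and> p y \<le> m}. (y, z) \<in> E} \<le> sum b {y\<in>{y\<in>V. p z < p y \<and> p y \<le> m}. (z, y) \<in> E}"
    if "z \<in> V" "0 < b z" for z m
  proof -
    have J: "{y\<in>V. p z < p y \<and> p y \<le> m} \<subseteq> V" by auto
    have "b z * sum b {y\<in>{y\<in>V. p z < p y \<and> p y \<le> m}. (y, z) \<in> E} \<le> b z * sum b {y\<in>{y\<in>V. p z < p y \<and> p y \<le> m}. (z, y) \<in> E}"
      using p(2)[rule_format, OF that(1), of m] unfolding w[OF J] .
    then show ?thesis by (rule mult_left_le_imp_le) (rule that(2))
  qed
  have m2: "sum b {y\<in>{y\<in>V. m \<le> p y \<and> p y < p z}. (z, y) \<in> E} \<le> sum b {y\<in>{y\<in>V. m \<le> p y \<and> p y < p z}. (y, z) \<in> E}"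
    if "z \<in> V" "0 < b z" for z m
  proof -
    have J: "{y\<in>V. m \<le> p y \<and> p y < p z} \<subseteq> V" by auto
    have "b z * sum b {y\<in>{y\<in>V. m \<le> p y \<and> p y < p z}. (z, y) \<in> E} \<le> b z * sum b {y\<in>{y\<in>V. m \<le> p y \<and> p y < p z}. (y, z) \<in> E}"
      using p(3)[rule_format, OF that(1), of m] unfolding w[OF J] .
    then show ?thesis by (rule mult_left_le_imp_le) (rule that(2))
  qed
  have b_eq: "b = (\<lambda>v. if v \<in> Domain F then k - 1 else k)" by (simp add: b_def fun_eq_iff)
  let ?A = "{(u, v) \<in> E. p u < p v} - F"
  let ?S = "{v\<in>V. card (?A `` {v}) < b v}"
    and ?S' = "{v\<in>V - X. card (?A\<inverse> `` {v}) < (if v \<in> Range F then k - 1 else k)}"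
  note prems = F p(1) m1[unfolded b_eq] m2[unfolded b_eq]
  obtain G where G: "G \<subseteq> ?A" "card G + card F \<le> k * card V + (2 * k * k + k * d + k)"
    "\<forall>v\<in>V. min (b v) (card (?A `` {v})) \<le> card (G `` {v})"
    "\<forall>v\<in>V. min (b v) (card (?A\<inverse> `` {v})) \<le> card (G\<inverse> `` {v})"
    using forward_arcs[OF prems] unfolding b_eq by blast
  have S: "card ?S \<le> 6 * k + 2 * d" using small_out_window[OF prems] unfolding b_eq .
  have S': "card ?S' \<le> 6 * k + 2 * d" using small_in_window[OF prems] .
  have out: "\<forall>v\<in>V - ?S. (if v \<in> Domain F then k - 1 else k) \<le> card (G `` {v})"
  proof
    fix v assume "v \<in> V - ?S"
    then have v: "v \<in> V" "b v \<le> card (?A `` {v})" by auto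
    then have "b v \<le> card (G `` {v})" using G(3)[rule_format, OF v(1)] by simp
    then show "(if v \<in> Domain F then k - 1 else k) \<le> card (G `` {v})" unfolding b_def .
  qed
  have "\<forall>v\<in>V - X - ?S'. (if v \<in> Range F then k - 1 else k) \<le> card (G\<inverse> `` {v})"
  proof
    fix v assume v': "v \<in> V - X - ?S'"
    let ?m = "if v \<in> Range F then k - 1 else k"
    have v: "v \<in> V" "\<not> card (?A\<inverse> `` {v}) < ?m" using v' by blast+
    have "?m \<le> b v" using Range_of_Domain[OF prems, of v] v' by (auto simp: b_def)
    then have "?m \<le> min (b v) (card (?A\<inverse> `` {v}))" using v(2) by linarith
    also have "\<dots> \<le> card (G\<inverse> `` {v})" by (rule G(4)[rule_format, OF v(1)])
    finally show "?m \<le> card (G\<inverse> `` {v})" .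
  qed
  moreover have "?S \<subseteq> V" "?S' \<subseteq> V" by auto
  ultimately show ?thesis using p(1) G(1,2) S S' out by blast
qed

end

section \<open>Strong connectivity of the union\<close>

definition arc_k_conn :: "'a set \<Rightarrow> nat \<Rightarrow> 'a rel \<Rightarrow> bool" where
  "arc_k_conn V k H \<longleftrightarrow>
     (\<forall>T\<subseteq>V. T \<noteq> {} \<longrightarrow> V - T - out_nbhd H T \<noteq> {} \<longrightarrow> k \<le> card (out_nbhd H T))"

lemma arc_k_connD:
  "arc_k_conn V k H \<Longrightarrow> T \<subseteq> V \<Longrightarrow> T \<noteq> {} \<Longrightarrow> V - T - out_nbhd H T \<noteq> {} \<Longrightarrow> k \<le> card (out_nbhd H T)"
  by (simp add: arc_k_conn_def)

text \<open>No arc leads from \<open>T\<close> to the remaining vertices, as its head would be in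
  \<open>out_nbhd H T\<close>; so the same separator works in the reversed digraph.\<close>

lemma out_nbhd_converse_complement:
  assumes "H \<subseteq> V \<times> V"
  shows "out_nbhd (H\<inverse>) (V - T - out_nbhd H T) \<subseteq> out_nbhd H T"
proof
  fix y assume "y \<in> out_nbhd (H\<inverse>) (V - T - out_nbhd H T)"
  then obtain x where x: "x \<in> V - T - out_nbhd H T" "(y, x) \<in> H" "y \<notin> V - T - out_nbhd H T"
    unfolding out_nbhd_iff[of y "H\<inverse>"] by blast
  then have "y \<notin> T" by (auto simp: out_nbhd_iff)
  then show "y \<in> out_nbhd H T" using x assms by auto
qed

lemma arc_k_conn_converse:
  assumes fin: "finite V" and H: "H \<subseteq> V \<times> V" and conn: "arc_k_conn V k H"
  shows "arc_k_conn V k (H\<inverse>)"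
  unfolding arc_k_conn_def
proof (intro allI impI)
  fix T assume T: "T \<subseteq> V" "T \<noteq> {}" "V - T - out_nbhd (H\<inverse>) T \<noteq> {}"
  let ?T = "V - T - out_nbhd (H\<inverse>) T"
  have H': "H\<inverse> \<subseteq> V \<times> V" using H by auto
  have sub: "out_nbhd H ?T \<subseteq> out_nbhd (H\<inverse>) T" using out_nbhd_converse_complement[OF H', of T] by simp
  moreover have "T \<inter> out_nbhd (H\<inverse>) T = {}" by (auto simp: out_nbhd_def)
  ultimately have "T \<subseteq> V - ?T - out_nbhd H ?T" using T(1) by blast
  then have "k \<le> card (out_nbhd H ?T)" using T by (intro arc_k_connD[OF conn]) auto
  also have "\<dots> \<le> card (out_nbhd (H\<inverse>) T)" by (rule card_mono[OF finite_out_nbhd[OF fin H'] sub])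
  finally show "k \<le> card (out_nbhd (H\<inverse>) T)" .
qed

lemma (in dense_digraph) converse: "dense_digraph V (E\<inverse>) k d"
proof
  have "arc_k_conn V k E" using conn by (simp add: arc_k_conn_def)
  then have c: "arc_k_conn V k (E\<inverse>)" by (rule arc_k_conn_converse[OF fin arcs])
  show "k \<le> card (out_nbhd (E\<inverse>) T)" if "T \<subseteq> V" "T \<noteq> {}" "V - T - out_nbhd (E\<inverse>) T \<noteq> {}" for T
    by (rule arc_k_connD[OF c that])
  show "card {w \<in> V. w \<noteq> v \<and> (v, w) \<notin> E\<inverse> \<and> (w, v) \<notin> E\<inverse>} \<le> d" if "v \<in> V" for v
    using non_adj[OF that] by (simp add: conj_commute)
qed (use fin arcs loopfree k_pos in auto)

text \<open>\<open>F\<close> and \<open>G\<close> give the main term; \<open>K\<close> leads from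
  \<open>W\<close> to \<open>X\<close>, and \<open>M\<close> leads from \<open>S\<close> and
  \<open>Y\<close> to \<open>W\<close>. The reversed \<open>M'\<close> serves \<open>S'\<close>, and
  the reversed \<open>C\<close> and \<open>F'\<close> lead backwards from \<open>W'\<close> to
  \<open>X\<close>, using \<open>F\<close>.\<close>

lemma (in dense_digraph) large_case:
  assumes n: "120 * k + 61 * d \<le> card V"
  shows "\<exists>H\<subseteq>E. arc_k_conn V k H \<and> card H \<le> k * card V + 790 * k * d + 790 * k\<^sup>2"
proof -
  interpret R: dense_digraph V "E\<inverse>" k d by (rule converse)
  from sink_side[OF n] obtain W X K where
    W: "W \<subseteq> V" and X: "X \<subseteq> V" "card X = k" and K: "K \<subseteq> E" "card K \<le> 420 * k * k + 215 * k * d"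
    and sink: "\<forall>T\<subseteq>V. T \<inter> W \<noteq> {} \<longrightarrow> card (out_nbhd K T) < k \<longrightarrow> X \<subseteq> T \<union> out_nbhd K T"
    and exits: "\<forall>v\<in>V - W. \<exists>L\<subseteq>E. card L \<le> 2 * k \<and> (\<forall>T. v \<in> T \<longrightarrow> T \<inter> W = {} \<longrightarrow> k \<le> card (out_nbhd L T))"
    by (elim exE conjE)
  \<comment> \<open>On this side the core set itself is \<open>Y\<close>, hence
    \<open>m = k\<close>.\<close>
  have "4 * k + 24 * k + 13 * d \<le> card V" using n by simp
  from R.core_structure[OF this] obtain W' Y C where
    W': "W' \<subseteq> V" "card W' = 4 * k + 24 * k + 13 * d" and Y: "Y \<subseteq> W'" "card Y = k"
    and C: "C \<subseteq> E\<inverse>" "card C \<le> 2 * k * (2 * k + 6 * k + 5 * d)"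
    and core: "\<forall>T\<subseteq>V. T \<inter> W' \<noteq> {} \<longrightarrow> card (out_nbhd (C \<union> E\<inverse> \<inter> W' \<times> UNIV) T) < k \<longrightarrow>
       Y \<subseteq> T \<union> out_nbhd (C \<union> E\<inverse> \<inter> W' \<times> UNIV) T"
    and exits': "\<forall>v\<in>V - W'. \<exists>L\<subseteq>E\<inverse>. card L \<le> 2 * k \<and> (\<forall>T. v \<in> T \<longrightarrow> T \<inter> W' = {} \<longrightarrow> k \<le> card (out_nbhd L T))"
    by (elim exE conjE)
  have YV: "Y \<subseteq> V" using Y W' by blast
  obtain F where F: "minimal_linkage V E X Y k F" using exists_linkage[OF X YV Y(2)] by blast
  interpret F: minimal_linkage V E X Y k F by (rule F)
  \<comment> \<open>In the reversed digraph a set meeting \<open>W'\<close> covers \<open>Y\<close>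
    or has \<open>k\<close> out-neighbours, and \<open>F\<close> backwards leads from
    \<open>Y\<close> to \<open>X\<close>. So \<open>X\<close> can serve as root set.\<close>
  have "\<exists>F'\<subseteq>E\<inverse> \<inter> W' \<times> UNIV. card F' \<le> k * card W' \<and>
    (\<forall>T\<subseteq>V. T \<inter> W' \<noteq> {} \<longrightarrow> T \<inter> X = {} \<longrightarrow> k \<le> card (out_nbhd (C \<union> F\<inverse> \<union> F') T))"
  proof (rule rooted_sparsification[OF fin])
    let ?G = "C \<union> F\<inverse> \<union> E\<inverse> \<inter> W' \<times> UNIV" and ?B = "C \<union> E\<inverse> \<inter> W' \<times> UNIV"
    have G: "?G \<subseteq> V \<times> V" using C F.F(1) arcs by blast
    fix T assume T: "T \<subseteq> V" "T \<inter> W' \<noteq> {}" "T \<inter> X = {}"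
    show "k \<le> card (out_nbhd ?G T)"
    proof (rule ccontr)
      assume less: "\<not> ?thesis"
      have "card (out_nbhd ?B T) \<le> card (out_nbhd ?G T)" by (rule card_out_nbhd_mono[OF fin G]) auto
      then have "Y \<subseteq> T \<union> out_nbhd ?B T" using core T less by simp
      also have "\<dots> \<subseteq> T \<union> out_nbhd ?G T" using out_nbhd_mono[of ?B ?G T] by blast
      finally have "k \<le> card (out_nbhd ?G T)"
        by (intro linked_reverse[OF fin G X(1) F.F(2) _ T(1) T(3)]) auto
      then show False using less by simp
    qed
  qed (use C F.F(1) arcs W' in auto)
  then obtain F' where F': "F' \<subseteq> E\<inverse> \<inter> W' \<times> UNIV" "card F' \<le> k * card W'"
    and root: "\<forall>T\<subseteq>V. T \<inter> W' \<noteq> {} \<longrightarrow> T \<inter> X = {} \<longrightarrow> k \<le> card (out_nbhd (C \<union> F\<inverse> \<union> F') T)"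
    by (elim exE conjE)
  from forward_structure[OF F] obtain p :: "'a \<Rightarrow> nat" and G S S' where
    p: "inj_on p V" and G: "G \<subseteq> {(u, v) \<in> E. p u < p v} - F"
      "card G + card F \<le> k * card V + (2 * k * k + k * d + k)"
    and S: "S \<subseteq> V" "card S \<le> 6 * k + 2 * d" and S': "S' \<subseteq> V" "card S' \<le> 6 * k + 2 * d"
    and out_deg: "\<forall>v\<in>V - S. (if v \<in> Domain F then k - 1 else k) \<le> card (G `` {v})"
    and in_deg: "\<forall>v\<in>V - X - S'. (if v \<in> Range F then k - 1 else k) \<le> card (G\<inverse> `` {v})"
    by (elim exE conjE)
  from bchoice[OF exits] obtain L where
    L: "\<forall>v\<in>V - W. L v \<subseteq> E \<and> card (L v) \<le> 2 * k \<and> (\<forall>T. v \<in> T \<longrightarrow> T \<inter> W = {} \<longrightarrow> k \<le> card (out_nbhd (L v) T))"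
    by blast
  from bchoice[OF exits'] obtain L' where
    L': "\<forall>v\<in>V - W'. L' v \<subseteq> E\<inverse> \<and> card (L' v) \<le> 2 * k \<and> (\<forall>T. v \<in> T \<longrightarrow> T \<inter> W' = {} \<longrightarrow> k \<le> card (out_nbhd (L' v) T))"
    by blast
  define M where "M = (\<Union>v\<in>(S \<union> Y) - W. L v)"
  define M' where "M' = (\<Union>v\<in>S' - W'. L' v)"
  define H where "H = F \<union> G \<union> K \<union> M \<union> (C \<union> F' \<union> M')\<inverse>"
  have finS: "finite S" "finite Y" "finite S'" using S S' YV finite_sub by blast+
  have ME: "M \<subseteq> E" using L S YV by (auto simp: M_def)
  have M'E: "M' \<subseteq> E\<inverse>" using L' S' by (force simp: M'_def)
  have HE: "H \<subseteq> E" using F.F(1) G(1) K ME C F' M'E by (auto simp: H_def)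
  have HV: "H \<subseteq> V \<times> V" using HE arcs by blast
  have H'V: "H\<inverse> \<subseteq> V \<times> V" using HV by auto
  have card_H: "card H \<le> k * card V + 790 * k * d + 790 * k\<^sup>2"
  proof -
    have "card M \<le> 2 * k * card ((S \<union> Y) - W)"
      unfolding M_def by (rule card_UN_le_mult) (use finS L S YV in auto)
    also have "\<dots> \<le> 2 * k * (7 * k + 2 * d)"
    proof (rule mult_le_mono2)
      have "card ((S \<union> Y) - W) \<le> card (S \<union> Y)" using finS by (intro card_mono) auto
      also have "\<dots> \<le> card S + card Y" by (rule card_Un_le)
      finally show "card ((S \<union> Y) - W) \<le> 7 * k + 2 * d" using S Y by simp
    qed
    finally have cM: "card M \<le> 14 * (k * k) + 4 * (k * d)" by (simp add: algebra_simps)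
    have "card M' \<le> 2 * k * card (S' - W')"
      unfolding M'_def by (rule card_UN_le_mult) (use finS L' S' in auto)
    also have "\<dots> \<le> 2 * k * (6 * k + 2 * d)"
    proof (rule mult_le_mono2)
      have "card (S' - W') \<le> card S'" using finS by (intro card_mono) auto
      then show "card (S' - W') \<le> 6 * k + 2 * d" using S' by simp
    qed
    finally have cM': "card M' \<le> 12 * (k * k) + 4 * (k * d)" by (simp add: algebra_simps)
    have cC: "card C \<le> 16 * (k * k) + 10 * (k * d)" using C(2) by (simp add: algebra_simps)
    have cF': "card F' \<le> 28 * (k * k) + 13 * (k * d)" using F'(2) W'(2) by (simp add: algebra_simps)
    have cK: "card K \<le> 420 * (k * k) + 215 * (k * d)" using K(2) by (simp add: algebra_simps)
    have cG: "card G + card F \<le> k * card V + (2 * (k * k) + k * d + k)" using G(2) by (simp add: algebra_simps)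
    have "card H \<le> card F + card G + card K + card M + card ((C \<union> F' \<union> M')\<inverse>)"
      unfolding H_def by (meson add_le_mono1 card_Un_le order_trans)
    also have "card ((C \<union> F' \<union> M')\<inverse>) \<le> card C + card F' + card M'"
      unfolding card_inverse by (meson add_le_mono1 card_Un_le order_trans)
    finally have "card H \<le> card F + card G + card K + card M + (card C + card F' + card M')" by simp
    moreover have "k \<le> k * k" using k_pos by simp
    \<comment> \<open>The coefficients of \<open>k * k\<close> add up to 493 and those of
      \<open>k * d\<close> to 247.\<close>
    ultimately have "card H \<le> k * card V + 790 * (k * d) + 790 * (k * k)"
      using cM cM' cC cF' cK cG by linarith
    then show ?thesis by (simp add: power2_eq_square mult.assoc)
  qed
  have "arc_k_conn V k H"
    unfolding arc_k_conn_def
  proof (intro allI impI)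
    fix T assume T: "T \<subseteq> V" "T \<noteq> {}" "V - T - out_nbhd H T \<noteq> {}"
    show "k \<le> card (out_nbhd H T)"
    proof (rule ccontr)
      assume "\<not> k \<le> card (out_nbhd H T)"
      then have less: "card (out_nbhd H T) < k" by simp
      have finO: "finite (out_nbhd H T)" by (rule finite_out_nbhd[OF fin HV])
      have W_X: "X \<subseteq> T \<union> out_nbhd H T" if "T \<inter> W \<noteq> {}"
      proof -
        have KH: "K \<subseteq> H" by (auto simp: H_def)
        have "card (out_nbhd K T) < k" using card_out_nbhd_mono[OF fin HV KH, of T] less by simp
        then have "X \<subseteq> T \<union> out_nbhd K T" using sink T(1) that by simp
        then show ?thesis using out_nbhd_mono[OF KH, of T] by blast
      qed
      have SY_X: "X \<subseteq> T \<union> out_nbhd H T" if v: "v \<in> T" "v \<in> S \<union> Y" for v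
      proof (cases "T \<inter> W = {}")
        case True
        then have "v \<in> V - W" using v T by auto
        then have "k \<le> card (out_nbhd (L v) T)" using L v True by blast
        also have "\<dots> \<le> card (out_nbhd H T)"
          by (rule card_out_nbhd_mono[OF fin HV]) (use v True in \<open>auto simp: H_def M_def\<close>)
        finally show ?thesis using less by simp
      qed (rule W_X)
      have finT: "finite T" using T finite_sub by blast
      have XT: "X \<subseteq> T \<union> out_nbhd H T"
      proof -
        have "Max (p ` T) \<in> p ` T" using finT T by (intro Max_in) auto
        then obtain t where t: "t \<in> T" "p t = Max (p ` T)" by auto
        have t_max: "p x \<le> p t" if "x \<in> T" for x using that finT t(2) by simp
        show ?thesis
        proof (cases "t \<in> S")
          case False
          then have deg: "(if t \<in> Domain F then k - 1 else k) \<le> card (G `` {t})" using out_deg t T by blast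
          have N: "G `` {t} \<subseteq> out_nbhd H T"
          proof
            fix y assume y: "y \<in> G `` {t}"
            then have "p t < p y" using G(1) by auto
            then have "y \<notin> T" using t_max[of y] by auto
            then show "y \<in> out_nbhd H T" using y t by (auto simp: out_nbhd_iff H_def)
          qed
          have cN: "card (G `` {t}) \<le> card (out_nbhd H T)" by (rule card_mono[OF finO N])
          \<comment> \<open>Otherwise \<open>t\<close> would have \<open>k\<close> forward
            out-neighbours, all of them in the separator.\<close>
          have "t \<in> Domain F" using deg cN less by (auto split: if_splits)
          then obtain t' where tt': "(t, t') \<in> F" by auto
          have "card (out_nbhd H T) \<le> card (G `` {t})" using deg less \<open>t \<in> Domain F\<close> by simp
          then have N_eq: "G `` {t} = out_nbhd H T" by (rule card_seteq[OF finO N])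
          have "t' \<notin> G `` {t}" using tt' G(1) by auto
          then have t'T: "t' \<in> T" using N_eq tt' t by (auto simp: out_nbhd_iff H_def)
          let ?R = "{r. (t', r) \<in> F\<^sup>*}"
          \<comment> \<open>The first vertex of this path outside \<open>T\<close> would be in the
            separator, hence a forward out-neighbour of \<open>t\<close> and the head of a
            chord.\<close>
          have RT: "r \<in> T" if "(t', r) \<in> F\<^sup>*" for r
            using that
          proof (induction rule: rtrancl_induct)
            case (step r s)
            show ?case
            proof (rule ccontr)
              assume s: "s \<notin> T"
              then have "s \<in> G `` {t}" using step N_eq by (auto simp: out_nbhd_iff H_def)
              then have "(t, s) \<in> E" using G(1) by auto
              moreover have "(t', s) \<in> F\<^sup>+" using step by auto
              moreover have "s \<noteq> t'" using s t'T by auto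
              ultimately show False using F.chordless[OF tt'] by blast
            qed
          qed (rule t'T)
          have "?R \<inter> Y \<noteq> {}"
            by (rule F.forward_closed_meets_Y[OF tt']) (use RT T in \<open>auto intro: rtrancl_into_rtrancl\<close>)
          then show ?thesis using SY_X RT by blast
        qed (use SY_X t in blast)
      qed
      \<comment> \<open>The remaining vertices are treated in the reversed digraph. They avoid
        \<open>X\<close> by \<open>XT\<close>, so a vertex of \<open>X\<close> among them gives the
        contradiction.\<close>
      define I where "I = V - T - out_nbhd H T"
      have IV: "I \<subseteq> V" "I \<noteq> {}" using T(3) by (auto simp: I_def)
      have O': "card (out_nbhd (H\<inverse>) I) < k"
        using card_mono[OF finO out_nbhd_converse_complement[OF HV, of T]] less by (simp add: I_def)
      have finO': "finite (out_nbhd (H\<inverse>) I)" by (rule finite_out_nbhd[OF fin H'V])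
      have IX: "I \<inter> X = {}" using XT by (auto simp: I_def)
      have W'_F: "I \<inter> W' = {}"
      proof (rule ccontr)
        assume "I \<inter> W' \<noteq> {}"
        then have "k \<le> card (out_nbhd (C \<union> F\<inverse> \<union> F') I)" using root IX IV by simp
        also have "\<dots> \<le> card (out_nbhd (H\<inverse>) I)"
          by (rule card_out_nbhd_mono[OF fin H'V]) (auto simp: H_def)
        finally show False using O' by simp
      qed
      have S'_F: "v \<notin> S'" if v: "v \<in> I" for v
      proof
        assume v': "v \<in> S'"
        then have vW: "v \<in> V - W'" using v W'_F IV by auto
        then have "k \<le> card (out_nbhd (L' v) I)" using L'[rule_format, OF vW] v W'_F by simp
        also have "\<dots> \<le> card (out_nbhd (H\<inverse>) I)"
          by (rule card_out_nbhd_mono[OF fin H'V]) (use vW v' in \<open>auto simp: H_def M'_def\<close>)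
        finally show False using O' by simp
      qed
      have finI: "finite I" using IV finite_sub by blast
      have "Min (p ` I) \<in> p ` I" using finI IV by (intro Min_in) auto
      then obtain i where i: "i \<in> I" "p i = Min (p ` I)" by auto
      have i_min: "p i \<le> p x" if "x \<in> I" for x using that finI i(2) by simp
      have iV: "i \<in> V - X - S'" using i(1) IX S'_F IV by auto
      have deg: "(if i \<in> Range F then k - 1 else k) \<le> card (G\<inverse> `` {i})" by (rule in_deg[rule_format, OF iV])
      have N: "G\<inverse> `` {i} \<subseteq> out_nbhd (H\<inverse>) I"
      proof
        fix y assume y: "y \<in> G\<inverse> `` {i}"
        then have "p y < p i" using G(1) by auto
        then have "y \<notin> I" using i_min[of y] by linarith
        moreover have "(i, y) \<in> H\<inverse>" using y by (auto simp: H_def)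
        ultimately show "y \<in> out_nbhd (H\<inverse>) I" using i(1) unfolding out_nbhd_iff[of y "H\<inverse>"] by blast
      qed
      have cN: "card (G\<inverse> `` {i}) \<le> card (out_nbhd (H\<inverse>) I)" by (rule card_mono[OF finO' N])
      have iF: "i \<in> Range F" using deg cN O' by (auto split: if_splits)
      then obtain i' where ii': "(i', i) \<in> F" by auto
      have "card (out_nbhd (H\<inverse>) I) \<le> card (G\<inverse> `` {i})" using deg O' iF by simp
      then have N_eq: "G\<inverse> `` {i} = out_nbhd (H\<inverse>) I" by (rule card_seteq[OF finO' N])
      have in_N: "s \<in> G\<inverse> `` {i}" if "(s, r) \<in> F" "r \<in> I" "s \<notin> I" for s r
      proof -
        have "(r, s) \<in> H\<inverse>" using that by (auto simp: H_def)
        then show ?thesis using that unfolding N_eq out_nbhd_iff[of s "H\<inverse>"] by blast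
      qed
      have not_N: "s \<notin> G\<inverse> `` {i}" if "(s, i) \<in> F" for s using that G(1) by auto
      have i'I: "i' \<in> I" using in_N[OF ii' i(1)] not_N[OF ii'] by blast
      let ?R = "{r. (r, i') \<in> F\<^sup>*}"
      have RI: "r \<in> I" if "(r, i') \<in> F\<^sup>*" for r
        using that
      proof (induction rule: converse_rtrancl_induct)
        case (step s r)
        show ?case
        proof (rule ccontr)
          assume s: "s \<notin> I"
          then have "s \<in> G\<inverse> `` {i}" using in_N step by blast
          then have si: "(s, i) \<in> E" "(s, i) \<notin> F" using G(1) by auto
          have "(r, i) \<in> F\<^sup>+" using step(2) ii' by auto
          moreover have "i \<noteq> r" using si(2) step(1) by auto
          ultimately show False using F.chordless[OF step(1)] si(1) by blast
        qed
      qed (rule i'I)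
      have "?R \<inter> X \<noteq> {}"
        by (rule F.backward_closed_meets_X[OF ii']) (auto intro: converse_rtrancl_into_rtrancl)
      then show False using RI IX by blast
    qed
  qed
  then show ?thesis using HE card_H by blast
qed

section \<open>Digraphs with few vertices\<close>

text \<open>
  In the reversed digraph this bounds the number of arcs entering \<open>u\<close> that are critical for a set containing \<open>r\<close>.
\<close>

lemma card_critical_heads:
  assumes fin: "finite V" and H: "H \<subseteq> V \<times> V" and conn: "arc_k_conn V k H" and k: "1 \<le> k"
  shows "card {v. (u, v) \<in> H \<and> (\<exists>T\<subseteq>V. T \<noteq> {} \<and> r \<in> V - T - out_nbhd (H - {(u, v)}) T \<and>
    card (out_nbhd (H - {(u, v)}) T) < k)} \<le> k"
    (is "card ?M \<le> k")
proof (cases "?M \<subseteq> {r}")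
  case True
  then have "card ?M \<le> card {r}" by (intro card_mono) auto
  then show ?thesis using k by simp
next
  case False
  have crit: "\<exists>T. (T \<subseteq> V \<and> r \<in> V - T - out_nbhd H T) \<and> u \<in> T \<and> v \<in> out_nbhd H T \<and> card (out_nbhd H T) = k"
    if v: "v \<in> ?M" "v \<noteq> r" for v
  proof -
    obtain T where T: "T \<subseteq> V" "T \<noteq> {}" "r \<in> V - T - out_nbhd (H - {(u, v)}) T"
      "card (out_nbhd (H - {(u, v)}) T) < k" using v(1) by blast
    have r: "r \<in> V - T - out_nbhd H T" using T(3) v(2) by (auto simp: out_nbhd_iff)
    then have "k \<le> card (out_nbhd H T)" using T by (intro arc_k_connD[OF conn]) auto
    then show ?thesis
      using card_out_nbhd_remove1[OF fin H, where T = T and u = u and v = v] T r by (intro exI[of _ T]) auto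
  qed
  obtain v where "v \<in> ?M" "v \<noteq> r" using False by blast
  from crit[OF this] obtain T where "r \<in> V - T - out_nbhd H T" "u \<in> T" by blast
  \<comment> \<open>Thus \<open>r\<close> is not a head, and \<open>crit\<close> applies to every
    element of \<open>?M\<close>.\<close>
  then have "(u, r) \<notin> H" by (auto simp: out_nbhd_iff)
  then have ne: "v \<noteq> r" if "v \<in> ?M" for v using that by blast
  show ?thesis
  proof (rule card_tight_heads[OF fin H, where P = "\<lambda>T. T \<subseteq> V \<and> r \<in> V - T - out_nbhd H T" and u = u])
    show "k \<le> card (out_nbhd H T)" if "T \<subseteq> V \<and> r \<in> V - T - out_nbhd H T" "u \<in> T" for T
      using that by (intro arc_k_connD[OF conn]) auto
    show "\<exists>T. (T \<subseteq> V \<and> r \<in> V - T - out_nbhd H T) \<and> u \<in> T \<and> v \<in> out_nbhd H T \<and> card (out_nbhd H T) = k"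
      if "v \<in> ?M" for v using crit[OF that ne[OF that]] .
  qed (auto simp: out_nbhd_iff)
qed

text \<open>
  Every arc \<open>e\<close> of a minimal \<open>H\<close> is critical for some \<open>T e\<close>. On average over \<open>r\<close>, at most
  a fraction \<open>k / card V\<close> of the arcs has \<open>r\<close> in the out-neighbourhood of \<open>T e\<close>; the other arcs
  are counted by the previous lemma.
\<close>

lemma sparse_arc_k_conn:
  assumes fin: "finite V" "V \<noteq> {}" and E: "E \<subseteq> V \<times> V" and conn: "arc_k_conn V k E" and k: "1 \<le> k"
  shows "\<exists>H\<subseteq>E. arc_k_conn V k H \<and> card H \<le> 4 * k * card V"
proof -
  have finE: "finite E" using E fin by (meson finite_SigmaI finite_subset)
  obtain H where H: "H \<subseteq> E" "arc_k_conn V k H" and min: "\<And>H'. H' \<subset> H \<Longrightarrow> \<not> arc_k_conn V k H'"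
    by (rule exists_minimal_subset[of E "arc_k_conn V k"]) (use finE conn in auto)
  have HV: "H \<subseteq> V \<times> V" and finH: "finite H" using H E finE finite_subset by blast+
  have "card H \<le> 4 * k * card V"
  proof (cases "card V < 2 * k")
    case True
    have "card H \<le> card (V \<times> V)" using HV fin by (intro card_mono) auto
    also have "\<dots> = card V * card V" by (simp add: card_cartesian_product)
    also have "\<dots> \<le> (4 * k) * card V" using True by (intro mult_le_mono1) simp
    finally show ?thesis .
  next
    case False
    have "\<forall>e\<in>H. \<exists>T. T \<subseteq> V \<and> T \<noteq> {} \<and> V - T - out_nbhd (H - {e}) T \<noteq> {} \<and> card (out_nbhd (H - {e}) T) < k"
    proof
      fix e assume "e \<in> H"
      then have "\<not> arc_k_conn V k (H - {e})" by (intro min) auto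
      then show "\<exists>T. T \<subseteq> V \<and> T \<noteq> {} \<and> V - T - out_nbhd (H - {e}) T \<noteq> {} \<and> card (out_nbhd (H - {e}) T) < k"
        by (auto simp: arc_k_conn_def not_le)
    qed
    from bchoice[OF this] obtain T where T: "\<forall>e\<in>H. T e \<subseteq> V \<and> T e \<noteq> {} \<and> V - T e - out_nbhd (H - {e}) (T e) \<noteq> {} \<and>
        card (out_nbhd (H - {e}) (T e)) < k" by blast
    define B where "B r = {e\<in>H. r \<in> out_nbhd (H - {e}) (T e)}" for r
    have "(\<Sum>r\<in>V. card (B r)) = (\<Sum>r\<in>V. \<Sum>e\<in>H. if r \<in> out_nbhd (H - {e}) (T e) then 1 else 0)"
      using finH by (simp add: B_def sum.If_cases Int_def)
    also have "\<dots> = (\<Sum>e\<in>H. card (V \<inter> out_nbhd (H - {e}) (T e)))"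
      using fin by (subst sum.swap) (simp add: sum.If_cases Int_def)
    also have "\<dots> \<le> (\<Sum>e\<in>H. k)"
    proof (rule sum_mono)
      fix e assume e: "e \<in> H"
      have "card (V \<inter> out_nbhd (H - {e}) (T e)) \<le> card (out_nbhd (H - {e}) (T e))"
        by (rule card_mono[OF finite_out_nbhd[OF fin(1)]]) (use HV in auto)
      then show "card (V \<inter> out_nbhd (H - {e}) (T e)) \<le> k" using T e by fastforce
    qed
    finally have sumB: "(\<Sum>r\<in>V. card (B r)) \<le> k * card H" by (simp add: mult.commute)
    have "\<exists>r\<in>V. card V * card (B r) \<le> k * card H"
    proof (rule ccontr)
      assume "\<not> ?thesis"
      then have gt: "\<And>r. r \<in> V \<Longrightarrow> k * card H < card V * card (B r)" by (meson not_le)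
      have "card V * (k * card H) = (\<Sum>r\<in>V. k * card H)" by simp
      also have "\<dots> < (\<Sum>r\<in>V. card V * card (B r))" using fin gt by (intro sum_strict_mono) auto
      also have "\<dots> = card V * (\<Sum>r\<in>V. card (B r))" by (simp add: sum_distrib_left)
      also have "\<dots> \<le> card V * (k * card H)" using sumB by (rule mult_le_mono2)
      finally show False by simp
    qed
    then obtain r where r: "r \<in> V" "card V * card (B r) \<le> k * card H" by blast
    define M1 where "M1 u = {v. (u, v) \<in> H \<and> (\<exists>T\<subseteq>V. T \<noteq> {} \<and> r \<in> V - T - out_nbhd (H - {(u, v)}) T \<and>
      card (out_nbhd (H - {(u, v)}) T) < k)}" for u
    define M2 where "M2 v = {u. (v, u) \<in> H\<inverse> \<and> (\<exists>T\<subseteq>V. T \<noteq> {} \<and> r \<in> V - T - out_nbhd (H\<inverse> - {(v, u)}) T \<and>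
      card (out_nbhd (H\<inverse> - {(v, u)}) T) < k)}" for v
    have HV': "H\<inverse> \<subseteq> V \<times> V" using HV by auto
    have M1: "card (M1 u) \<le> k" for u
      unfolding M1_def by (rule card_critical_heads[OF fin(1) HV H(2) k])
    have M2: "card (M2 v) \<le> k" for v
      unfolding M2_def by (rule card_critical_heads[OF fin(1) HV' arc_k_conn_converse[OF fin(1) HV H(2)] k])
    have sub: "H \<subseteq> B r \<union> (SIGMA u:V. M1 u) \<union> (SIGMA v:V. M2 v)\<inverse>"
    proof
      fix e assume e: "e \<in> H"
      obtain u v where uv: "e = (u, v)" by (cases e)
      have uvV: "u \<in> V" "v \<in> V" using HV e uv by auto
      let ?H = "H - {(u, v)}" and ?T = "T (u, v)"
      have t: "?T \<subseteq> V" "?T \<noteq> {}" "V - ?T - out_nbhd ?H ?T \<noteq> {}" "card (out_nbhd ?H ?T) < k"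
        using T e uv by blast+
      have HV1: "?H \<subseteq> V \<times> V" using HV by auto
      \<comment> \<open>With \<open>r\<close> in the separator the arc is counted by
        \<open>B r\<close>, beyond it by \<open>M1\<close>, and in \<open>?T\<close> by
        \<open>M2\<close> for the reversed arc.\<close>
      consider "r \<in> out_nbhd ?H ?T" | "r \<in> V - ?T - out_nbhd ?H ?T" | "r \<in> ?T" using r(1) by blast
      then show "e \<in> B r \<union> (SIGMA u:V. M1 u) \<union> (SIGMA v:V. M2 v)\<inverse>"
      proof cases
        case 1
        then show ?thesis using e uv by (auto simp: B_def)
      next
        case 2
        then have "v \<in> M1 u" unfolding M1_def using t e uv by auto
        then show ?thesis using uvV uv by blast
      next
        case 3
        let ?I = "V - ?T - out_nbhd ?H ?T"
        have eq: "H\<inverse> - {(v, u)} = ?H\<inverse>" by auto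
        have O: "out_nbhd (?H\<inverse>) ?I \<subseteq> out_nbhd ?H ?T" by (rule out_nbhd_converse_complement[OF HV1])
        have "card (out_nbhd (?H\<inverse>) ?I) \<le> card (out_nbhd ?H ?T)"
          by (rule card_mono[OF finite_out_nbhd[OF fin(1) HV1] O])
        then have less: "card (out_nbhd (?H\<inverse>) ?I) < k" using t(4) by simp
        have "r \<notin> out_nbhd ?H ?T" using 3 by (auto simp: out_nbhd_def)
        then have rI: "r \<in> V - ?I - out_nbhd (?H\<inverse>) ?I" using 3 O r(1) by blast
        have "\<exists>T\<subseteq>V. T \<noteq> {} \<and> r \<in> V - T - out_nbhd (?H\<inverse>) T \<and> card (out_nbhd (?H\<inverse>) T) < k"
          by (intro exI[of _ ?I] conjI t(3) rI less) blast
        then have "u \<in> M2 v" using e uv unfolding eq[symmetric] M2_def by simp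
        then show ?thesis using uvV uv by blast
      qed
    qed
    have finM: "finite (M1 u)" "finite (M2 v)" for u v
      using finite_subset[of "M1 u" "H `` {u}"] finite_subset[of "M2 v" "H\<inverse> `` {v}"] finH
      by (auto simp: M1_def M2_def)
    have Sigma_bound: "card (SIGMA u:V. M u) \<le> k * card V" if "\<And>u. finite (M u) \<and> card (M u) \<le> k" for M :: "'a \<Rightarrow> 'a set"
    proof (rule card_le_sum_out_degrees[OF fin(1)])
      fix u assume "u \<in> V"
      then have "(SIGMA u:V. M u) `` {u} = M u" by auto
      then show "finite ((SIGMA u:V. M u) `` {u}) \<and> card ((SIGMA u:V. M u) `` {u}) \<le> k" using that by simp
    qed auto
    have c1: "card (SIGMA u:V. M1 u) \<le> k * card V"
      by (rule Sigma_bound) (use M1 finM in auto)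
    have c2: "card (SIGMA v:V. M2 v) \<le> k * card V"
      by (rule Sigma_bound) (use M2 finM in auto)
    have finB: "finite (B r)" using finH by (simp add: B_def)
    have "card H \<le> card (B r \<union> (SIGMA u:V. M1 u) \<union> (SIGMA v:V. M2 v)\<inverse>)"
      using finB fin finM by (intro card_mono[OF _ sub]) auto
    also have "\<dots> \<le> card (B r) + card (SIGMA u:V. M1 u) + card ((SIGMA v:V. M2 v)\<inverse>)"
      by (meson add_le_mono1 card_Un_le order_trans)
    finally have cH: "card H \<le> card (B r) + 2 * (k * card V)" using c1 c2 by (simp add: card_inverse)
    \<comment> \<open>As \<open>card V\<close> is at least \<open>2 * k\<close>, at most half of the
      arcs are in \<open>B r\<close>; this doubles \<open>2 * k * card V\<close>.\<close>
    have "2 * (card V * card (B r)) \<le> 2 * k * card H" using r(2) by simp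
    also have "\<dots> \<le> card V * card H" using False by (intro mult_le_mono1) simp
    finally have "card V * (2 * card (B r)) \<le> card V * card H" by simp
    then have "2 * card (B r) \<le> card H" by (rule mult_left_le_imp_le) (use fin in \<open>simp add: card_gt_0_iff\<close>)
    then show ?thesis using cH by simp
  qed
  then show ?thesis using H by blast
qed

section \<open>Strong connectivity versus its cut form, and the conclusion\<close>

lemma strongly_k_connected_imp_arc_k_conn:
  fixes D :: "'a pair_pre_digraph"
  assumes D: "strongly_k_connected k (with_proj D)" and arcs: "parcs D \<subseteq> pverts D \<times> pverts D"
  shows "arc_k_conn (pverts D) k (parcs D)"
  unfolding arc_k_conn_def
proof (intro allI impI)
  fix T assume T: "T \<subseteq> pverts D" "T \<noteq> {}" "pverts D - T - out_nbhd (parcs D) T \<noteq> {}"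
  let ?S = "out_nbhd (parcs D) T"
  show "k \<le> card ?S"
  proof (rule ccontr)
    \<comment> \<open>After the deletion of \<open>?S\<close> no arc leaves \<open>T\<close>, so
      \<open>z\<close> is not reachable from \<open>u\<close>.\<close>
    assume "\<not> k \<le> card ?S"
    moreover have "?S \<subseteq> pverts D" by (rule out_nbhd_subset[OF arcs])
    ultimately have sc: "strongly_connected (with_proj D \<restriction> (pverts D - ?S))"
      using D by (simp add: strongly_k_connected_def)
    obtain u z where u: "u \<in> T" and z: "z \<in> pverts D - T - ?S" using T by blast
    have TS: "T \<inter> ?S = {}" by (auto simp: out_nbhd_def)
    have "u \<in> pverts D - ?S" "z \<in> pverts D - ?S" using u z T TS by auto
    then have "(u, z) \<in> rtrancl_on (pverts D - ?S) (arcs_ends (with_proj D \<restriction> (pverts D - ?S)))"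
      using sc by (simp add: strongly_connected_def reachable_def)
    then have "z \<in> T"
    proof (induction rule: rtrancl_on_induct)
      case (step x y)
      then have "(x, y) \<in> parcs D" by (auto simp: arcs_ends_conv)
      then show ?case using step by (auto simp: out_nbhd_iff)
    qed (rule u)
    then show False using z by simp
  qed
qed

text \<open>After deleting \<open>S\<close>, the set reachable from \<open>u\<close> has all its
  out-neighbours in \<open>S\<close>, hence fewer than \<open>k\<close>; the cut condition leaves
  nothing beyond it and \<open>S\<close>.\<close>

lemma arc_k_conn_imp_strongly_k_connected:
  assumes fin: "finite V" and H: "H \<subseteq> V \<times> V" and conn: "arc_k_conn V k H" and n: "k + 1 \<le> card V"
  shows "strongly_k_connected k (with_proj \<lparr>pverts = V, parcs = H\<rparr>)"
proof -
  let ?H = "with_proj \<lparr>pverts = V, parcs = H\<rparr>"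
  have "strongly_connected (?H \<restriction> (V - S))" if S: "S \<subseteq> V" "card S < k" for S
  proof
    have "V \<noteq> S" using S n by auto
    then show "verts (?H \<restriction> (V - S)) \<noteq> {}" using S by auto
    fix u v assume uv: "u \<in> verts (?H \<restriction> (V - S))" "v \<in> verts (?H \<restriction> (V - S))"
    let ?r = "rtrancl_on (V - S) (arcs_ends (?H \<restriction> (V - S)))"
    let ?T = "{w. (u, w) \<in> ?r}"
    have uT: "u \<in> ?T" using uv by auto
    have TV: "?T \<subseteq> V - S" using in_rtrancl_on_in_F by fastforce
    have "out_nbhd H ?T \<subseteq> S"
    proof
      fix y assume "y \<in> out_nbhd H ?T"
      then obtain x where x: "(u, x) \<in> ?r" "(x, y) \<in> H" "(u, y) \<notin> ?r" by (auto simp: out_nbhd_iff)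
      show "y \<in> S"
      proof (rule ccontr)
        assume "y \<notin> S"
        then have y: "y \<in> V - S" using x H by auto
        have "x \<in> V - S" using x(1) TV by auto
        then have "(x, y) \<in> arcs_ends (?H \<restriction> (V - S))" using x(2) y by (force simp: arcs_ends_conv)
        then have "(u, y) \<in> ?r" using x(1) y by (auto intro: rtrancl_on_into_rtrancl_on)
        then show False using x(3) by simp
      qed
    qed
    then have sub: "out_nbhd H ?T \<subseteq> S" "card (out_nbhd H ?T) < k"
      using card_mono[of S "out_nbhd H ?T"] S finite_subset[OF S(1) fin] by auto
    have "?T \<subseteq> V" "?T \<noteq> {}" using TV uT by blast+
    then have "V - ?T - out_nbhd H ?T = {}" using arc_k_connD[OF conn, of ?T] sub(2) by linarith
    then have "v \<in> ?T" using uv sub(1) by auto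
    then show "u \<rightarrow>\<^sup>*\<^bsub>?H \<restriction> (V - S)\<^esub> v" by (simp add: reachable_def)
  qed
  then show ?thesis using n by (simp add: strongly_k_connected_def)
qed

theorem theorem6p1:
  fixes D :: "'a pair_pre_digraph" and k n d :: nat
  assumes "k \<ge> 1" and "n \<ge> 1"
    and "pair_digraph D"
    and "card (pverts D) = n"
    and "strongly_k_connected k (with_proj D)"
    and "max_non_degree (with_proj D) \<le> d"
  shows "\<exists>H :: 'a pair_pre_digraph.
           spanning (with_proj H) (with_proj D) \<and>
           strongly_k_connected k (with_proj H) \<and>
           card (parcs H) \<le> k * n + 790 * k * d + 790 * k\<^sup>2"
proof -
  interpret pair_digraph D by (rule assms(3))
  let ?V = "pverts D" and ?E = "parcs D"
  have fin: "finite ?V" by (rule pair_finite_verts)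
  have arcs: "?E \<subseteq> ?V \<times> ?V" using in_arcsD1 in_arcsD2 by auto
  have ne: "?V \<noteq> {}" using assms(2,4) by auto
  have k_conn: "arc_k_conn ?V k ?E" by (rule strongly_k_connected_imp_arc_k_conn[OF assms(5) arcs])
  have deg: "card {w\<in>?V. w \<noteq> v \<and> (v, w) \<notin> ?E \<and> (w, v) \<notin> ?E} \<le> d" if v: "v \<in> ?V" for v
  proof -
    have "card (non_neighbours (with_proj D) v) \<le> max_non_degree (with_proj D)"
      unfolding max_non_degree_def using fin v by (intro Max_ge) auto
    then show ?thesis using assms(6) by (simp add: non_neighbours_def)
  qed
  interpret dense_digraph ?V ?E k d
  proof
    show "(v, v) \<notin> ?E" for v using pair_no_loops by fastforce
    show "k \<le> card (out_nbhd ?E T)" if "T \<subseteq> ?V" "T \<noteq> {}" "?V - T - out_nbhd ?E T \<noteq> {}" for T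
      by (rule arc_k_connD[OF k_conn that])
  qed (use fin arcs assms(1) deg in auto)
  have "\<exists>H\<subseteq>?E. arc_k_conn ?V k H \<and> card H \<le> k * n + 790 * k * d + 790 * k\<^sup>2"
  proof (cases "120 * k + 61 * d \<le> card ?V")
    case True
    then show ?thesis using large_case assms(4) by simp
  next
    case False
    obtain H where H: "H \<subseteq> ?E" "arc_k_conn ?V k H" "card H \<le> 4 * k * n"
      using sparse_arc_k_conn[OF fin ne arcs k_conn assms(1)] assms(4) by auto
    \<comment> \<open>The excess of \<open>4 * k * n\<close> over \<open>k * n\<close> is absorbed
      by the additive terms, since \<open>n\<close> is below
      \<open>120 * k + 61 * d\<close>.\<close>
    have "(3 * k) * n \<le> (3 * k) * (120 * k + 61 * d)" using False assms(4) by (intro mult_le_mono2) simp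
    then have "card H \<le> k * n + 790 * (k * d) + 790 * (k * k)" using H(3) by (simp add: algebra_simps)
    then show ?thesis using H by (auto simp: power2_eq_square mult.assoc)
  qed
  then obtain H where H: "H \<subseteq> ?E" "arc_k_conn ?V k H" "card H \<le> k * n + 790 * k * d + 790 * k\<^sup>2" by blast
  let ?H = "\<lparr>pverts = ?V, parcs = H\<rparr>"
  have HV: "H \<subseteq> ?V \<times> ?V" using H(1) arcs by blast
  have "wf_digraph (with_proj ?H)" using HV by unfold_locales auto
  moreover have "wf_digraph (with_proj D)" by unfold_locales
  ultimately have "spanning (with_proj ?H) (with_proj D)"
    using H(1) by (simp add: spanning_def subgraph_def compatible_def)
  moreover have "strongly_k_connected k (with_proj ?H)"
    using assms(5) by (intro arc_k_conn_imp_strongly_k_connected[OF fin HV H(2)]) (simp add: strongly_k_connected_def)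
  ultimately show ?thesis using H(3) by (intro exI[of _ ?H]) simp
qed

end
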